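(* Let $\mathfrak{R}$ be an expansion of $(\mathbb{R},<,+,\mathbb{Z})$ by subsets of various $\mathbb{Z}^n$ (any number of such sets, with $n$ allowed to vary). Then $\mathfrak{R}$ is PCC, CC or QCC if and only if it defines all arithmetic sets.
   Context: $\mathbb{N}$ is the set of nonnegative integers. An arithmetic set is a subset of some $\mathbb{N}^n$ that is definable in $(\mathbb{N},+,\cdot\,)$. All structures $\mathfrak{R}$ are first-order structures with underlying set $\mathbb{R}$. "Definable" means definable with parameters; definable sets are subsets of $\mathbb{R}^n$ for arbitrary $n$. Each $\mathbb{R}^n$ has its usual topology and subsets carry the subspace topology. A structure on $\mathbb{R}$ is PCC (path-component closed) if for every definable set $E$, each path component of $E$ is definable; it is CC (component closed) if for every definable set $E$, each connected component of $E$ is definable; it is QCC (quasicomponent closed) if for every definable set $E$, each quasicomponent of $E$ is definable. (The quasicomponent of a point $x$ in a space $E$ is the intersection of all clopen subsets of $E$ containing $x$.) *)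

theory Defs
  imports "HOL-Analysis.Analysis"
begin

section \<open>Tuples\<close>

text \<open>
  The Cartesian power \<open>X\<^sup>n\<close> is represented by the functions \<open>x :: nat \<Rightarrow> X\<close> that vanish outside
  \<open>{..<n}\<close>; the coordinates are \<open>x 0, \<dots>, x (n - 1)\<close>. For reals this is exactly the point set
  of the library's \<^const>\<open>Euclidean_space\<close>. A subset of \<open>X\<^sup>n\<close> is always accompanied by its
  dimension \<open>n\<close>.
\<close>

definition tuples :: "nat \<Rightarrow> (nat \<Rightarrow> 'a::zero) set" where
  "tuples n = {x. \<forall>i\<ge>n. x i = 0}"

definition tuple_of :: "'a::zero list \<Rightarrow> nat \<Rightarrow> 'a" where
  "tuple_of xs = (\<lambda>i. if i < length xs then xs ! i else 0)"

lemma tuple_of_in_tuples: "tuple_of xs \<in> tuples (length xs)"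
  by (simp add: tuples_def tuple_of_def)

lemma topspace_Euclidean_space_eq_tuples: "topspace (Euclidean_space n) = tuples n"
  by (simp add: tuples_def topspace_Euclidean_space)

section \<open>First-order structures and definability\<close>

text \<open>
  The symbols of a language are elements of the types \<open>'f\<close> and \<open>'r\<close>, restricted to the sets \<open>fun_syms\<close>
  and \<open>rel_syms\<close>. The underlying set of the structure is the whole type \<open>'a\<close>.
\<close>

record ('f, 'r, 'a) fo_structure =
  fun_syms :: "'f set"
  fun_arity :: "'f \<Rightarrow> nat"
  fun_interp :: "'f \<Rightarrow> (nat \<Rightarrow> 'a) \<Rightarrow> 'a"
  rel_syms :: "'r set"
  rel_arity :: "'r \<Rightarrow> nat"
  rel_interp :: "'r \<Rightarrow> (nat \<Rightarrow> 'a) set"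

datatype 'f fo_term = Var nat | Fun 'f "'f fo_term list"

datatype ('f, 'r) fo_formula =
    Equal "'f fo_term" "'f fo_term"
  | Rel 'r "'f fo_term list"
  | Neg "('f, 'r) fo_formula"
  | Conj "('f, 'r) fo_formula" "('f, 'r) fo_formula"
  | Exists nat "('f, 'r) fo_formula"

fun term_ok :: "('f, 'r, 'a) fo_structure \<Rightarrow> 'f fo_term \<Rightarrow> bool" where
  "term_ok M (Var i) \<longleftrightarrow> True"
| "term_ok M (Fun f ts) \<longleftrightarrow>
     f \<in> fun_syms M \<and> length ts = fun_arity M f \<and> (\<forall>t\<in>set ts. term_ok M t)"

fun formula_ok :: "('f, 'r, 'a) fo_structure \<Rightarrow> ('f, 'r) fo_formula \<Rightarrow> bool" where
  "formula_ok M (Equal s t) \<longleftrightarrow> term_ok M s \<and> term_ok M t"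
| "formula_ok M (Rel r ts) \<longleftrightarrow>
     r \<in> rel_syms M \<and> length ts = rel_arity M r \<and> (\<forall>t\<in>set ts. term_ok M t)"
| "formula_ok M (Neg \<phi>) \<longleftrightarrow> formula_ok M \<phi>"
| "formula_ok M (Conj \<phi> \<psi>) \<longleftrightarrow> formula_ok M \<phi> \<and> formula_ok M \<psi>"
| "formula_ok M (Exists i \<phi>) \<longleftrightarrow> formula_ok M \<phi>"

fun term_val :: "('f, 'r, 'a::zero) fo_structure \<Rightarrow> (nat \<Rightarrow> 'a) \<Rightarrow> 'f fo_term \<Rightarrow> 'a" where
  "term_val M e (Var i) = e i"
| "term_val M e (Fun f ts) = fun_interp M f (tuple_of (map (term_val M e) ts))"

fun satisfies :: "('f, 'r, 'a::zero) fo_structure \<Rightarrow> (nat \<Rightarrow> 'a) \<Rightarrow> ('f, 'r) fo_formula \<Rightarrow> bool" where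
  "satisfies M e (Equal s t) \<longleftrightarrow> term_val M e s = term_val M e t"
| "satisfies M e (Rel r ts) \<longleftrightarrow> tuple_of (map (term_val M e) ts) \<in> rel_interp M r"
| "satisfies M e (Neg \<phi>) \<longleftrightarrow> \<not> satisfies M e \<phi>"
| "satisfies M e (Conj \<phi> \<psi>) \<longleftrightarrow> satisfies M e \<phi> \<and> satisfies M e \<psi>"
| "satisfies M e (Exists i \<phi>) \<longleftrightarrow> (\<exists>a. satisfies M (e(i := a)) \<phi>)"

text \<open>
  Definability with parameters: the variables \<open>0, \<dots>, n - 1\<close> stand for the coordinates, and
  \<open>p\<close> assigns parameters to the remaining variables, only finitely many of which occur in \<open>\<phi>\<close>.
\<close>

definition definable :: "('f, 'r, 'a::zero) fo_structure \<Rightarrow> nat \<Rightarrow> (nat \<Rightarrow> 'a) set \<Rightarrow> bool" where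
  "definable M n E \<longleftrightarrow>
     (\<exists>\<phi> p. formula_ok M \<phi> \<and>
        E = {x \<in> tuples n. satisfies M (\<lambda>i. if i < n then x i else p i) \<phi>})"

section \<open>Component-closed structures on the reals\<close>

definition PCC :: "('f, 'r, real) fo_structure \<Rightarrow> bool" where
  "PCC M \<longleftrightarrow> (\<forall>n E. definable M n E \<longrightarrow>
     (\<forall>C \<in> path_components_of (subtopology (Euclidean_space n) E). definable M n C))"

definition CC :: "('f, 'r, real) fo_structure \<Rightarrow> bool" where
  "CC M \<longleftrightarrow> (\<forall>n E. definable M n E \<longrightarrow>
     (\<forall>C \<in> connected_components_of (subtopology (Euclidean_space n) E). definable M n C))"

definition QCC :: "('f, 'r, real) fo_structure \<Rightarrow> bool" where
  "QCC M \<longleftrightarrow> (\<forall>n E. definable M n E \<longrightarrow>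
     (\<forall>C \<in> quasi_components_of (subtopology (Euclidean_space n) E). definable M n C))"

section \<open>Arithmetic sets\<close>

datatype arith_fun = Add | Mult

text \<open>
  The structure \<open>(\<nat>, +, \<cdot>)\<close>. It has no relation symbols besides equality, so \<open>rel_arity\<close> and
  \<open>rel_interp\<close> are irrelevant.
\<close>

definition nat_arith :: "(arith_fun, unit, nat) fo_structure" where
  "nat_arith =
     \<lparr> fun_syms = {Add, Mult},
       fun_arity = (\<lambda>_. 2),
       fun_interp = (\<lambda>f x. case f of Add \<Rightarrow> x 0 + x 1 | Mult \<Rightarrow> x 0 * x 1),
       rel_syms = {},
       rel_arity = (\<lambda>_. 0),
       rel_interp = (\<lambda>_. {}) \<rparr>"

text \<open>
  Allowing parameters makes no difference here, since every natural number is definable in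
  \<open>(\<nat>, +, \<cdot>)\<close> without parameters.
\<close>

definition arithmetic :: "nat \<Rightarrow> (nat \<Rightarrow> nat) set \<Rightarrow> bool" where
  "arithmetic n A \<longleftrightarrow> definable nat_arith n A"

definition defines_all_arithmetic :: "('f, 'r, real) fo_structure \<Rightarrow> bool" where
  "defines_all_arithmetic M \<longleftrightarrow>
     (\<forall>n A. arithmetic n A \<longrightarrow> definable M n ((\<lambda>x. real \<circ> x) ` A))"

section \<open>Expansions of the ordered additive group of reals with the integers\<close>

datatype add_fun = Plus

text \<open>
  The symbol \<open>IntRel n A\<close> names the subset \<open>A\<close> of \<open>\<int>\<^sup>n\<close>, regarded as a subset of \<open>\<real>\<^sup>n\<close>.
\<close>

datatype exp_rel = Less | IsInt | IntRel nat "(nat \<Rightarrow> int) set"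

text \<open>
  \<open>(\<real>, <, +, \<int>)\<close> expanded by all \<open>A \<subseteq> \<int>\<^sup>n\<close> with \<open>(n, A) \<in> \<A>\<close>.
\<close>

definition int_expansion :: "(nat \<times> (nat \<Rightarrow> int) set) set \<Rightarrow> (add_fun, exp_rel, real) fo_structure" where
  "int_expansion \<A> =
     \<lparr> fun_syms = {Plus},
       fun_arity = (\<lambda>_. 2),
       fun_interp = (\<lambda>_ x. x 0 + x 1),
       rel_syms = {Less, IsInt} \<union> {IntRel n A | n A. (n, A) \<in> \<A>},
       rel_arity = (\<lambda>r. case r of Less \<Rightarrow> 2 | IsInt \<Rightarrow> 1 | IntRel n A \<Rightarrow> n),
       rel_interp = (\<lambda>r. case r of
           Less \<Rightarrow> {x \<in> tuples 2. x 0 < x 1}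
         | IsInt \<Rightarrow> {x \<in> tuples 1. x 0 \<in> \<int>}
         | IntRel n A \<Rightarrow> (\<lambda>x. real_of_int \<circ> x) ` A) \<rparr>"

end

theory Submission
  imports Defs "HOL-Number_Theory.Cong" "HOL-Library.Nat_Bijection"
begin

text \<open>
  Both implications reduce to the definability of the graph of multiplication on \<open>\<nat>\<close>, which is
  equivalent to the definability of all arithmetic sets.

  If the structure is component closed, multiplication is read off a component of a set that is
  definable in \<open>(\<real>, <, +, \<int>)\<close>: a locally finite union of segments of slopes \<open>0\<close> and \<open>\<plusminus>1\<close> along
  which a counter is increased by \<open>a\<close> in each row. The component of the origin is
  path-connected and clopen, so that the three notions of component agree on it.

  Conversely, separating integer and fractional parts turns every definable set into a locally finite
  union of integer translates of finitely many polyhedral cells, the set of translates being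
  definable. Whether two cells touch depends only on their types and on the difference of the
  translations. So the components, in each of the three senses, are the unions of the cells over the
  connected components of a graph on \<open>\<int>\<^sup>n\<close> with finitely many kinds of edges, and reachability in that
  graph is definable with the help of Goedel's beta function.
\<close>

section \<open>Definable predicates and functions\<close>

text \<open>The structure may contain arbitrary subsets of Z^n, about which nothing is known, so no
  description of its definable sets of integers is available. What helps is that such a subset sees
  little of the reals: terms with real arguments have integral values only if their fractional
  contributions are integers, and these are carries from a finite range. A quantifier over a real
  number therefore splits. Over the integer part it is kept inside the structure as it stands; only
  over the fractional part, in [0, 1), is it eliminated, and there the constraints are linear. For
  the resulting cells, clopenness of a class comes from local finiteness: near a point only those
  cells matter whose closure contains it. Path-connectedness needs more than convexity of the cells,
  because touching cells share a point that may lie in only one of them: a segment towards a point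
  of the closure must stay in the cell up to its last point. The finite list of pairs of cell types
  and displacements that touch is fixed outside the structure. Only the conditions on integer parts
  and the search for a path in the graph have to be expressed by formulas.\<close>

primrec rename_term :: "(nat \<Rightarrow> nat) \<Rightarrow> 'f fo_term \<Rightarrow> 'f fo_term" where
  "rename_term \<sigma> (Var i) = Var (\<sigma> i)"
| "rename_term \<sigma> (Fun f ts) = Fun f (map (rename_term \<sigma>) ts)"

primrec rename :: "(nat \<Rightarrow> nat) \<Rightarrow> ('f, 'r) fo_formula \<Rightarrow> ('f, 'r) fo_formula" where
  "rename \<sigma> (Equal s t) = Equal (rename_term \<sigma> s) (rename_term \<sigma> t)"
| "rename \<sigma> (Rel r ts) = Rel r (map (rename_term \<sigma>) ts)"
| "rename \<sigma> (Neg \<phi>) = Neg (rename \<sigma> \<phi>)"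
| "rename \<sigma> (Conj \<phi> \<psi>) = Conj (rename \<sigma> \<phi>) (rename \<sigma> \<psi>)"
| "rename \<sigma> (Exists i \<phi>) = Exists (\<sigma> i) (rename \<sigma> \<phi>)"

lemma term_ok_rename [simp]: "term_ok M (rename_term \<sigma> t) \<longleftrightarrow> term_ok M t"
  by (induction t) auto

lemma formula_ok_rename [simp]: "formula_ok M (rename \<sigma> \<phi>) \<longleftrightarrow> formula_ok M \<phi>"
  by (induction \<phi>) auto

lemma term_val_rename: "term_val M e (rename_term \<sigma> t) = term_val M (\<lambda>i. e (\<sigma> i)) t"
proof (induction t)
  case (Fun f ts)
  then have "map (term_val M e \<circ> rename_term \<sigma>) ts = map (term_val M (\<lambda>i. e (\<sigma> i))) ts"
    by simp
  then show ?case by (simp only: rename_term.simps term_val.simps map_map)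
qed simp

text \<open>Injectivity matters at quantifiers: overwriting the variable \<open>\<sigma> i\<close>
  must leave all other \<open>\<sigma> k\<close> alone.\<close>

lemma satisfies_rename:
  assumes "inj \<sigma>"
  shows "satisfies M e (rename \<sigma> \<phi>) \<longleftrightarrow> satisfies M (\<lambda>i. e (\<sigma> i)) \<phi>"
proof (induction \<phi> arbitrary: e)
  case (Rel r ts)
  have "map (term_val M e) (map (rename_term \<sigma>) ts) = map (term_val M (\<lambda>i. e (\<sigma> i))) ts"
    by (simp add: term_val_rename)
  then show ?case by (simp only: rename.simps satisfies.simps)
next
  case (Exists i \<phi>)
  have "(\<lambda>k. (e(\<sigma> i := a)) (\<sigma> k)) = (\<lambda>k. e (\<sigma> k))(i := a)" for a
    using assms by (auto simp: fun_eq_iff inj_eq)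
  then show ?case using Exists by simp
qed (simp_all add: term_val_rename)

lemma term_val_finite_dep:
  "\<exists>N. \<forall>e e'. (\<forall>i<N. e i = e' i) \<longrightarrow> term_val M e t = term_val M e' t"
proof (induction t)
  case (Var i)
  show ?case by (rule exI[of _ "Suc i"]) simp
next
  case (Fun f ts)
  then have "\<exists>N. \<forall>e e'. (\<forall>i<N. e i = e' i) \<longrightarrow> map (term_val M e) ts = map (term_val M e') ts"
  proof (induction ts)
    case (Cons t ts)
    obtain K where
      K: "\<And>e e'. \<forall>i<K. e i = e' i \<Longrightarrow> term_val M e t = term_val M e' t"
      using Cons.prems[of t, OF list.set_intros(1)] by blast
    have "\<exists>L. \<forall>e e'. (\<forall>i<L. e i = e' i) \<longrightarrow> map (term_val M e) ts = map (term_val M e') ts"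
      by (rule Cons.IH) (rule Cons.prems, simp)
    then obtain L where
      L: "\<And>e e'. \<forall>i<L. e i = e' i \<Longrightarrow> map (term_val M e) ts = map (term_val M e') ts"
      by blast
    have "map (term_val M e) (t # ts) = map (term_val M e') (t # ts)"
      if "\<forall>i<max K L. e i = e' i" for e e'
      using K[of e e'] L[of e e'] that by simp
    then show ?case by blast
  qed simp
  then obtain N where
    "\<And>e e'. \<forall>i<N. e i = e' i \<Longrightarrow> map (term_val M e) ts = map (term_val M e') ts" by blast
  then have "term_val M e (Fun f ts) = term_val M e' (Fun f ts)" if "\<forall>i<N. e i = e' i" for e e'
    unfolding term_val.simps using that by metis
  then show ?case by blast
qed

text \<open>A formula contains finitely many variables. This provides fresh variables for
  quantifiers and reduces substitutions for all variables to finitely many.\<close>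

lemma satisfies_finite_dep:
  "\<exists>N. \<forall>e e'. (\<forall>i<N. e i = e' i) \<longrightarrow> satisfies M e \<phi> = satisfies M e' \<phi>"
proof (induction \<phi>)
  case (Equal s t)
  obtain K where K: "\<And>e e'. \<forall>i<K. e i = e' i \<Longrightarrow> term_val M e s = term_val M e' s"
    using term_val_finite_dep by blast
  obtain L where L: "\<And>e e'. \<forall>i<L. e i = e' i \<Longrightarrow> term_val M e t = term_val M e' t"
    using term_val_finite_dep by blast
  have "satisfies M e (Equal s t) = satisfies M e' (Equal s t)"
    if "\<forall>i<max K L. e i = e' i" for e e'
    using K[of e e'] L[of e e'] that by simp
  then show ?case by blast
next
  case (Rel r ts)
  have "\<exists>N. \<forall>e e'. (\<forall>i<N. e i = e' i) \<longrightarrow> map (term_val M e) ts = map (term_val M e') ts"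
  proof (induction ts)
    case (Cons t ts)
    obtain K where
      K: "\<And>e e'. \<forall>i<K. e i = e' i \<Longrightarrow> term_val M e t = term_val M e' t"
      using term_val_finite_dep by blast
    from Cons obtain L where
      L: "\<And>e e'. \<forall>i<L. e i = e' i \<Longrightarrow> map (term_val M e) ts = map (term_val M e') ts" by blast
    have "map (term_val M e) (t # ts) = map (term_val M e') (t # ts)"
      if "\<forall>i<max K L. e i = e' i" for e e'
      using K[of e e'] L[of e e'] that by simp
    then show ?case by blast
  qed simp
  then obtain N where
    "\<And>e e'. \<forall>i<N. e i = e' i \<Longrightarrow> map (term_val M e) ts = map (term_val M e') ts" by blast
  then have "satisfies M e (Rel r ts) = satisfies M e' (Rel r ts)" if "\<forall>i<N. e i = e' i" for e e'
    unfolding satisfies.simps using that by metis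
  then show ?case by blast
next
  case (Neg \<phi>)
  then obtain N where N: "\<And>e e'. \<forall>i<N. e i = e' i \<Longrightarrow> satisfies M e \<phi> = satisfies M e' \<phi>"
    by blast
  have "satisfies M e (Neg \<phi>) = satisfies M e' (Neg \<phi>)" if "\<forall>i<N. e i = e' i" for e e'
    using N[OF that] by simp
  then show ?case by blast
next
  case (Conj \<phi> \<psi>)
  then obtain K L where K: "\<And>e e'. \<forall>i<K. e i = e' i \<Longrightarrow> satisfies M e \<phi> = satisfies M e' \<phi>"
    and L: "\<And>e e'. \<forall>i<L. e i = e' i \<Longrightarrow> satisfies M e \<psi> = satisfies M e' \<psi>" by blast
  have "satisfies M e (Conj \<phi> \<psi>) = satisfies M e' (Conj \<phi> \<psi>)"
    if "\<forall>i<max K L. e i = e' i" for e e'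
    using K[of e e'] L[of e e'] that by simp
  then show ?case by blast
next
  case (Exists j \<phi>)
  then obtain N where N: "\<And>e e'. \<forall>i<N. e i = e' i \<Longrightarrow> satisfies M e \<phi> = satisfies M e' \<phi>"
    by blast
  have "satisfies M (e(j := a)) \<phi> = satisfies M (e'(j := a)) \<phi>" if "\<forall>i<N. e i = e' i" for e e' a
    by (rule N) (simp add: that)
  then have "satisfies M e (Exists j \<phi>) = satisfies M e' (Exists j \<phi>)"
    if "\<forall>i<N. e i = e' i" for e e'
    unfolding satisfies.simps using that by blast
  then show ?case by blast
qed

section \<open>Predicates of environments\<close>

definition mix :: "(nat \<Rightarrow> 'a) \<Rightarrow> (nat \<Rightarrow> 'a) \<Rightarrow> nat \<Rightarrow> 'a" where
  "mix e p = (\<lambda>i. if even i then e (i div 2) else p (i div 2))"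

text \<open>
  Definability of predicates of environments rather than of subsets of a fixed power. The formula
  sees the environment \<open>e\<close> at the even variables and the parameters at the odd ones, so that there
  are always infinitely many free places for further parameters.
\<close>

definition dpred :: "('f, 'r, 'a::zero) fo_structure \<Rightarrow> ((nat \<Rightarrow> 'a) \<Rightarrow> bool) \<Rightarrow> bool" where
  "dpred M P \<longleftrightarrow> (\<exists>\<phi> p. formula_ok M \<phi> \<and> (\<forall>e. P e \<longleftrightarrow> satisfies M (mix e p) \<phi>))"

text \<open>The value occupies variable 0 and the arguments move up by one. Quantifiers introduce
  their variable in the same way in \<open>dpred_ex\<close>, so terms and formulas nest
  uniformly.\<close>

definition dfun :: "('f, 'r, 'a::zero) fo_structure \<Rightarrow> ((nat \<Rightarrow> 'a) \<Rightarrow> 'a) \<Rightarrow> bool" where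
  "dfun M g \<longleftrightarrow> dpred M (\<lambda>e. e 0 = g (\<lambda>i. e (Suc i)))"

lemma dpredI:
  assumes "formula_ok M \<phi>" "inj \<sigma>" "\<And>e. P e \<longleftrightarrow> satisfies M (\<lambda>i. mix e p (\<sigma> i)) \<phi>"
  shows "dpred M P"
  unfolding dpred_def
  by (rule exI[of _ "rename \<sigma> \<phi>"], rule exI[of _ p]) (simp add: assms satisfies_rename)

lemma dpred_not:
  assumes "dpred M P"
  shows "dpred M (\<lambda>e. \<not> P e)"
proof -
  from assms obtain \<phi> p where "formula_ok M \<phi>" "\<And>e. P e \<longleftrightarrow> satisfies M (mix e p) \<phi>"
    unfolding dpred_def by metis
  then show ?thesis
    unfolding dpred_def by (intro exI[of _ "Neg \<phi>"] exI[of _ p]) simp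
qed

lemma dpred_conj:
  assumes "dpred M P" "dpred M Q"
  shows "dpred M (\<lambda>e. P e \<and> Q e)"
proof -
  from assms obtain \<phi> p \<psi> q where ok: "formula_ok M \<phi>" "formula_ok M \<psi>"
    and *: "\<And>e. P e \<longleftrightarrow> satisfies M (mix e p) \<phi>" "\<And>e. Q e \<longleftrightarrow> satisfies M (mix e q) \<psi>"
    unfolding dpred_def by metis
  \<comment> \<open>The parameters of both formulas must coexist in one sequence:
    \<open>\<sigma>\<close> sends parameter \<open>k\<close> to place \<open>2 * k\<close> and
    \<open>\<tau>\<close> to place \<open>2 * k + 1\<close>, which is how \<open>mix p q\<close>
    stores them. Even variables stay fixed.\<close>
  define \<sigma> where "\<sigma> i = (if even i then i else 4 * (i div 2) + 1)" for i :: nat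
  define \<tau> where "\<tau> i = (if even i then i else 4 * (i div 2) + 3)" for i :: nat
  have inj: "inj \<sigma>" "inj \<tau>"
    unfolding inj_def \<sigma>_def \<tau>_def by (auto split: if_splits elim!: oddE)
  have mix: "mix e p' (2 * k + 1) = p' k" "mix e p' (2 * k) = e k" for k e p'
    by (simp_all add: mix_def)
  have odd: "\<sigma> (2 * k + 1) = 2 * (2 * k) + 1" "\<tau> (2 * k + 1) = 2 * (2 * k + 1) + 1" for k
    by (simp_all add: \<sigma>_def \<tau>_def)
  have even: "\<sigma> (2 * k) = 2 * k" "\<tau> (2 * k) = 2 * k" for k
    by (simp_all add: \<sigma>_def \<tau>_def)
  have "mix e (mix p q) (\<sigma> i) = mix e p i \<and> mix e (mix p q) (\<tau> i) = mix e q i" for e i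
  proof (cases "even i")
    case True
    then obtain k where k: "i = 2 * k" by blast
    show ?thesis unfolding k even mix by simp
  next
    case False
    then obtain k where k: "i = 2 * k + 1" by (rule oddE)
    show ?thesis unfolding k odd mix by simp
  qed
  then have "(\<lambda>i. mix e (mix p q) (\<sigma> i)) = mix e p" "(\<lambda>i. mix e (mix p q) (\<tau> i)) = mix e q" for e
    by auto
  then have "P e \<and> Q e \<longleftrightarrow> satisfies M (mix e (mix p q)) (Conj (rename \<sigma> \<phi>) (rename \<tau> \<psi>))" for e
    by (simp add: * satisfies_rename inj)
  then show ?thesis unfolding dpred_def using ok
    by (intro exI[of _ "Conj (rename \<sigma> \<phi>) (rename \<tau> \<psi>)"] exI[of _ "mix p q"]) simp
qed

lemma dpred_inj:
  assumes "dpred M P" "inj \<sigma>"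
  shows "dpred M (\<lambda>e. P (\<lambda>i. e (\<sigma> i)))"
proof -
  from assms obtain \<phi> p where ok: "formula_ok M \<phi>" and *: "\<And>e. P e \<longleftrightarrow> satisfies M (mix e p) \<phi>"
    unfolding dpred_def by metis
  define \<tau> where "\<tau> i = (if even i then 2 * \<sigma> (i div 2) else i)" for i :: nat
  have "inj \<tau>"
  proof (rule injI)
    fix i j assume eq: "\<tau> i = \<tau> j"
    then have "even i \<longleftrightarrow> even j" by (auto simp: \<tau>_def split: if_splits)
    then show "i = j" using eq injD[OF assms(2), of "i div 2" "j div 2"]
      by (auto simp: \<tau>_def split: if_splits)
  qed
  have mix: "mix (\<lambda>i. e (\<sigma> i)) p = (\<lambda>i. mix e p (\<tau> i))" for e
    by (auto simp: fun_eq_iff mix_def \<tau>_def)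
  show ?thesis
    by (rule dpredI[OF ok \<open>inj \<tau>\<close>, where p = p]) (simp only: * mix)
qed

lemma dpred_ex_upd:
  assumes "dpred M P"
  shows "dpred M (\<lambda>e. \<exists>a. P (e(i := a)))"
proof -
  from assms obtain \<phi> p where ok: "formula_ok M \<phi>" and *: "\<And>e. P e \<longleftrightarrow> satisfies M (mix e p) \<phi>"
    unfolding dpred_def by metis
  have "mix (e(i := a)) p = (mix e p)(2 * i := a)" for e a
    by (auto simp: fun_eq_iff mix_def)
  then show ?thesis
    unfolding dpred_def * using ok
    by (intro exI[of _ "Exists (2 * i) \<phi>"] exI[of _ p]) simp
qed

lemma dpred_finite_dep:
  assumes "dpred M P"
  obtains N where "\<And>e e'. (\<And>i. i < N \<Longrightarrow> e i = e' i) \<Longrightarrow> P e = P e'"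
proof -
  from assms obtain \<phi> p where *: "\<And>e. P e \<longleftrightarrow> satisfies M (mix e p) \<phi>"
    unfolding dpred_def by metis
  obtain N where N: "\<forall>e e'. (\<forall>i<N. e i = e' i) \<longrightarrow> satisfies M e \<phi> = satisfies M e' \<phi>"
    using satisfies_finite_dep by blast
  have "P e = P e'" if "\<And>i. i < N \<Longrightarrow> e i = e' i" for e e'
  proof -
    have "\<forall>i<N. mix e p i = mix e' p i" using that by (auto simp: mix_def)
    then show ?thesis using N * by blast
  qed
  then show thesis using that by blast
qed

text \<open>A formula quantifies by overwriting a variable, whereas this rule binds variable 0 of a
  shifted environment and can be iterated blindly. The two agree once the overwritten variable is
  one on which the predicate does not depend.\<close>

lemma dpred_ex:
  assumes "dpred M (\<lambda>e. Q (\<lambda>i. e (Suc i)) (e 0))"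
  shows "dpred M (\<lambda>e. \<exists>a. Q e a)"
proof -
  obtain N where N: "\<And>e e'. (\<And>i. i < N \<Longrightarrow> e i = e' i) \<Longrightarrow>
      Q (\<lambda>i. e (Suc i)) (e 0) = Q (\<lambda>i. e' (Suc i)) (e' 0)"
    using dpred_finite_dep[OF assms] by metis
  \<comment> \<open>The bound variable 0 goes to the fresh variable \<open>N\<close>, and
    \<open>Suc j\<close> goes back to \<open>j\<close>. The values from \<open>Suc N\<close> on only
    keep \<open>\<tau>\<close> injective.\<close>
  define \<tau> where "\<tau> i = (case i of 0 \<Rightarrow> N | Suc j \<Rightarrow> if j < N then j else Suc j)" for i
  have "inj \<tau>"
    by (auto simp: inj_def \<tau>_def split: nat.splits if_splits)
  from dpred_ex_upd[OF dpred_inj[OF assms this], of N]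
  have "dpred M (\<lambda>e. \<exists>a. Q (\<lambda>i. (e(N := a)) (\<tau> (Suc i))) ((e(N := a)) (\<tau> 0)))" .
  moreover have "Q (\<lambda>i. (e(N := a)) (\<tau> (Suc i))) ((e(N := a)) (\<tau> 0)) = Q e a" for e a
    using N[of "\<lambda>i. (e(N := a)) (\<tau> i)" "case_nat a e"]
    by (auto simp: \<tau>_def split: nat.splits)
  ultimately show ?thesis by simp
qed

text \<open>Parameters enter here: the constant is the value of an odd variable.\<close>

lemma dpred_var_eq_const: "dpred M (\<lambda>e. e i = c)"
proof (rule dpredI[of M "Equal (Var 0) (Var 1)" "\<lambda>k. if k = 0 then 2 * i else 2 * k + 1 + 2 * i" _ "\<lambda>_. c"])
  show "inj (\<lambda>k. if k = 0 then 2 * i else 2 * k + 1 + 2 * i)"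
    by (auto simp: inj_def split: if_splits)
qed (simp_all add: mix_def)

lemma dpred_var_eq_var: "dpred M (\<lambda>e. e i = e j)"
  unfolding dpred_def
  by (intro exI[of _ "Equal (Var (2 * i)) (Var (2 * j))"] exI) (simp add: mix_def)

lemma dfun_const [simp, intro]: "dfun M (\<lambda>e. c)"
  unfolding dfun_def by (rule dpred_var_eq_const)

lemma dfun_var [simp, intro]: "dfun M (\<lambda>e. e i)"
  unfolding dfun_def by (rule dpred_var_eq_var)

section \<open>Substitution of definable functions\<close>

text \<open>The substituted value is quantified: some \<open>a\<close> equals \<open>g e\<close>,
  and \<open>P\<close> holds with \<open>a\<close> in place \<open>i\<close>.\<close>

lemma dpred_subst1:
  assumes "dfun M g" "dpred M P"
  shows "dpred M (\<lambda>e. P (e(i := g e)))"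
proof -
  let ?\<sigma> = "Suc(i := 0)"
  have "inj ?\<sigma>" by (auto simp: inj_def split: if_splits)
  from dpred_inj[OF assms(2) this] have "dpred M (\<lambda>e. P (\<lambda>k. e (?\<sigma> k)))" .
  moreover have "(\<lambda>e. P (\<lambda>k. e (?\<sigma> k))) = (\<lambda>e. P ((\<lambda>k. e (Suc k))(i := e 0)))"
    by (intro ext arg_cong[of _ _ P]) auto
  ultimately have "dpred M (\<lambda>e. P ((\<lambda>k. e (Suc k))(i := e 0)))" by (rule back_subst)
  from dpred_conj[OF assms(1)[unfolded dfun_def] this]
  have "dpred M (\<lambda>e. \<exists>a. a = g e \<and> P (e(i := a)))" by (rule dpred_ex)
  then show ?thesis by simp
qed

lemma dfun_shift:
  assumes "dfun M g"
  shows "dfun M (\<lambda>e. g (\<lambda>j. e (N + j)))"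
proof -
  let ?\<sigma> = "\<lambda>k. case k of 0 \<Rightarrow> 0 | Suc j \<Rightarrow> Suc (N + j)"
  have "inj ?\<sigma>" by (auto simp: inj_def split: nat.splits)
  from dpred_inj[OF assms[unfolded dfun_def] this] show ?thesis
    unfolding dfun_def by simp
qed

text \<open>Each vacuous quantifier removes one of the \<open>N\<close> ignored leading
  variables.\<close>

lemma dpred_unshift:
  fixes M :: "('f, 'r, 'a::zero) fo_structure"
  assumes "dpred M (\<lambda>e. P (\<lambda>j. e (N + j)))"
  shows "dpred M P"
  using assms
proof (induction N)
  case (Suc N)
  then have "dpred M (\<lambda>e. P (\<lambda>j. e (Suc (N + j))))" by simp
  then have "dpred M (\<lambda>e. \<exists>a :: 'a. P (\<lambda>j. e (N + j)))" by (rule dpred_ex)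
  then show ?case using Suc.IH by simp
qed simp

text \<open>Substituting one coordinate after the other would let later functions read coordinates
  already overwritten. So \<open>h\<close> reads from a copy of the environment that starts at
  \<open>N\<close>, beyond the variables on which \<open>P\<close> depends;
  \<open>dpred_unshift\<close> removes the gap at the end.\<close>

lemma dpred_subst:
  assumes "dpred M P" "\<And>i. dfun M (\<lambda>e. h e i)"
  shows "dpred M (\<lambda>e. P (h e))"
proof -
  obtain N where N: "\<And>e e'. (\<And>i. i < N \<Longrightarrow> e i = e' i) \<Longrightarrow> P e = P e'"
    using dpred_finite_dep[OF assms(1)] by metis
  have "dpred M (\<lambda>e. P (\<lambda>i. if i < k then h (\<lambda>j. e (N + j)) i else e i))" if "k \<le> N" for k
    using that
  proof (induction k)
    case 0
    then show ?case using assms(1) by simp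
  next
    case (Suc k)
    let ?g = "\<lambda>e. h (\<lambda>j. e (N + j)) k"
    have "dfun M ?g" using dfun_shift[OF assms(2)] by simp
    from dpred_subst1[OF this Suc.IH, of k] Suc.prems
    have "dpred M (\<lambda>e. P (\<lambda>i. if i < k then h (\<lambda>j. (e(k := ?g e)) (N + j)) i else (e(k := ?g e)) i))"
      by simp
    moreover have "(\<lambda>i. if i < k then h (\<lambda>j. (e(k := ?g e)) (N + j)) i else (e(k := ?g e)) i) =
        (\<lambda>i. if i < Suc k then h (\<lambda>j. e (N + j)) i else e i)" for e
    proof -
      have "(\<lambda>j. (e(k := ?g e)) (N + j)) = (\<lambda>j. e (N + j))" using Suc.prems by auto
      then show ?thesis by (auto simp: fun_eq_iff less_Suc_eq)
    qed
    ultimately show ?case by simp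
  qed
  from this[of N] have "dpred M (\<lambda>e. P (\<lambda>i. if i < N then h (\<lambda>j. e (N + j)) i else e i))" by simp
  moreover have "P (\<lambda>i. if i < N then h (\<lambda>j. e (N + j)) i else e i) = P (h (\<lambda>j. e (N + j)))" for e
    by (rule N) simp
  ultimately have "dpred M (\<lambda>e. P (h (\<lambda>j. e (N + j))))" by simp
  then show ?thesis by (rule dpred_unshift)
qed

lemma dfun_subst:
  assumes "dfun M g" "\<And>i. dfun M (\<lambda>e. h e i)"
  shows "dfun M (\<lambda>e. g (h e))"
proof -
  let ?h = "\<lambda>e i. case i of 0 \<Rightarrow> e 0 | Suc j \<Rightarrow> h (\<lambda>k. e (Suc k)) j"
  have "dfun M (\<lambda>e. ?h e i)" for i
    using dfun_shift[OF assms(2), of 1] by (cases i) auto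
  from dpred_subst[OF assms(1)[unfolded dfun_def], of ?h, OF this] show ?thesis unfolding dfun_def by simp
qed

lemma dpred_true [simp, intro]: "dpred M (\<lambda>e. True)"
  using dpred_var_eq_var[of M 0 0] by simp

lemma dpred_disj:
  assumes "dpred M P" "dpred M Q"
  shows "dpred M (\<lambda>e. P e \<or> Q e)"
  using dpred_not[OF dpred_conj[OF dpred_not[OF assms(1)] dpred_not[OF assms(2)]]] by simp

lemma dpred_imp:
  assumes "dpred M P" "dpred M Q"
  shows "dpred M (\<lambda>e. P e \<longrightarrow> Q e)"
  using dpred_disj[OF dpred_not[OF assms(1)] assms(2)] by (simp only: imp_conv_disj)

lemma dpred_const [simp, intro]: "dpred M (\<lambda>e. b)"
  using dpred_not[OF dpred_true, of M] by (cases b) simp_all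

lemma dpred_bex:
  assumes "finite I" "\<And>i. i \<in> I \<Longrightarrow> dpred M (P i)"
  shows "dpred M (\<lambda>e. \<exists>i\<in>I. P i e)"
  using assms by (induction I rule: finite_induct) (auto intro: dpred_disj)

lemma dpred_ball:
  assumes "finite I" "\<And>i. i \<in> I \<Longrightarrow> dpred M (P i)"
  shows "dpred M (\<lambda>e. \<forall>i\<in>I. P i e)"
  using assms by (induction I rule: finite_induct) (auto intro: dpred_conj)

lemma dpred_subst2:
  assumes "dpred M (\<lambda>e. R (e 0) (e 1))" "dfun M f" "dfun M g"
  shows "dpred M (\<lambda>e. R (f e) (g e))"
proof -
  have "dfun M (\<lambda>e. if i = 0 then f e else g e)" for i :: nat
    using assms by (cases "i = 0") simp_all
  from dpred_subst[OF assms(1), where h = "\<lambda>e i. if i = 0 then f e else g e", OF this]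
  show ?thesis by simp
qed

lemma dpred_subst3:
  assumes "dpred M (\<lambda>e. R (e 0) (e 1) (e 2))" "dfun M f" "dfun M g" "dfun M h"
  shows "dpred M (\<lambda>e. R (f e) (g e) (h e))"
proof -
  have "dfun M (\<lambda>e. if i = 0 then f e else if i = 1 then g e else h e)" for i :: nat
    using assms by (cases "i = 0"; cases "i = 1") simp_all
  from dpred_subst[OF assms(1),
      where h = "\<lambda>e i. if i = 0 then f e else if i = 1 then g e else h e", OF this]
  show ?thesis by simp
qed

lemma dpred_eq:
  assumes "dfun M f" "dfun M g"
  shows "dpred M (\<lambda>e. f e = g e)"
  by (rule dpred_subst2[where R = "(=)", OF dpred_var_eq_var assms])

lemma dfun_Suc:
  assumes "dfun M g"
  shows "dfun M (\<lambda>e. g (\<lambda>i. e (Suc i)))"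
  using dfun_shift[OF assms, of 1] by simp

lemma dpred_Suc:
  assumes "dpred M P"
  shows "dpred M (\<lambda>e. P (\<lambda>i. e (Suc i)))"
  using dpred_inj[OF assms, of Suc] by simp

lemma dfun_if:
  assumes "dpred M P" "dfun M f" "dfun M g"
  shows "dfun M (\<lambda>e. if P e then f e else g e)"
proof -
  have "dpred M (\<lambda>e. (P (\<lambda>i. e (Suc i)) \<and> e 0 = f (\<lambda>i. e (Suc i))) \<or>
      (\<not> P (\<lambda>i. e (Suc i)) \<and> e 0 = g (\<lambda>i. e (Suc i))))"
    by (intro dpred_disj dpred_conj dpred_not dpred_Suc assms assms[unfolded dfun_def])
  moreover have "(\<lambda>e. (P (\<lambda>i. e (Suc i)) \<and> e 0 = f (\<lambda>i. e (Suc i))) \<or>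
      (\<not> P (\<lambda>i. e (Suc i)) \<and> e 0 = g (\<lambda>i. e (Suc i)))) =
      (\<lambda>e. e 0 = (if P (\<lambda>i. e (Suc i)) then f (\<lambda>i. e (Suc i)) else g (\<lambda>i. e (Suc i))))"
    by auto
  ultimately show ?thesis unfolding dfun_def by simp
qed

lemma dfunI_rel2:
  assumes "dpred M (\<lambda>e. R (e 0) (e 1) (e 2))" "\<And>r x y. R r x y \<longleftrightarrow> r = F x y"
    "dfun M f" "dfun M g"
  shows "dfun M (\<lambda>e. F (f e) (g e))"
  unfolding dfun_def
  using dpred_subst3[OF assms(1) dfun_var[of M 0] dfun_Suc[OF assms(3)] dfun_Suc[OF assms(4)]]
  by (simp add: assms(2))

lemma dfunI_rel1:
  assumes "dpred M (\<lambda>e. R (e 0) (e 1))" "\<And>r x. R r x \<longleftrightarrow> r = F x" "dfun M f"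
  shows "dfun M (\<lambda>e. F (f e))"
  unfolding dfun_def
  using dpred_subst2[OF assms(1) dfun_var[of M 0] dfun_Suc[OF assms(3)]]
  by (simp add: assms(2))

section \<open>Subsets of powers versus predicates of environments\<close>

lemma definable_imp_dpred:
  assumes "definable M n E"
  shows "dpred M (\<lambda>e. (\<lambda>i. if i < n then e i else 0) \<in> E)"
proof -
  from assms obtain \<phi> p where ok: "formula_ok M \<phi>"
    and E: "E = {x \<in> tuples n. satisfies M (\<lambda>i. if i < n then x i else p i) \<phi>}"
    unfolding definable_def by blast
  define \<sigma> where "\<sigma> i = (if i < n then 2 * i else 2 * i + 1)" for i :: nat
  have "inj \<sigma>" by (auto simp: inj_def \<sigma>_def split: if_splits)
  moreover have "(\<lambda>i. if i < n then if i < n then e i else 0 else p i) = (\<lambda>i. mix e p (\<sigma> i))" for e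
    by (auto simp: fun_eq_iff mix_def \<sigma>_def)
  moreover have "(\<lambda>i. if i < n then e i else 0) \<in> tuples n" for e :: "nat \<Rightarrow> 'c"
    by (simp add: tuples_def)
  ultimately show ?thesis using ok by (intro dpredI[of M \<phi> \<sigma> _ p]) (auto simp: E)
qed

lemma dpred_imp_definable:
  assumes "dpred M P" "\<And>x. x \<in> E \<longleftrightarrow> x \<in> tuples n \<and> P x"
  shows "definable M n E"
proof -
  from assms obtain \<phi> p where ok: "formula_ok M \<phi>" and *: "\<And>e. P e \<longleftrightarrow> satisfies M (mix e p) \<phi>"
    unfolding dpred_def by metis
  \<comment> \<open>The coordinates below \<open>n\<close> return to their places, everything else
    moves to \<open>n\<close> or beyond. There \<open>q\<close> supplies the old parameters, and 0
    for the coordinates from \<open>n\<close> on, which is their value in a tuple.\<close>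
  define \<sigma> where "\<sigma> i = (if even i \<and> i div 2 < n then i div 2 else n + i)" for i :: nat
  define q where "q i = (if even (i - n) then 0 else p ((i - n) div 2))" for i
  have "inj \<sigma>" by (auto simp: inj_def \<sigma>_def split: if_splits elim!: evenE)
  moreover have "(if \<sigma> i < n then x (\<sigma> i) else q (\<sigma> i)) = mix x p i" if "x \<in> tuples n" for x i
    using that by (cases "even i \<and> i div 2 < n") (auto simp: mix_def \<sigma>_def q_def tuples_def)
  ultimately have "P x \<longleftrightarrow> satisfies M (\<lambda>i. if i < n then x i else q i) (rename \<sigma> \<phi>)"
    if "x \<in> tuples n" for x
    using that by (simp add: * satisfies_rename)
  then show ?thesis unfolding definable_def using ok assms(2)
    by (intro exI[of _ "rename \<sigma> \<phi>"] exI[of _ q]) auto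
qed

section \<open>Basic definable relations on the reals\<close>

lemma dpred_var_less: "dpred (int_expansion \<A>) (\<lambda>e. e i < e j)"
  unfolding dpred_def
  by (intro exI[of _ "Rel Less [Var (2 * i), Var (2 * j)]"] exI)
    (simp add: mix_def int_expansion_def tuple_of_def tuples_def)

lemma dpred_less:
  assumes "dfun (int_expansion \<A>) f" "dfun (int_expansion \<A>) g"
  shows "dpred (int_expansion \<A>) (\<lambda>e. f e < g e)"
  by (rule dpred_subst2[where R = "(<)", OF dpred_var_less assms])

lemma dpred_le:
  assumes "dfun (int_expansion \<A>) f" "dfun (int_expansion \<A>) g"
  shows "dpred (int_expansion \<A>) (\<lambda>e. f e \<le> g e)"
  using dpred_not[OF dpred_less[OF assms(2,1)]] by (simp add: not_less)

lemma dpred_Ints: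
  assumes "dfun (int_expansion \<A>) f"
  shows "dpred (int_expansion \<A>) (\<lambda>e. f e \<in> \<int>)"
proof -
  have "dpred (int_expansion \<A>) (\<lambda>e. e 0 \<in> \<int>)"
    unfolding dpred_def
    by (intro exI[of _ "Rel IsInt [Var 0]"] exI)
      (simp add: mix_def int_expansion_def tuple_of_def tuples_def)
  from dpred_subst[OF this, of "\<lambda>e i. f e"] assms show ?thesis by simp
qed

lemma dfun_add:
  assumes "dfun (int_expansion \<A>) f" "dfun (int_expansion \<A>) g"
  shows "dfun (int_expansion \<A>) (\<lambda>e. f e + g e)"
proof (rule dfunI_rel2[where R = "\<lambda>r x y. r = x + y", OF _ _ assms])
  show "dpred (int_expansion \<A>) (\<lambda>e. e 0 = e 1 + e 2)"
    unfolding dpred_def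
    by (intro exI[of _ "Equal (Var 0) (Fun Plus [Var 2, Var 4])"] exI)
      (simp add: mix_def int_expansion_def tuple_of_def)
qed simp

lemma dfun_diff:
  assumes "dfun (int_expansion \<A>) f" "dfun (int_expansion \<A>) g"
  shows "dfun (int_expansion \<A>) (\<lambda>e. f e - g e)"
proof (rule dfunI_rel2[where R = "\<lambda>r x y. r + y = x", OF _ _ assms])
  show "dpred (int_expansion \<A>) (\<lambda>e. e 0 + e 2 = e 1)"
    by (intro dpred_eq dfun_add dfun_var)
qed auto

lemma dfun_uminus:
  assumes "dfun (int_expansion \<A>) f"
  shows "dfun (int_expansion \<A>) (\<lambda>e. - f e)"
  using dfun_diff[OF dfun_const[of _ 0] assms] by simp

lemma dfun_floor:
  assumes "dfun (int_expansion \<A>) f"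
  shows "dfun (int_expansion \<A>) (\<lambda>e. of_int \<lfloor>f e\<rfloor>)"
proof (rule dfunI_rel1[where R = "\<lambda>r x. r \<in> \<int> \<and> r \<le> x \<and> x < r + 1", OF _ _ assms])
  show "dpred (int_expansion \<A>) (\<lambda>e. e 0 \<in> \<int> \<and> e 0 \<le> e 1 \<and> e 1 < e 0 + 1)"
    by (intro dpred_conj dpred_Ints dpred_le dpred_less dfun_var dfun_add dfun_const)
  show "r \<in> \<int> \<and> r \<le> x \<and> x < r + 1 \<longleftrightarrow> r = of_int \<lfloor>x\<rfloor>" for r x :: real
    by (auto elim!: Ints_cases simp: floor_unique)
qed

text \<open>Conditions on integers are stated as predicates of real environments read through
  \<open>floor\<close>; on integer-valued functions the \<open>floor\<close> disappears.\<close>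

lemma dpred_of_int_subst:
  assumes "dpred (int_expansion \<A>) (\<lambda>e. D (\<lambda>i. \<lfloor>e i\<rfloor>))"
    "\<And>i. dfun (int_expansion \<A>) (\<lambda>e. of_int (h e i))"
  shows "dpred (int_expansion \<A>) (\<lambda>e. D (h e))"
  using dpred_subst[OF assms(1), of "\<lambda>e i. of_int (h e i)", OF assms(2)] by simp

lemma dfun_nat_floor:
  assumes "dfun (int_expansion \<A>) f"
  shows "dfun (int_expansion \<A>) (\<lambda>e. real (nat \<lfloor>f e\<rfloor>))"
proof -
  have "dfun (int_expansion \<A>) (\<lambda>e. if 0 \<le> f e then of_int \<lfloor>f e\<rfloor> else 0)"
    by (intro dfun_if dpred_le dfun_floor dfun_const assms)
  moreover have "(if 0 \<le> f e then of_int \<lfloor>f e\<rfloor> else 0) = real (nat \<lfloor>f e\<rfloor>)" for e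
    by (simp add: floor_less_zero)
  ultimately show ?thesis by simp
qed

text \<open>\<open>nat\<close> after \<open>floor\<close> maps the reals onto the naturals, so an
  unrestricted real quantifier serves as a quantifier over naturals.\<close>

lemma dpred_ex_nat:
  assumes "dpred (int_expansion \<A>) (\<lambda>e. Q (\<lambda>i. e (Suc i)) (nat \<lfloor>e 0\<rfloor>))"
  shows "dpred (int_expansion \<A>) (\<lambda>e. \<exists>n. Q e n)"
proof -
  have "(\<exists>n. Q e n) \<longleftrightarrow> (\<exists>x :: real. Q e (nat \<lfloor>x\<rfloor>))" for e
    by (metis floor_of_nat nat_int)
  then show ?thesis using dpred_ex[of _ "\<lambda>e x. Q e (nat \<lfloor>x\<rfloor>)", OF assms] by simp
qed

lemma dpred_all_nat:
  assumes "dpred (int_expansion \<A>) (\<lambda>e. Q (\<lambda>i. e (Suc i)) (nat \<lfloor>e 0\<rfloor>))"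
  shows "dpred (int_expansion \<A>) (\<lambda>e. \<forall>n. Q e n)"
  using dpred_not[OF dpred_ex_nat[of _ "\<lambda>e n. \<not> Q e n", OF dpred_not[OF assms]]] by simp

lemma dpred_subst_nat2:
  assumes "dpred (int_expansion \<A>) (\<lambda>e. R (nat \<lfloor>e 0\<rfloor>) (nat \<lfloor>e 1\<rfloor>))"
    "dfun (int_expansion \<A>) (\<lambda>e. real (f e))" "dfun (int_expansion \<A>) (\<lambda>e. real (g e))"
  shows "dpred (int_expansion \<A>) (\<lambda>e. R (f e) (g e))"
  using dpred_subst2[where R = "\<lambda>x y. R (nat \<lfloor>x\<rfloor>) (nat \<lfloor>y\<rfloor>)", OF assms] by simp

section \<open>Components of clopen path-connected pieces\<close>

text \<open>Path components lie in connected components and these in quasicomponents.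
  Path-connectedness puts \<open>C\<close> inside the smallest of the three sets, clopenness puts
  the largest inside \<open>C\<close>.\<close>

lemma clopen_path_connected_component:
  assumes "path_connectedin X C" "openin X C" "closedin X C" "x \<in> C"
  shows "path_component_of_set X x = C" "connected_component_of_set X x = C"
    "quasi_component_of_set X x = C"
proof -
  have "x \<in> topspace X" using assms(2,4) openin_subset by blast
  have sub: "C \<subseteq> path_component_of_set X x"
    using assms(1,4) by (simp add: path_component_of_maximal)
  have sup: "quasi_component_of_set X x \<subseteq> C"
    using assms(2-4) by (auto simp: quasi_component_of_def)
  have "path_component_of_set X x \<subseteq> connected_component_of_set X x"
    by (rule path_component_subset_connected_component_of)
  moreover have "connected_component_of_set X x \<subseteq> quasi_component_of_set X x"
    by (rule connected_component_subset_quasi_component_of)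
  ultimately show "path_component_of_set X x = C" "connected_component_of_set X x = C"
    "quasi_component_of_set X x = C"
    using sub sup by blast+
qed

text \<open>Passes to the type class topology on functions, in which continuity, closures and paths
  are treated below.\<close>

lemma subtopology_Euclidean_space:
  assumes "E \<subseteq> tuples n"
  shows "subtopology (Euclidean_space n) E = top_of_set E"
  using assms
  by (simp add: Euclidean_space_def subtopology_subtopology tuples_def euclidean_product_topology
      Int_absorb1)

lemma path_component_curve:
  fixes g :: "real \<Rightarrow> 'a::topological_space"
  assumes "continuous_on {u..v} g" "\<And>s. u \<le> s \<Longrightarrow> s \<le> v \<Longrightarrow> g s \<in> S" "u \<le> v"
  shows "path_component S (g u) (g v)"
proof -
  have "path_connected (g ` {u..v})"
    using assms(1) by (rule path_connected_continuous_image) (simp add: convex_imp_path_connected)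
  then have "path_component (g ` {u..v}) (g u) (g v)"
    using assms(3) by (simp add: path_connected_component)
  moreover have "g ` {u..v} \<subseteq> S" using assms(2) by auto
  ultimately show ?thesis using path_component_of_subset by blast
qed

section \<open>Multiplication from a component\<close>

definition pt :: "real \<Rightarrow> real \<Rightarrow> real \<Rightarrow> real \<Rightarrow> nat \<Rightarrow> real" where
  "pt a x r m = (\<lambda>i. if i = 0 then a else if i = 1 then x else if i = 2 then r else if i = 3 then m else 0)"

lemma pt_simps [simp]: "pt a x r m 0 = a" "pt a x r m (Suc 0) = x" "pt a x r m 2 = r" "pt a x r m 3 = m"
  by (simp_all add: pt_def)

lemma pt_in_tuples [simp]: "pt a x r m \<in> tuples 4"
  by (simp add: pt_def tuples_def)

lemma pt_eta: "e \<in> tuples 4 \<Longrightarrow> pt (e 0) (e 1) (e 2) (e 3) = e"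
  by (auto simp: pt_def tuples_def fun_eq_iff)

text \<open>
  The first coordinate \<open>a\<close> is a multiplicand. For integral \<open>a\<close>, the projection of the set to
  \<open>(x, r)\<close> is a curve that runs to and fro between \<open>r = 0\<close> and \<open>r = a\<close> while \<open>x\<close> increases by \<open>1\<close> at
  each turn. The last coordinate \<open>m\<close> increases at the speed at which \<open>r\<close> changes, so it adds up to
  \<open>x * a\<close>. The half-line joins the curves for different \<open>a\<close>.
\<close>

definition snake :: "(nat \<Rightarrow> real) set" where
  "snake = {e \<in> tuples 4.
     e 0 \<in> \<int> \<and> 0 \<le> e 2 \<and> e 2 \<le> e 0 \<and>
       (\<exists>k. k \<in> \<int> \<and> 0 \<le> k \<and>
         (e 1 = k + k \<and> e 3 - e 2 \<in> \<int> \<or>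
          e 1 = k + k + 1 \<and> e 3 + e 2 \<in> \<int> \<or>
          k + k \<le> e 1 \<and> e 1 \<le> k + k + 1 \<and> e 2 = e 0 \<and> e 3 \<in> \<int> \<or>
          k + k + 1 \<le> e 1 \<and> e 1 \<le> k + k + 2 \<and> e 2 = 0 \<and> e 3 \<in> \<int>)) \<or>
     0 \<le> e 0 \<and> e 1 = 0 \<and> e 2 = 0 \<and> e 3 = 0}"

text \<open>The set is written with \<open>k + k\<close> instead of a product, so that every clause
  is built from sums, order and integrality alone.\<close>

lemma definable_snake: "definable (int_expansion \<A>) 4 snake"
proof (rule dpred_imp_definable)
  show "e \<in> snake \<longleftrightarrow> e \<in> tuples 4 \<and> (e 0 \<in> \<int> \<and> 0 \<le> e 2 \<and> e 2 \<le> e 0 \<and>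
       (\<exists>k. k \<in> \<int> \<and> 0 \<le> k \<and>
         (e 1 = k + k \<and> e 3 - e 2 \<in> \<int> \<or>
          e 1 = k + k + 1 \<and> e 3 + e 2 \<in> \<int> \<or>
          k + k \<le> e 1 \<and> e 1 \<le> k + k + 1 \<and> e 2 = e 0 \<and> e 3 \<in> \<int> \<or>
          k + k + 1 \<le> e 1 \<and> e 1 \<le> k + k + 2 \<and> e 2 = 0 \<and> e 3 \<in> \<int>)) \<or>
     0 \<le> e 0 \<and> e 1 = 0 \<and> e 2 = 0 \<and> e 3 = 0)" for e
    by (simp add: snake_def)
  show "dpred (int_expansion \<A>) (\<lambda>e. e 0 \<in> \<int> \<and> 0 \<le> e 2 \<and> e 2 \<le> e 0 \<and>
       (\<exists>k. k \<in> \<int> \<and> 0 \<le> k \<and>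
         (e 1 = k + k \<and> e 3 - e 2 \<in> \<int> \<or>
          e 1 = k + k + 1 \<and> e 3 + e 2 \<in> \<int> \<or>
          k + k \<le> e 1 \<and> e 1 \<le> k + k + 1 \<and> e 2 = e 0 \<and> e 3 \<in> \<int> \<or>
          k + k + 1 \<le> e 1 \<and> e 1 \<le> k + k + 2 \<and> e 2 = 0 \<and> e 3 \<in> \<int>)) \<or>
     0 \<le> e 0 \<and> e 1 = 0 \<and> e 2 = 0 \<and> e 3 = 0)"
    by (intro dpred_conj dpred_disj dpred_ex dpred_Ints dpred_le dpred_eq dfun_add dfun_diff
        dfun_var dfun_const)
qed

section \<open>An integer-valued invariant of the snake\<close>

text \<open>The triangle wave of period 2, that is, the distance to the nearest even integer. The
  trigonometric form makes continuity immediate.\<close>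

definition zigzag :: "real \<Rightarrow> real" where
  "zigzag x = arccos (cos (pi * x)) / pi"

lemma continuous_zigzag: "continuous_on UNIV zigzag"
  unfolding zigzag_def by (intro continuous_intros) auto

lemma zigzag_even:
  assumes "0 \<le> t" "t \<le> 1"
  shows "zigzag (2 * real k + t) = t"
proof -
  have "pi * (2 * real k + t) = pi * t + 2 * real k * pi" by (simp add: algebra_simps)
  then have "cos (pi * (2 * real k + t)) = cos (pi * t)"
    by (simp only: cos_add) simp
  moreover have "arccos (cos (pi * t)) = pi * t" using assms by (intro arccos_cos) auto
  ultimately show ?thesis by (simp add: zigzag_def)
qed

lemma zigzag_odd:
  assumes "0 \<le> t" "t \<le> 1"
  shows "zigzag (2 * real k + 1 + t) = 1 - t"
proof -
  have "pi * (2 * real k + 1 + t) = - (pi * (1 - t)) + 2 * real (Suc k) * pi"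
    by (simp add: algebra_simps)
  then have "cos (pi * (2 * real k + 1 + t)) = cos (pi * (1 - t))"
    by (simp only: cos_add cos_minus) (simp del: of_nat_Suc)
  moreover have "arccos (cos (pi * (1 - t))) = pi * (1 - t)" using assms by (intro arccos_cos) auto
  ultimately show ?thesis by (simp add: zigzag_def)
qed

text \<open>
  This is \<open>m\<close> minus its value on the curve that starts at the origin; on the horizontal parts
  it is interpolated linearly in \<open>x\<close>.
\<close>

definition deviation :: "(nat \<Rightarrow> real) \<Rightarrow> real" where
  "deviation e = e 3 - (e 1 + zigzag (e 1)) * e 0 - (1 - 2 * zigzag (e 1)) * e 2"

lemma continuous_deviation: "continuous_on UNIV deviation"
proof -
  have coord: "continuous_on UNIV (\<lambda>e :: nat \<Rightarrow> real. e i)" for i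
    by (rule continuous_on_product_coordinates)
  have "continuous_on UNIV (\<lambda>e :: nat \<Rightarrow> real. zigzag (e 1))"
    using continuous_on_compose2[OF continuous_zigzag coord[of 1]] by simp
  then show ?thesis unfolding deviation_def by (intro continuous_intros coord)
qed

lemma Ints_nonneg_cases:
  assumes "(k :: real) \<in> \<int>" "0 \<le> k"
  obtains n where "k = real n"
  using assms by (metis Ints_cases nonneg_int_cases of_int_0_le_iff of_int_of_nat_eq)

lemma snake_cases:
  assumes "e \<in> snake"
  obtains
    (up) a k r m where "e = pt (real a) (2 * real k) r m" "0 \<le> r" "r \<le> real a" "m - r \<in> \<int>"
  | (down) a k r m where "e = pt (real a) (2 * real k + 1) r m" "0 \<le> r" "r \<le> real a" "m + r \<in> \<int>"
  | (top) a k t m where "e = pt (real a) (2 * real k + t) (real a) m" "0 \<le> t" "t \<le> 1" "m \<in> \<int>"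
  | (bottom) a k t m where "e = pt (real a) (2 * real k + 1 + t) 0 m" "0 \<le> t" "t \<le> 1" "m \<in> \<int>"
  | (link) a where "e = pt a 0 0 0" "0 \<le> a"
proof -
  have e: "e = pt (e 0) (e 1) (e 2) (e 3)" using assms pt_eta[of e] unfolding snake_def by fastforce
  consider "e 0 \<in> \<int>" "0 \<le> e 2" "e 2 \<le> e 0" "\<exists>k. k \<in> \<int> \<and> 0 \<le> k \<and>
         (e 1 = k + k \<and> e 3 - e 2 \<in> \<int> \<or>
          e 1 = k + k + 1 \<and> e 3 + e 2 \<in> \<int> \<or>
          k + k \<le> e 1 \<and> e 1 \<le> k + k + 1 \<and> e 2 = e 0 \<and> e 3 \<in> \<int> \<or>
          k + k + 1 \<le> e 1 \<and> e 1 \<le> k + k + 2 \<and> e 2 = 0 \<and> e 3 \<in> \<int>)"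
    | "0 \<le> e 0" "e 1 = 0" "e 2 = 0" "e 3 = 0"
    using assms unfolding snake_def by blast
  then show thesis
  proof cases
    case 1
    then obtain a where a: "e 0 = real a" using Ints_nonneg_cases[of "e 0"] by force
    from 1(4) obtain k' where k': "k' \<in> \<int>" "0 \<le> k'" and
      *: "e 1 = k' + k' \<and> e 3 - e 2 \<in> \<int> \<or>
          e 1 = k' + k' + 1 \<and> e 3 + e 2 \<in> \<int> \<or>
          k' + k' \<le> e 1 \<and> e 1 \<le> k' + k' + 1 \<and> e 2 = e 0 \<and> e 3 \<in> \<int> \<or>
          k' + k' + 1 \<le> e 1 \<and> e 1 \<le> k' + k' + 2 \<and> e 2 = 0 \<and> e 3 \<in> \<int>" by blast
    from k' obtain k where k: "k' = real k" using Ints_nonneg_cases by blast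
    from * show thesis
    proof (elim disjE conjE)
      assume "e 1 = k' + k'" "e 3 - e 2 \<in> \<int>"
      then show thesis using up[of a k "e 2" "e 3"] e a k 1 by simp
    next
      assume "e 1 = k' + k' + 1" "e 3 + e 2 \<in> \<int>"
      then show thesis using down[of a k "e 2" "e 3"] e a k 1 by simp
    next
      assume "k' + k' \<le> e 1" "e 1 \<le> k' + k' + 1" "e 2 = e 0" "e 3 \<in> \<int>"
      then show thesis using top[of a k "e 1 - 2 * real k" "e 3"] e a k by simp
    next
      assume "k' + k' + 1 \<le> e 1" "e 1 \<le> k' + k' + 2" "e 2 = 0" "e 3 \<in> \<int>"
      then show thesis using bottom[of a k "e 1 - 2 * real k - 1" "e 3"] e a k by simp
    qed
  next
    case 2
    then show thesis using link[of "e 0"] e by simp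
  qed
qed

text \<open>The horizontal parts explain the formula of \<open>deviation\<close>. At the top
  \<open>x + zigzag x\<close> is \<open>2 * k + 2 * t\<close>, and the term with
  \<open>r = a\<close> cancels \<open>2 * t\<close>; at the bottom \<open>x + zigzag x\<close> is
  constantly \<open>2 * k + 2\<close>.\<close>

lemma deviation_pt:
  "deviation (pt a (2 * real k) r m) = m - r - 2 * real k * a"
  "deviation (pt a (2 * real k + 1) r m) = m + r - 2 * (real k + 1) * a"
  "0 \<le> t \<Longrightarrow> t \<le> 1 \<Longrightarrow> deviation (pt a (2 * real k + t) a m) = m - (2 * real k + 1) * a"
  "0 \<le> t \<Longrightarrow> t \<le> 1 \<Longrightarrow> deviation (pt a (2 * real k + 1 + t) 0 m) = m - 2 * (real k + 1) * a"
  "deviation (pt a 0 0 0) = 0"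
  using zigzag_even[of 0 k] zigzag_odd[of 0 k] zigzag_even[of 0 0]
  by (simp_all add: deviation_def zigzag_even zigzag_odd) (simp_all add: algebra_simps)

text \<open>On the curves \<open>a\<close> is an integer, so the multiples of \<open>a\<close> in
  \<open>deviation\<close> are integers. On the half-line \<open>a\<close> is arbitrary, but the
  deviation vanishes.\<close>

lemma deviation_Ints:
  assumes "e \<in> snake"
  shows "deviation e \<in> \<int>"
  using assms by (cases rule: snake_cases) (auto simp: deviation_pt intro!: Ints_diff Ints_mult)

section \<open>The component of the origin\<close>

definition strand :: "(nat \<Rightarrow> real) set" where
  "strand = {e \<in> snake. deviation e = 0}"

lemma pt_in_strand:
  "0 \<le> r \<Longrightarrow> r \<le> real a \<Longrightarrow> pt (real a) (2 * real k) r (2 * real k * real a + r) \<in> strand"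
  "0 \<le> r \<Longrightarrow> r \<le> real a \<Longrightarrow> pt (real a) (2 * real k + 1) r (2 * (real k + 1) * real a - r) \<in> strand"
  "0 \<le> t \<Longrightarrow> t \<le> 1 \<Longrightarrow> pt (real a) (2 * real k + t) (real a) ((2 * real k + 1) * real a) \<in> strand"
  "0 \<le> t \<Longrightarrow> t \<le> 1 \<Longrightarrow> pt (real a) (2 * real k + 1 + t) 0 (2 * (real k + 1) * real a) \<in> strand"
  "0 \<le> s \<Longrightarrow> pt s 0 0 0 \<in> strand"
  by (auto simp: strand_def deviation_pt snake_def intro!: exI[of _ "real k"] Ints_mult Ints_add)

lemma continuous_on_pt:
  assumes "continuous_on S a" "continuous_on S x" "continuous_on S r" "continuous_on S m"
  shows "continuous_on S (\<lambda>s. pt (a s) (x s) (r s) (m s))"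
proof (rule continuous_on_coordinatewise_then_product)
  show "continuous_on S (\<lambda>s. pt (a s) (x s) (r s) (m s) i)" for i
    unfolding pt_def using assms by (cases "i = 0"; cases "i = 1"; cases "i = 2"; cases "i = 3") simp_all
qed

text \<open>One period goes up at \<open>2 * k\<close>, along the top, down at
  \<open>2 * k + 1\<close> and along the bottom. The counter gains \<open>a\<close> on the way up
  and \<open>a\<close> on the way down.\<close>

lemma strand_bottom: "path_component strand (pt 0 0 0 0) (pt (real a) (2 * real k) 0 (2 * real k * real a))"
proof (induction k)
  case 0
  \<comment> \<open>The half-line leads from the origin to the start of the curve for
    \<open>a\<close>.\<close>
  have "path_component strand ((\<lambda>s. pt s 0 0 0) 0) ((\<lambda>s. pt s 0 0 0) (real a))"
    by (rule path_component_curve[where g = "\<lambda>s. pt s 0 0 0"]) (auto intro!: continuous_on_pt continuous_on_add continuous_on_diff continuous_on_id continuous_on_const pt_in_strand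
        simp del: distrib_left_numeral)
  then show ?case by simp
next
  case (Suc k)
  let ?g1 = "\<lambda>r. pt (real a) (2 * real k) r (2 * real k * real a + r)"
  let ?g2 = "\<lambda>t. pt (real a) (2 * real k + t) (real a) ((2 * real k + 1) * real a)"
  let ?g3 = "\<lambda>r. pt (real a) (2 * real k + 1) r (2 * (real k + 1) * real a - r)"
  let ?g4 = "\<lambda>t. pt (real a) (2 * real k + 1 + t) 0 (2 * (real k + 1) * real a)"
  have 1: "path_component strand (?g1 0) (?g1 (real a))"
    by (rule path_component_curve) (auto intro!: continuous_on_pt continuous_on_add continuous_on_diff continuous_on_id continuous_on_const pt_in_strand
        simp del: distrib_left_numeral)
  have 2: "path_component strand (?g2 0) (?g2 1)"
    by (rule path_component_curve) (auto intro!: continuous_on_pt continuous_on_add continuous_on_diff continuous_on_id continuous_on_const pt_in_strand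
        simp del: distrib_left_numeral)
  have 3: "path_component strand (?g3 0) (?g3 (real a))"
    by (rule path_component_curve) (auto intro!: continuous_on_pt continuous_on_add continuous_on_diff continuous_on_id continuous_on_const pt_in_strand
        simp del: distrib_left_numeral)
  have 4: "path_component strand (?g4 0) (?g4 1)"
    by (rule path_component_curve) (auto intro!: continuous_on_pt continuous_on_add continuous_on_diff continuous_on_id continuous_on_const pt_in_strand
        simp del: distrib_left_numeral)
  \<comment> \<open>Consecutive segments share endpoints; the third is parametrised by
    \<open>r\<close> and is therefore traversed backwards.\<close>
  have eqs: "?g1 (real a) = ?g2 0" "?g2 1 = ?g3 (real a)" "?g3 0 = ?g4 0"
    by (simp_all add: algebra_simps)
  have "path_component strand (pt 0 0 0 0) (?g1 0)" using Suc by simp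
  from path_component_trans[OF this 1[unfolded eqs]]
  have "path_component strand (pt 0 0 0 0) (?g2 0)" .
  from path_component_trans[OF this 2[unfolded eqs]]
  have "path_component strand (pt 0 0 0 0) (?g3 (real a))" .
  from path_component_trans[OF this path_component_sym[OF 3[unfolded eqs]]]
  have "path_component strand (pt 0 0 0 0) (?g4 0)" .
  from path_component_trans[OF this 4]
  have "path_component strand (pt 0 0 0 0) (?g4 1)" .
  moreover have "?g4 1 = pt (real a) (2 * real (Suc k)) 0 (2 * real (Suc k) * real a)"
    by (simp add: algebra_simps)
  ultimately show ?case by simp
qed

text \<open>On each kind of segment, vanishing deviation determines \<open>m\<close> from the other
  coordinates. Rising segments hang on the points of \<open>strand_bottom\<close>, and each further
  kind of segment on the end of the preceding one.\<close>

lemma path_connected_strand: "path_connected strand"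
proof -
  have "path_component strand (pt 0 0 0 0) e" if e: "e \<in> strand" for e
  proof -
    have to_up: "path_component strand (pt 0 0 0 0) (pt (real a) (2 * real k) r (2 * real k * real a + r))"
      if "0 \<le> r" "r \<le> real a" for a k r
    proof -
      let ?g = "\<lambda>r. pt (real a) (2 * real k) r (2 * real k * real a + r)"
      have "path_component strand (?g 0) (?g r)"
        using that by (intro path_component_curve)
          (auto intro!: continuous_on_pt continuous_on_add continuous_on_diff continuous_on_id continuous_on_const pt_in_strand
        simp del: distrib_left_numeral)
      then show ?thesis using strand_bottom[of a k] path_component_trans by simp blast
    qed
    have to_top: "path_component strand (pt 0 0 0 0) (pt (real a) (2 * real k + t) (real a) ((2 * real k + 1) * real a))"
      if "0 \<le> t" "t \<le> 1" for a k t
    proof -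
      let ?g = "\<lambda>t. pt (real a) (2 * real k + t) (real a) ((2 * real k + 1) * real a)"
      have "path_component strand (?g 0) (?g t)"
        using that by (intro path_component_curve)
          (auto intro!: continuous_on_pt continuous_on_add continuous_on_diff continuous_on_id continuous_on_const pt_in_strand
        simp del: distrib_left_numeral)
      moreover have "path_component strand (pt 0 0 0 0) (?g 0)"
        using to_up[of "real a" a k] by (simp add: algebra_simps)
      ultimately show ?thesis using path_component_trans by blast
    qed
    have to_down: "path_component strand (pt 0 0 0 0) (pt (real a) (2 * real k + 1) r (2 * (real k + 1) * real a - r))"
      if "0 \<le> r" "r \<le> real a" for a k r
    proof -
      let ?g = "\<lambda>r. pt (real a) (2 * real k + 1) r (2 * (real k + 1) * real a - r)"
      have "path_component strand (?g r) (?g (real a))"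
        using that by (intro path_component_curve)
          (auto intro!: continuous_on_pt continuous_on_add continuous_on_diff continuous_on_id continuous_on_const pt_in_strand
        simp del: distrib_left_numeral)
      moreover have "path_component strand (pt 0 0 0 0) (?g (real a))"
        using to_top[of 1 a k] by (simp add: algebra_simps)
      ultimately show ?thesis using path_component_trans path_component_sym by blast
    qed
    have to_bottom: "path_component strand (pt 0 0 0 0) (pt (real a) (2 * real k + 1 + t) 0 (2 * (real k + 1) * real a))"
      if "0 \<le> t" "t \<le> 1" for a k t
    proof -
      let ?g = "\<lambda>t. pt (real a) (2 * real k + 1 + t) 0 (2 * (real k + 1) * real a)"
      have "path_component strand (?g 0) (?g t)"
        using that by (intro path_component_curve)
          (auto intro!: continuous_on_pt continuous_on_add continuous_on_diff continuous_on_id continuous_on_const pt_in_strand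
        simp del: distrib_left_numeral)
      moreover have "path_component strand (pt 0 0 0 0) (?g 0)"
        using to_down[of 0 a k] by simp
      ultimately show ?thesis using path_component_trans by blast
    qed
    have to_link: "path_component strand (pt 0 0 0 0) (pt s 0 0 0)" if "0 \<le> s" for s
    proof -
      have "path_component strand ((\<lambda>s. pt s 0 0 0) 0) ((\<lambda>s. pt s 0 0 0) s)"
        using that by (intro path_component_curve)
          (auto intro!: continuous_on_pt continuous_on_add continuous_on_diff continuous_on_id continuous_on_const pt_in_strand
        simp del: distrib_left_numeral)
      then show ?thesis by simp
    qed
    from e have "e \<in> snake" "deviation e = 0" by (simp_all add: strand_def)
    then show ?thesis
    proof (cases rule: snake_cases)
      case (up a k r m)
      then have "m = 2 * real k * real a + r" using \<open>deviation e = 0\<close> by (simp add: deviation_pt)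
      then show ?thesis using up to_up by simp
    next
      case (down a k r m)
      then have "m = 2 * (real k + 1) * real a - r" using \<open>deviation e = 0\<close> by (simp add: deviation_pt)
      then show ?thesis using down to_down by simp
    next
      case (top a k t m)
      then have "m = (2 * real k + 1) * real a" using \<open>deviation e = 0\<close> by (simp add: deviation_pt)
      then show ?thesis using top to_top by simp
    next
      case (bottom a k t m)
      then have "m = 2 * (real k + 1) * real a" using \<open>deviation e = 0\<close> by (simp add: deviation_pt)
      then show ?thesis using bottom to_bottom by simp
    next
      case (link a)
      then show ?thesis using \<open>\<And>s. _ \<Longrightarrow> path_component strand (pt 0 0 0 0) (pt s 0 0 0)\<close> by simp
    qed
  qed
  then show ?thesis
    unfolding path_connected_component by (meson path_component_sym path_component_trans)
qed

text \<open>On the snake \<open>deviation\<close> is continuous with integer values, so its zero set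
  is the preimage both of the closed set {0} and of the open interval from -1 to 1.\<close>

lemma clopen_strand: "openin (top_of_set snake) strand" "closedin (top_of_set snake) strand"
proof -
  have "strand = snake \<inter> deviation -` {0}" by (auto simp: strand_def)
  then show "closedin (top_of_set snake) strand"
    using continuous_closedin_preimage[of snake deviation "{0}"] continuous_deviation
      continuous_on_subset by fastforce
  have "deviation e = 0" if "e \<in> snake" "deviation e \<in> {-1<..<1}" for e
    using deviation_Ints[OF that(1)] that(2) by (auto elim!: Ints_cases)
  then have "strand = snake \<inter> deviation -` {-1<..<1}" by (auto simp: strand_def)
  then show "openin (top_of_set snake) strand"
    using continuous_openin_preimage_gen[of snake deviation "{-1<..<1}"] continuous_deviation
      continuous_on_subset by fastforce
qed

lemma strand_component:
  "strand \<in> path_components_of (subtopology (Euclidean_space 4) snake)"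
  "strand \<in> connected_components_of (subtopology (Euclidean_space 4) snake)"
  "strand \<in> quasi_components_of (subtopology (Euclidean_space 4) snake)"
proof -
  have sub: "snake \<subseteq> tuples 4" by (auto simp: snake_def)
  have 0: "pt 0 0 0 0 \<in> strand" by (rule pt_in_strand) simp
  have pc: "path_connectedin (top_of_set snake) strand"
    using path_connected_strand
    by (auto simp: path_connectedin_subtopology strand_def)
  have "pt 0 0 0 0 \<in> topspace (top_of_set snake)" using 0 by (simp add: strand_def)
  then show "strand \<in> path_components_of (subtopology (Euclidean_space 4) snake)"
    "strand \<in> connected_components_of (subtopology (Euclidean_space 4) snake)"
    "strand \<in> quasi_components_of (subtopology (Euclidean_space 4) snake)"
    unfolding subtopology_Euclidean_space[OF sub] path_components_of_def connected_components_of_def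
      quasi_components_of_def
    using clopen_path_connected_component[OF pc clopen_strand 0] by blast+
qed

section \<open>Reading off products\<close>

definition def_mult :: "('f, 'r, real) fo_structure \<Rightarrow> bool" where
  "def_mult M \<longleftrightarrow> dpred M (\<lambda>e. \<exists>a b :: nat. e 0 = real a \<and> e 1 = real b \<and> e 2 = real (a * b))"

text \<open>At the foot \<open>r = 0\<close> of the rising segment at \<open>x = 2 * b\<close> the
  counter is \<open>2 * b * a\<close>; hence both the second factor and the product are
  doubled.\<close>

lemma def_mult_if_definable_strand:
  assumes "definable (int_expansion \<A>) 4 strand"
  shows "def_mult (int_expansion \<A>)"
proof -
  have "dpred (int_expansion \<A>) (\<lambda>e. pt (e 0) (e 1 + e 1) 0 (e 2 + e 2) \<in> strand)"
  proof -
    have "dfun (int_expansion \<A>) (\<lambda>e. e i + e i)" for i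
      by (intro dfun_add dfun_var)
    then have "dfun (int_expansion \<A>) (\<lambda>e. pt (e 0) (e 1 + e 1) 0 (e 2 + e 2) i)" for i
      unfolding pt_def
      by (cases "i = 0"; cases "i = 1"; cases "i = 2"; cases "i = 3")
        simp_all
    from dpred_subst[OF definable_imp_dpred[OF assms], of "\<lambda>e. pt (e 0) (e 1 + e 1) 0 (e 2 + e 2)", OF this]
    show ?thesis
      by (rule back_subst) (intro ext arg_cong[of _ _ "dpred _"] arg_cong[of _ _ "\<lambda>x. x \<in> strand"],
        auto simp: pt_def)
  qed
  then have "dpred (int_expansion \<A>) (\<lambda>e. e 0 \<in> \<int> \<and> 0 \<le> e 0 \<and> e 1 \<in> \<int> \<and> 0 \<le> e 1 \<and>
      pt (e 0) (e 1 + e 1) 0 (e 2 + e 2) \<in> strand)"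
    by (intro dpred_conj dpred_Ints dpred_le dfun_const dfun_var)
  moreover have "e 0 \<in> \<int> \<and> 0 \<le> e 0 \<and> e 1 \<in> \<int> \<and> 0 \<le> e 1 \<and> pt (e 0) (e 1 + e 1) 0 (e 2 + e 2) \<in> strand
    \<longleftrightarrow> (\<exists>a b :: nat. e 0 = real a \<and> e 1 = real b \<and> e 2 = real (a * b))" (is "?L \<longleftrightarrow> ?R") for e :: "nat \<Rightarrow> real"
  proof
    assume L: ?L
    then obtain a b where ab: "e 0 = real a" "e 1 = real b" using Ints_nonneg_cases by meson
    with L have "deviation (pt (real a) (2 * real b) 0 (e 2 + e 2)) = 0" by (simp add: strand_def)
    then show ?R using ab by (intro exI[of _ a] exI[of _ b]) (simp add: deviation_pt)
  next
    assume ?R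
    then obtain a b :: nat where ab: "e 0 = real a" "e 1 = real b" "e 2 = real (a * b)" by blast
    then show ?L using pt_in_strand(1)[of 0 a b] by (simp add: algebra_simps)
  qed
  ultimately show ?thesis unfolding def_mult_def by simp
qed

lemma def_mult_if_component_closed:
  assumes "PCC (int_expansion \<A>) \<or> CC (int_expansion \<A>) \<or> QCC (int_expansion \<A>)"
  shows "def_mult (int_expansion \<A>)"
  using assms strand_component definable_snake[of \<A>]
  by (intro def_mult_if_definable_strand) (auto simp: PCC_def CC_def QCC_def)

section \<open>Definability of arithmetic sets\<close>

lemma dfun_of_nat_mult:
  assumes "def_mult M" "dfun M (\<lambda>e. real (f e))" "dfun M (\<lambda>e. real (g e))"
  shows "dfun M (\<lambda>e. real (f e * g e))"
proof -
  have "dpred M (\<lambda>e. \<exists>a b :: nat. real (f (\<lambda>i. e (Suc i))) = real a \<and>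
      real (g (\<lambda>i. e (Suc i))) = real b \<and> e 0 = real (a * b))"
    using dpred_subst3[where R = "\<lambda>x y z. \<exists>a b :: nat. x = real a \<and> y = real b \<and> z = real (a * b)",
        OF assms(1)[unfolded def_mult_def] dfun_Suc[OF assms(2)] dfun_Suc[OF assms(3)] dfun_var[of M 0]]
    by simp
  then show ?thesis unfolding dfun_def by simp
qed

lemma dpred_of_nat_eq:
  assumes "dfun M (\<lambda>e. real (f e))" "dfun M (\<lambda>e. real (g e))"
  shows "dpred M (\<lambda>e. f e = g e)"
  using dpred_eq[OF assms] by simp

lemma dfun_of_nat_add:
  assumes "dfun (int_expansion \<A>) (\<lambda>e. real (f e))" "dfun (int_expansion \<A>) (\<lambda>e. real (g e))"
  shows "dfun (int_expansion \<A>) (\<lambda>e. real (f e + g e))"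
  using dfun_add[OF assms] by simp

lemma dfun_term_val_nat_arith:
  assumes "def_mult (int_expansion \<A>)" "term_ok nat_arith t"
  shows "dfun (int_expansion \<A>) (\<lambda>e. real (term_val nat_arith (\<lambda>i. nat \<lfloor>e i\<rfloor>) t))"
  using assms(2)
proof (induction t)
  case (Var i)
  then show ?case by (simp add: dfun_nat_floor)
next
  case (Fun f ts)
  then have "length ts = 2" by (simp add: nat_arith_def)
  then obtain s t where ts: "ts = [s, t]" by (auto simp: numeral_2_eq_2 length_Suc_conv)
  have *: "dfun (int_expansion \<A>) (\<lambda>e. real (term_val nat_arith (\<lambda>i. nat \<lfloor>e i\<rfloor>) s))"
    "dfun (int_expansion \<A>) (\<lambda>e. real (term_val nat_arith (\<lambda>i. nat \<lfloor>e i\<rfloor>) t))"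
    using Fun.IH[of s] Fun.IH[of t] Fun.prems unfolding ts by simp_all
  have "term_val nat_arith e (Fun f ts) = (case f of
      Add \<Rightarrow> term_val nat_arith e s + term_val nat_arith e t
    | Mult \<Rightarrow> term_val nat_arith e s * term_val nat_arith e t)" for e
    by (simp add: ts nat_arith_def tuple_of_def split: arith_fun.split)
  then show ?case
    using dfun_of_nat_mult[OF assms(1) *] dfun_of_nat_add[OF *] by (cases f) simp_all
qed

text \<open>Every variable is read through \<open>nat\<close> after \<open>floor\<close>. As this
  map is onto the naturals, quantifiers translate without relativisation.\<close>

lemma dpred_satisfies_nat_arith:
  assumes "def_mult (int_expansion \<A>)" "formula_ok nat_arith \<phi>"
  shows "dpred (int_expansion \<A>) (\<lambda>e. satisfies nat_arith (\<lambda>i. nat \<lfloor>e i\<rfloor>) \<phi>)"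
  using assms(2)
proof (induction \<phi>)
  case (Equal s t)
  then have *: "term_ok nat_arith s" "term_ok nat_arith t" by simp_all
  show ?case
    using dpred_of_nat_eq[OF dfun_term_val_nat_arith[OF assms(1) *(1)]
        dfun_term_val_nat_arith[OF assms(1) *(2)]] by simp
next
  case (Rel r ts)
  then show ?case by (simp add: nat_arith_def)
next
  case (Neg \<phi>)
  then show ?case by (simp add: dpred_not)
next
  case (Conj \<phi> \<psi>)
  then show ?case by (simp add: dpred_conj)
next
  case (Exists i \<phi>)
  have "(\<exists>a. satisfies nat_arith ((\<lambda>k. nat \<lfloor>e k\<rfloor>)(i := a)) \<phi>) \<longleftrightarrow>
      (\<exists>x. satisfies nat_arith (\<lambda>k. nat \<lfloor>(e(i := x)) k\<rfloor>) \<phi>)" for e :: "nat \<Rightarrow> real"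
  proof -
    have eq: "(\<lambda>k. nat \<lfloor>(e(i := x)) k\<rfloor>) = (\<lambda>k. nat \<lfloor>e k\<rfloor>)(i := nat \<lfloor>x\<rfloor>)" for x
      by auto
    show ?thesis
      unfolding eq
    proof
      assume "\<exists>a. satisfies nat_arith ((\<lambda>k. nat \<lfloor>e k\<rfloor>)(i := a)) \<phi>"
      then obtain a where "satisfies nat_arith ((\<lambda>k. nat \<lfloor>e k\<rfloor>)(i := nat \<lfloor>real a\<rfloor>)) \<phi>" by auto
      then show "\<exists>x. satisfies nat_arith ((\<lambda>k. nat \<lfloor>e k\<rfloor>)(i := nat \<lfloor>x :: real\<rfloor>)) \<phi>" ..
    qed blast
  qed
  then show ?case using dpred_ex_upd[of "int_expansion \<A>", OF Exists.IH, of i] Exists.prems by simp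
qed

lemma defines_all_arithmetic_if_def_mult:
  assumes "def_mult (int_expansion \<A>)"
  shows "defines_all_arithmetic (int_expansion \<A>)"
  unfolding defines_all_arithmetic_def
proof (intro allI impI)
  fix n A assume "arithmetic n A"
  then obtain \<phi> p where ok: "formula_ok nat_arith \<phi>"
    and A: "A = {x \<in> tuples n. satisfies nat_arith (\<lambda>i. if i < n then x i else p i) \<phi>}"
    unfolding arithmetic_def definable_def by blast
  let ?h = "\<lambda>(e :: nat \<Rightarrow> real) i. if i < n then e i else real (p i)"
  have "dfun (int_expansion \<A>) (\<lambda>e. ?h e i)" for i by (cases "i < n") simp_all
  from dpred_subst[OF dpred_satisfies_nat_arith[OF assms ok], of ?h, OF this]
  have "dpred (int_expansion \<A>) (\<lambda>e. satisfies nat_arith (\<lambda>i. nat \<lfloor>?h e i\<rfloor>) \<phi>)" .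
  then have *: "dpred (int_expansion \<A>) (\<lambda>e. (\<forall>i\<in>{..<n}. e i \<in> \<int> \<and> 0 \<le> e i) \<and>
      satisfies nat_arith (\<lambda>i. nat \<lfloor>?h e i\<rfloor>) \<phi>)"
    by (intro dpred_conj dpred_ball dpred_Ints dpred_le dfun_const dfun_var finite_lessThan)
  show "definable (int_expansion \<A>) n ((\<lambda>x. real \<circ> x) ` A)"
  proof (rule dpred_imp_definable[OF *])
    fix y :: "nat \<Rightarrow> real"
    show "y \<in> (\<lambda>x. real \<circ> x) ` A \<longleftrightarrow> y \<in> tuples n \<and> (\<forall>i\<in>{..<n}. y i \<in> \<int> \<and> 0 \<le> y i) \<and>
      satisfies nat_arith (\<lambda>i. nat \<lfloor>?h y i\<rfloor>) \<phi>" (is "?L \<longleftrightarrow> ?R")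
    proof
      assume ?L
      then obtain x where x: "x \<in> A" "y = real \<circ> x" by blast
      have "(\<lambda>i. nat \<lfloor>?h y i\<rfloor>) = (\<lambda>i. if i < n then x i else p i)" by (auto simp: x(2))
      then show ?R using x by (simp add: A tuples_def)
    next
      assume R: ?R
      define x where "x i = nat \<lfloor>y i\<rfloor>" for i
      have "real (x i) = y i" for i
        using R by (cases "i < n") (auto simp: x_def tuples_def elim!: Ints_cases)
      then have y: "y = real \<circ> x" by auto
      have "(\<lambda>i. nat \<lfloor>?h y i\<rfloor>) = (\<lambda>i. if i < n then x i else p i)" by (auto simp: x_def)
      then have "x \<in> A" using R by (simp add: A tuples_def x_def)
      then show ?L using y by blast
    qed
  qed
qed

lemma def_mult_if_defines_all_arithmetic:
  assumes "defines_all_arithmetic M"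
  shows "def_mult M"
proof -
  let ?A = "{x \<in> tuples 3. x 0 * x 1 = (x 2 :: nat)}"
  have "arithmetic 3 ?A"
    unfolding arithmetic_def definable_def
    by (rule exI[of _ "Equal (Fun Mult [Var 0, Var 1]) (Var 2)"])
      (auto simp: nat_arith_def tuple_of_def)
  then have "definable M 3 ((\<lambda>x. real \<circ> x) ` ?A)"
    using assms by (simp add: defines_all_arithmetic_def)
  from definable_imp_dpred[OF this]
  have "dpred M (\<lambda>e. (\<lambda>i. if i < 3 then e i else 0) \<in> (\<lambda>x. real \<circ> x) ` ?A)" .
  moreover have "(\<lambda>i. if i < 3 then e i else 0) \<in> (\<lambda>x. real \<circ> x) ` ?A \<longleftrightarrow>
      (\<exists>a b :: nat. e 0 = real a \<and> e 1 = real b \<and> e 2 = real (a * b))" (is "?L \<longleftrightarrow> ?R") for e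
  proof
    assume ?L
    then obtain x where x: "x \<in> ?A" "(\<lambda>i. if i < 3 then e i else 0) = real \<circ> x" by blast
    have "(if i < 3 then e i else 0) = real (x i)" for i using fun_cong[OF x(2), of i] by simp
    from this[of 0] this[of 1] this[of 2] have "e 0 = real (x 0)" "e 1 = real (x 1)" "e 2 = real (x 2)"
      by simp_all
    moreover have "x 0 * x 1 = x 2" using x(1) by simp
    ultimately show ?R by (intro exI[of _ "x 0"] exI[of _ "x 1"]) simp
  next
    assume ?R
    then obtain a b :: nat where ab: "e 0 = real a" "e 1 = real b" "e 2 = real (a * b)" by blast
    define x where "x i = (if i = 0 then a else if i = 1 then b else if i = 2 then a * b else 0)" for i :: nat
    have "x \<in> ?A" by (simp add: x_def tuples_def)
    moreover have "(\<lambda>i. if i < 3 then e i else 0) = real \<circ> x"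
    proof
      fix i :: nat
      consider "i = 0" | "i = 1" | "i = 2" | "i \<ge> 3" by linarith
      then show "(if i < 3 then e i else 0) = (real \<circ> x) i" using ab by cases (auto simp: x_def)
    qed
    ultimately show ?L by blast
  qed
  ultimately show ?thesis unfolding def_mult_def by simp
qed

section \<open>Transitive closures\<close>

text \<open>Goedel's beta function. The Chinese remainder theorem applies because \<open>m i\<close>
  is coprime to \<open>b\<close>, hence to \<open>j - i\<close>, a divisor of \<open>b\<close>, and
  to the difference \<open>(j - i) * b\<close> of two moduli.\<close>

lemma beta_function:
  fixes f :: "nat \<Rightarrow> nat"
  obtains a b where "\<And>i. i \<le> n \<Longrightarrow> a mod (1 + (i + 1) * b) = f i"
proof -
  \<comment> \<open>\<open>N\<close> bounds \<open>n\<close>, so that differences of indices divide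
    \<open>fact N\<close>, and it bounds the values of \<open>f\<close>, so that each value is below
    its modulus and equals its own remainder.\<close>
  define N where "N = Max (insert n (f ` {..n}))"
  define b :: nat where "b = fact N"
  define m where "m i = 1 + (i + 1) * b" for i
  have "n \<le> N" unfolding N_def by simp
  have f: "f i < m i" if "i \<le> n" for i
  proof -
    have "f i \<le> N" using that unfolding N_def by (intro Max_ge) auto
    also have "N \<le> b" unfolding b_def by (rule fact_ge_self)
    also have "b < m i" by (simp add: m_def)
    finally show ?thesis .
  qed
  have cop: "coprime (m i) (m j)" if "i < j" "j \<le> n" for i j
  proof -
    have b: "coprime (m i) b" unfolding m_def
      by (metis coprime_1_left coprime_commute gcd_add_mult coprime_iff_gcd_eq_1 add.commute mult.commute)
    have "j - i dvd b" unfolding b_def using that \<open>n \<le> N\<close> by (intro dvd_fact) auto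
    then have "coprime (m i) (j - i)" using b coprime_divisors dvd_refl by blast
    then have "coprime (m i) ((j - i) * b)" using b by simp
    moreover have "m j = m i + (j - i) * b"
    proof -
      obtain d where "j = i + d" using \<open>i < j\<close> less_imp_add_positive by blast
      then show ?thesis by (simp add: m_def algebra_simps)
    qed
    ultimately show ?thesis by (simp add: coprime_iff_gcd_eq_1)
  qed
  have "\<forall>i\<in>{..n}. \<forall>j\<in>{..n}. i \<noteq> j \<longrightarrow> coprime (m i) (m j)"
  proof (intro ballI impI)
    fix i j assume "i \<in> {..n}" "j \<in> {..n}" "i \<noteq> j"
    then show "coprime (m i) (m j)"
      using cop[of i j] cop[of j i] by (cases "i < j") (auto simp: coprime_commute)
  qed
  from chinese_remainder_nat[OF _ this, of f] obtain a where "\<And>i. i \<le> n \<Longrightarrow> [a = f i] (mod m i)"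
    by auto
  then have "\<And>i. i \<le> n \<Longrightarrow> a mod m i = f i" using f by (simp add: cong_def)
  then show thesis using that[of a b] by (simp add: m_def)
qed

text \<open>A finite path is coded by its length \<open>n\<close> and the two numbers of the beta
  function, so only quantifiers over naturals remain. Terms such as \<open>0 + 1\<close> and
  \<open>i + 1 + 1\<close> are left unsimplified: all are built by addition from one
  pattern.\<close>

lemma rtranclp_beta:
  fixes R :: "nat \<Rightarrow> nat \<Rightarrow> bool"
  shows "R\<^sup>*\<^sup>* x y \<longleftrightarrow> (\<exists>n a b. a mod (1 + (0 + 1) * b) = x \<and> a mod (1 + (n + 1) * b) = y \<and>
    (\<forall>i. i < n \<longrightarrow> R (a mod (1 + (i + 1) * b)) (a mod (1 + (i + 1 + 1) * b))))" (is "_ \<longleftrightarrow> ?rhs")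
proof
  assume "R\<^sup>*\<^sup>* x y"
  then obtain n where "(R ^^ n) x y" by (auto simp: rtranclp_power)
  then obtain f where f: "f 0 = x" "f n = y" "\<And>i. i < n \<Longrightarrow> R (f i) (f (Suc i))"
    by (auto simp: relpowp_fun_conv)
  obtain a b where ab: "\<And>i. i \<le> n \<Longrightarrow> a mod (1 + (i + 1) * b) = f i"
    using beta_function[of n f] by blast
  have "R (a mod (1 + (i + 1) * b)) (a mod (1 + (i + 1 + 1) * b))" if "i < n" for i
    using f(3)[OF that] ab[of i] ab[of "Suc i"] that by simp
  then show ?rhs using ab[of 0] ab[of n] f(1,2) by (intro exI[of _ n] exI[of _ a] exI[of _ b]) auto
next
  assume ?rhs
  then obtain n a b where *: "a mod (1 + (0 + 1) * b) = x" "a mod (1 + (n + 1) * b) = y"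
    "\<And>i. i < n \<Longrightarrow> R (a mod (1 + (i + 1) * b)) (a mod (1 + (i + 1 + 1) * b))" by blast
  have "(R ^^ n) x y"
    unfolding relpowp_fun_conv using *
    by (intro exI[of _ "\<lambda>i. a mod (1 + (i + 1) * b)"]) auto
  then show "R\<^sup>*\<^sup>* x y" by (rule relpowp_imp_rtranclp)
qed

lemma dfun_of_natI:
  assumes "dpred (int_expansion \<A>) (\<lambda>e. R (nat \<lfloor>e 0\<rfloor>) (\<lambda>i. e (Suc i)))" "\<And>r e. R r e \<longleftrightarrow> r = f e"
  shows "dfun (int_expansion \<A>) (\<lambda>e. real (f e))"
proof -
  have "dpred (int_expansion \<A>) (\<lambda>e. e 0 \<in> \<int> \<and> 0 \<le> e 0 \<and> R (nat \<lfloor>e 0\<rfloor>) (\<lambda>i. e (Suc i)))"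
    by (intro dpred_conj dpred_Ints dpred_le dfun_const dfun_var assms(1))
  moreover have "e 0 \<in> \<int> \<and> 0 \<le> e 0 \<and> R (nat \<lfloor>e 0\<rfloor>) (\<lambda>i. e (Suc i)) \<longleftrightarrow> e 0 = real (f (\<lambda>i. e (Suc i)))"
    for e :: "nat \<Rightarrow> real"
    unfolding assms(2) by (auto elim!: Ints_cases)
  ultimately show ?thesis unfolding dfun_def by simp
qed

lemma dpred_of_nat_less:
  assumes "dfun (int_expansion \<A>) (\<lambda>e. real (f e))" "dfun (int_expansion \<A>) (\<lambda>e. real (g e))"
  shows "dpred (int_expansion \<A>) (\<lambda>e. f e < g e)"
  using dpred_less[OF assms] by simp

section \<open>Remainders, pairs and integers\<close>

context
  fixes \<A> :: "(nat \<times> (nat \<Rightarrow> int) set) set"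
  assumes mult: "def_mult (int_expansion \<A>)"
begin

text \<open>Division with remainder; the disjunct \<open>g e = 0\<close> covers the convention that
  the remainder modulo 0 is the number itself.\<close>

lemma dfun_of_nat_mod:
  assumes "dfun (int_expansion \<A>) (\<lambda>e. real (f e))" "dfun (int_expansion \<A>) (\<lambda>e. real (g e))"
  shows "dfun (int_expansion \<A>) (\<lambda>e. real (f e mod g e))"
proof (rule dfun_of_natI)
  show "dpred (int_expansion \<A>) (\<lambda>e. (\<exists>q. f (\<lambda>i. e (Suc i)) = q * g (\<lambda>i. e (Suc i)) + nat \<lfloor>e 0\<rfloor>) \<and>
      (g (\<lambda>i. e (Suc i)) = 0 \<or> nat \<lfloor>e 0\<rfloor> < g (\<lambda>i. e (Suc i))))"
    by (intro dpred_conj dpred_disj dpred_ex_nat dpred_of_nat_eq dpred_of_nat_less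
        dfun_of_nat_add dfun_of_nat_mult[OF mult] dfun_nat_floor dfun_var dfun_const
        dfun_Suc[OF assms(1)] dfun_Suc[OF assms(2)]
        dfun_Suc[OF dfun_Suc[OF assms(1)]] dfun_Suc[OF dfun_Suc[OF assms(2)]])
  show "(\<exists>q. f e = q * g e + r) \<and> (g e = 0 \<or> r < g e) \<longleftrightarrow> r = f e mod g e" for r e
  proof
    assume "(\<exists>q. f e = q * g e + r) \<and> (g e = 0 \<or> r < g e)"
    then show "r = f e mod g e" by (metis mod_mult_self3 mod_less mult_0_right add_0 mod_0 mod_by_0)
  next
    assume "r = f e mod g e"
    then show "(\<exists>q. f e = q * g e + r) \<and> (g e = 0 \<or> r < g e)"
      using div_mult_mod_eq[of "f e" "g e"] by (metis mod_less_divisor not_gr_zero)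
  qed
qed

lemma dpred_rtranclp:
  assumes "dpred (int_expansion \<A>) (\<lambda>e. R (nat \<lfloor>e 0\<rfloor>) (nat \<lfloor>e 1\<rfloor>))"
    "dfun (int_expansion \<A>) (\<lambda>e. real (f e))" "dfun (int_expansion \<A>) (\<lambda>e. real (g e))"
  shows "dpred (int_expansion \<A>) (\<lambda>e. R\<^sup>*\<^sup>* (f e) (g e))"
proof (rule dpred_subst_nat2[OF _ assms(2,3)])
  show "dpred (int_expansion \<A>) (\<lambda>e. R\<^sup>*\<^sup>* (nat \<lfloor>e 0\<rfloor>) (nat \<lfloor>e 1\<rfloor>))"
    unfolding rtranclp_beta
    by (intro dpred_conj dpred_imp dpred_ex_nat dpred_all_nat dpred_of_nat_eq dpred_of_nat_less
        dpred_subst_nat2[where R = R, OF assms(1)]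
        dfun_of_nat_add dfun_of_nat_mult[OF mult] dfun_of_nat_mod dfun_nat_floor dfun_var dfun_const)
qed

text \<open>Cantor's pairing function, multiplied by 2 so that triangular numbers become
  products.\<close>

lemma dfun_prod_encode:
  assumes "dfun (int_expansion \<A>) (\<lambda>e. real (f e))" "dfun (int_expansion \<A>) (\<lambda>e. real (g e))"
  shows "dfun (int_expansion \<A>) (\<lambda>e. real (prod_encode (f e, g e)))"
proof (rule dfun_of_natI)
  show "dpred (int_expansion \<A>) (\<lambda>e. 2 * nat \<lfloor>e 0\<rfloor> =
      (f (\<lambda>i. e (Suc i)) + g (\<lambda>i. e (Suc i))) * (f (\<lambda>i. e (Suc i)) + g (\<lambda>i. e (Suc i)) + 1) +
      2 * f (\<lambda>i. e (Suc i)))"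
    by (intro dpred_of_nat_eq dfun_of_nat_add dfun_of_nat_mult[OF mult] dfun_nat_floor dfun_var
        dfun_const dfun_Suc[OF assms(1)] dfun_Suc[OF assms(2)])
  have "2 * triangle n = n * (n + 1)" for n by (induction n) auto
  from this[of "f e + g e" for e]
  show "2 * r = (f e + g e) * (f e + g e + 1) + 2 * f e \<longleftrightarrow> r = prod_encode (f e, g e)" for r e
    unfolding prod_encode_def by (smt (verit) add_left_cancel case_prod_conv distrib_left mult_cancel1 zero_neq_numeral)
qed

lemma dfun_fst_prod_decode:
  assumes "dfun (int_expansion \<A>) (\<lambda>e. real (f e))"
  shows "dfun (int_expansion \<A>) (\<lambda>e. real (fst (prod_decode (f e))))"
proof (rule dfun_of_natI)
  show "dpred (int_expansion \<A>) (\<lambda>e. \<exists>s. prod_encode (nat \<lfloor>e 0\<rfloor>, s) = f (\<lambda>i. e (Suc i)))"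
    by (intro dpred_ex_nat dpred_of_nat_eq dfun_prod_encode dfun_nat_floor dfun_var
        dfun_Suc[OF dfun_Suc[OF assms]])
  show "(\<exists>s. prod_encode (r, s) = f e) \<longleftrightarrow> r = fst (prod_decode (f e))" for r e
    by (metis fst_conv prod.collapse prod_decode_inverse prod_encode_inverse)
qed

lemma dfun_snd_prod_decode:
  assumes "dfun (int_expansion \<A>) (\<lambda>e. real (f e))"
  shows "dfun (int_expansion \<A>) (\<lambda>e. real (snd (prod_decode (f e))))"
proof (rule dfun_of_natI)
  show "dpred (int_expansion \<A>) (\<lambda>e. \<exists>s. prod_encode (s, nat \<lfloor>e 0\<rfloor>) = f (\<lambda>i. e (Suc i)))"
    by (intro dpred_ex_nat dpred_of_nat_eq dfun_prod_encode dfun_nat_floor dfun_var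
        dfun_Suc[OF dfun_Suc[OF assms]])
  show "(\<exists>s. prod_encode (s, r) = f e) \<longleftrightarrow> r = snd (prod_decode (f e))" for r e
    by (metis snd_conv prod.collapse prod_decode_inverse prod_encode_inverse)
qed

lemma dfun_int_encode:
  assumes "dfun (int_expansion \<A>) (\<lambda>e. of_int (f e))"
  shows "dfun (int_expansion \<A>) (\<lambda>e. real (int_encode (f e)))"
proof -
  have "dfun (int_expansion \<A>) (\<lambda>e. if 0 \<le> real_of_int (f e) then of_int (f e) + of_int (f e)
      else - of_int (f e) - of_int (f e) - 1)"
    by (intro dfun_if dpred_le dfun_add dfun_diff dfun_uminus dfun_const assms)
  moreover have "(if 0 \<le> real_of_int k then of_int k + of_int k else - of_int k - of_int k - 1) =
      real (int_encode k)" for k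
    by (simp add: int_encode_def sum_encode_def)
  ultimately show ?thesis by simp
qed

lemma dfun_int_decode:
  assumes "dfun (int_expansion \<A>) (\<lambda>e. real (f e))"
  shows "dfun (int_expansion \<A>) (\<lambda>e. of_int (int_decode (f e)))"
proof -
  have "dpred (int_expansion \<A>) (\<lambda>e. e 0 \<in> \<int> \<and> int_encode \<lfloor>e 0\<rfloor> = f (\<lambda>i. e (Suc i)))"
    by (intro dpred_conj dpred_Ints dpred_of_nat_eq dfun_int_encode dfun_floor dfun_var dfun_Suc[OF assms])
  moreover have "e 0 \<in> \<int> \<and> int_encode \<lfloor>e 0\<rfloor> = f (\<lambda>i. e (Suc i)) \<longleftrightarrow>
      e 0 = of_int (int_decode (f (\<lambda>i. e (Suc i))))" for e :: "nat \<Rightarrow> real"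
    by (auto elim!: Ints_cases) (metis int_encode_inverse)
  ultimately show ?thesis unfolding dfun_def by simp
qed

end

section \<open>Codes of integer vectors\<close>

text \<open>The length is a fixed number outside the structure, so iterated pairing suffices; the
  beta function is reserved for paths, whose length varies.\<close>

primrec vec_encode :: "nat \<Rightarrow> (nat \<Rightarrow> int) \<Rightarrow> nat" where
  "vec_encode 0 z = 0"
| "vec_encode (Suc n) z = prod_encode (int_encode (z n), vec_encode n z)"

primrec vec_decode :: "nat \<Rightarrow> nat \<Rightarrow> nat \<Rightarrow> int" where
  "vec_decode 0 \<nu> = (\<lambda>i. 0)"
| "vec_decode (Suc n) \<nu> =
    (vec_decode n (snd (prod_decode \<nu>)))(n := int_decode (fst (prod_decode \<nu>)))"

lemma vec_decode_encode: "vec_decode n (vec_encode n z) = (\<lambda>i. if i < n then z i else 0)"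
  by (induction n) (auto simp: fun_eq_iff less_Suc_eq)

lemma dfun_vec_encode:
  assumes "def_mult (int_expansion \<A>)" "\<And>i. dfun (int_expansion \<A>) (\<lambda>e. of_int (z e i))"
  shows "dfun (int_expansion \<A>) (\<lambda>e. real (vec_encode n (z e)))"
proof (induction n)
  case (Suc n)
  show ?case
    unfolding vec_encode.simps
    by (intro dfun_prod_encode[OF assms(1)] dfun_int_encode[OF assms(1)] assms(2) Suc)
qed simp

lemma dfun_vec_decode:
  assumes "def_mult (int_expansion \<A>)" "dfun (int_expansion \<A>) (\<lambda>e. real (f e))"
  shows "dfun (int_expansion \<A>) (\<lambda>e. of_int (vec_decode n (f e) i))"
  using assms(2)
proof (induction n arbitrary: f)
  case (Suc n)
  show ?case
  proof (cases "i = n")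
    case True
    then show ?thesis
      using dfun_int_decode[OF assms(1) dfun_fst_prod_decode[OF assms(1) Suc.prems]] by simp
  next
    case False
    then show ?thesis
      using Suc.IH[OF dfun_snd_prod_decode[OF assms(1) Suc.prems]] by simp
  qed
qed simp

section \<open>Cell decomposition\<close>

text \<open>Integer coefficients arise from iterated addition, so these forms are definable, and
  they map integer vectors to integers. Without a constant term they split additively over integer
  and fractional parts; real parameters are still variables at this stage.\<close>

inductive lin :: "((nat \<Rightarrow> real) \<Rightarrow> real) \<Rightarrow> bool" where
  lin_var: "lin (\<lambda>f. f i)"
| lin_add: "lin A \<Longrightarrow> lin B \<Longrightarrow> lin (\<lambda>f. A f + B f)"
| lin_uminus: "lin A \<Longrightarrow> lin (\<lambda>f. - A f)"

inductive aff :: "((nat \<Rightarrow> real) \<Rightarrow> real) \<Rightarrow> bool" where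
  aff_one: "aff (\<lambda>f. 1)"
| aff_var: "aff (\<lambda>f. f i)"
| aff_add: "aff A \<Longrightarrow> aff B \<Longrightarrow> aff (\<lambda>f. A f + B f)"
| aff_uminus: "aff A \<Longrightarrow> aff (\<lambda>f. - A f)"

lemma aff_lin: "lin A \<Longrightarrow> aff A"
  by (induction rule: lin.induct) (auto intro: aff.intros)

lemma aff_diff: "aff A \<Longrightarrow> aff B \<Longrightarrow> aff (\<lambda>f. A f - B f)"
  using aff_add[OF _ aff_uminus] by simp

lemma aff_of_nat_mult:
  assumes "aff A"
  shows "aff (\<lambda>f. real n * A f)"
proof (induction n)
  case 0
  show ?case using aff_diff[OF assms assms] by simp
next
  case (Suc n)
  show ?case using aff_add[OF assms Suc] by (simp add: algebra_simps)
qed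

lemma aff_of_int_mult:
  assumes "aff A"
  shows "aff (\<lambda>f. of_int k * A f)"
proof (cases k)
  case (nonneg n)
  then show ?thesis using aff_of_nat_mult[OF assms] by simp
next
  case (neg n)
  then have k: "of_int k = - real (Suc n)" by simp
  show ?thesis
    unfolding k mult_minus_left by (rule aff_uminus[OF aff_of_nat_mult[OF assms]])
qed

lemma aff_of_int: "aff (\<lambda>f. of_int k)"
  using aff_of_int_mult[OF aff_one] by simp

lemma aff_decompose:
  assumes "aff A"
  obtains c :: int and B where "aff B" "\<And>f a. A (f(i := a)) = of_int c * a + B f"
proof -
  have "\<exists>(c :: int) B. aff B \<and> (\<forall>f a. A (f(i := a)) = of_int c * a + B f)"
    using assms
  proof (induction rule: aff.induct)
    case aff_one
    show ?case by (intro exI[of _ 0] exI[of _ "\<lambda>f. 1"]) (simp add: aff.aff_one)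
  next
    case (aff_var j)
    show ?case
    proof (cases "j = i")
      case True
      then show ?thesis using aff_of_int[of 0] by (intro exI[of _ 1] exI[of _ "\<lambda>f. 0"]) simp
    next
      case False
      then show ?thesis using aff.aff_var[of j] by (intro exI[of _ 0] exI[of _ "\<lambda>f. f j"]) simp
    qed
  next
    case (aff_add A B)
    then obtain c d :: int and A' B' where "aff A'" "aff B'"
      "\<And>f a. A (f(i := a)) = of_int c * a + A' f" "\<And>f a. B (f(i := a)) = of_int d * a + B' f"
      by metis
    note AB = this
    have "A (f(i := a)) + B (f(i := a)) = of_int (c + d) * a + (A' f + B' f)" for f a
      unfolding AB(3,4) by (simp add: algebra_simps)
    then show ?case using aff.aff_add[OF AB(1,2)] by blast
  next
    case (aff_uminus A)
    then obtain c :: int and A' where "aff A'" "\<And>f a. A (f(i := a)) = of_int c * a + A' f"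
      by metis
    note A = this
    have "- A (f(i := a)) = of_int (- c) * a + (- A' f)" for f a
      unfolding A(2) by simp
    then show ?case using aff.aff_uminus[OF A(1)] by blast
  qed
  then show thesis using that by blast
qed

lemma aff_convex_combination:
  assumes "aff A"
  shows "A (\<lambda>i. (1 - t) * x i + t * y i) = (1 - t) * A x + t * A y"
  using assms by (induction rule: aff.induct) (simp_all add: algebra_simps)

lemma continuous_aff:
  assumes "aff A"
  shows "continuous_on UNIV A"
  using assms
proof (induction rule: aff.induct)
  case (aff_var i)
  show ?case by (rule continuous_on_product_coordinates)
qed (auto intro: continuous_on_add continuous_on_minus continuous_on_const)

lemma dfun_aff:
  assumes "aff A"
  shows "dfun (int_expansion \<A>) A"
  using assms by (induction rule: aff.induct) (auto intro: dfun_add dfun_uminus)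

lemma lin_floor_frac:
  assumes "lin A"
  shows "A e = A (\<lambda>i. of_int \<lfloor>e i\<rfloor>) + A (\<lambda>i. frac (e i))"
  using assms by (induction rule: lin.induct) (simp_all add: frac_def)

lemma lin_Ints:
  assumes "lin A"
  shows "A (\<lambda>i. of_int (z i)) \<in> \<int>"
  using assms by (induction rule: lin.induct) auto

text \<open>This leaves finitely many possible carries from the fractional parts into the integer
  part.\<close>

lemma lin_bounded:
  assumes "lin A"
  obtains N :: nat where "\<And>f. (\<And>i. 0 \<le> f i \<and> f i < 1) \<Longrightarrow> \<bar>A f\<bar> \<le> real N"
proof -
  have "\<exists>N :: nat. \<forall>f. (\<forall>i. 0 \<le> f i \<and> f i < 1) \<longrightarrow> \<bar>A f\<bar> \<le> real N"
    using assms
  proof (induction rule: lin.induct)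
    case (lin_var i)
    have "\<bar>f i\<bar> \<le> real 1" if "\<forall>i. 0 \<le> f i \<and> f i < 1" for f :: "nat \<Rightarrow> real"
      using that[rule_format, of i] by simp
    then show ?case by blast
  next
    case (lin_add A B)
    then obtain K L :: nat where
      K: "\<And>f. \<forall>i. 0 \<le> f i \<and> f i < 1 \<Longrightarrow> \<bar>A f\<bar> \<le> real K" and
      L: "\<And>f. \<forall>i. 0 \<le> f i \<and> f i < 1 \<Longrightarrow> \<bar>B f\<bar> \<le> real L" by blast
    have "\<bar>A f + B f\<bar> \<le> real (K + L)" if "\<forall>i. 0 \<le> f i \<and> f i < 1" for f
      using K[OF that] L[OF that] by simp
    then show ?case by blast
  next
    case (lin_uminus A)
    then show ?case by simp
  qed
  then show thesis using that by blast
qed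

section \<open>Polyhedra and elimination of a variable\<close>

text \<open>The flag \<open>s\<close> marks strict inequalities. Negation exchanges the strict and
  the weak kind, so complements of half-spaces are half-spaces.\<close>

definition halfspace :: "((nat \<Rightarrow> real) \<Rightarrow> bool) \<Rightarrow> bool" where
  "halfspace h \<longleftrightarrow> (\<exists>A s. aff A \<and> h = (\<lambda>f. if s then A f < 0 else A f \<le> 0))"

definition polyhedral :: "((nat \<Rightarrow> real) \<Rightarrow> bool) \<Rightarrow> bool" where
  "polyhedral P \<longleftrightarrow> (\<exists>H. finite H \<and> (\<forall>h\<in>H. halfspace h) \<and> P = (\<lambda>f. \<forall>h\<in>H. h f))"

lemma halfspaceE:
  assumes "halfspace h"
  obtains A s where "aff A" "\<And>f. h f \<longleftrightarrow> (if s then A f < 0 else A f \<le> 0)"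
  using assms unfolding halfspace_def by blast

lemma polyhedralE:
  assumes "polyhedral P"
  obtains H where "finite H" "\<And>h. h \<in> H \<Longrightarrow> halfspace h" "\<And>f. P f \<longleftrightarrow> (\<forall>h\<in>H. h f)"
  using assms unfolding polyhedral_def by blast

lemma halfspace_less: "aff A \<Longrightarrow> halfspace (\<lambda>f. A f < 0)"
  unfolding halfspace_def by (intro exI[of _ A] exI[of _ True]) simp

lemma halfspace_le: "aff A \<Longrightarrow> halfspace (\<lambda>f. A f \<le> 0)"
  unfolding halfspace_def by (intro exI[of _ A] exI[of _ False]) simp

lemma halfspace_not:
  assumes "halfspace h"
  shows "halfspace (\<lambda>f. \<not> h f)"
proof -
  from assms obtain A s where A: "aff A" "h = (\<lambda>f. if s then A f < 0 else A f \<le> 0)"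
    unfolding halfspace_def by blast
  have "(\<lambda>f. \<not> h f) = (\<lambda>f. if \<not> s then - A f < 0 else - A f \<le> 0)" by (auto simp: A(2))
  then show ?thesis unfolding halfspace_def using aff_uminus[OF A(1)] by blast
qed

lemma polyhedral_halfspace: "halfspace h \<Longrightarrow> polyhedral h"
  unfolding polyhedral_def by (intro exI[of _ "{h}"]) auto

lemma polyhedral_true: "polyhedral (\<lambda>f. True)"
  unfolding polyhedral_def by (intro exI[of _ "{}"]) auto

lemma polyhedral_conj:
  assumes "polyhedral P" "polyhedral Q"
  shows "polyhedral (\<lambda>f. P f \<and> Q f)"
proof -
  obtain H K where "finite H" "\<forall>h\<in>H. halfspace h" "P = (\<lambda>f. \<forall>h\<in>H. h f)"
    "finite K" "\<forall>h\<in>K. halfspace h" "Q = (\<lambda>f. \<forall>h\<in>K. h f)"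
    using assms unfolding polyhedral_def by blast
  then show ?thesis unfolding polyhedral_def by (intro exI[of _ "H \<union> K"]) auto
qed

lemma polyhedral_ball:
  assumes "finite I" "\<And>i. i \<in> I \<Longrightarrow> polyhedral (P i)"
  shows "polyhedral (\<lambda>f. \<forall>i\<in>I. P i f)"
  using assms
  by (induction I rule: finite_induct) (auto intro: polyhedral_true polyhedral_conj)

lemma polyhedral_less: "aff A \<Longrightarrow> polyhedral (\<lambda>f. A f < 0)"
  by (intro polyhedral_halfspace halfspace_less)

lemma polyhedral_le: "aff A \<Longrightarrow> polyhedral (\<lambda>f. A f \<le> 0)"
  by (intro polyhedral_halfspace halfspace_le)

text \<open>The first inequality bounds \<open>a\<close> above by \<open>- u / c\<close>, the second
  bounds it below by \<open>- v / d\<close>. Cross-multiplication compares the bounds without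
  division, which keeps the coefficients integral.\<close>

lemma ex_between_iff:
  fixes c d u v :: real
  assumes "c > 0" "d < 0"
  shows "(\<exists>a. (if s then c * a + u < 0 else c * a + u \<le> 0) \<and>
      (if t then d * a + v < 0 else d * a + v \<le> 0)) \<longleftrightarrow>
    (if s \<or> t then c * v - d * u < 0 else c * v - d * u \<le> 0)"
    (is "?L \<longleftrightarrow> ?R")
proof
  assume ?L
  then obtain a where a: "if s then c * a + u < 0 else c * a + u \<le> 0"
    "if t then d * a + v < 0 else d * a + v \<le> 0" by blast
  \<comment> \<open>The positive combination of the two inequalities in which \<open>a\<close>
    cancels.\<close>
  have eq: "c * v - d * u = c * (d * a + v) + (- d) * (c * a + u)" by (simp add: algebra_simps)
  have a': "c * a + u \<le> 0" "d * a + v \<le> 0" using a by (auto split: if_splits)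
  have nonpos: "c * (d * a + v) \<le> 0" "(- d) * (c * a + u) \<le> 0"
    using assms by (intro mult_nonneg_nonpos a'; simp)+
  have "(- d) * (c * a + u) < 0" if s
    using a that assms by (intro mult_pos_neg) simp_all
  moreover have "c * (d * a + v) < 0" if t
    using a that assms by (intro mult_pos_neg) simp_all
  ultimately show ?R unfolding eq using nonpos by (smt (verit))
next
  assume R: ?R
  define l where "l = - v / d"
  define r where "r = - u / c"
  have l: "d * l + v = 0" and r: "c * r + u = 0"
    using assms by (simp_all add: l_def r_def)
  have uv: "v = - d * l" "u = - c * r" using l r by simp_all
  define p where "p = c * - d"
  have eq: "c * v - d * u = p * (l - r)" unfolding uv p_def by (simp add: algebra_simps)
  have "p > 0" unfolding p_def using assms by (simp add: mult_pos_neg)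
  then have lr: "if s \<or> t then l < r else l \<le> r"
    using R unfolding eq by (auto simp: mult_less_0_iff mult_le_0_iff split: if_splits)
  have c: "c * a + u < 0 \<longleftrightarrow> a < r" "c * a + u \<le> 0 \<longleftrightarrow> a \<le> r" for a
    using assms(1) unfolding uv(2) by simp_all
  have d: "d * a + v < 0 \<longleftrightarrow> l < a" "d * a + v \<le> 0 \<longleftrightarrow> l \<le> a" for a
    using assms(2) unfolding uv(1) by simp_all
  show ?L
  proof (cases "s \<and> t")
    case True
    then show ?thesis unfolding c d using lr dense[of l r] by auto
  next
    \<comment> \<open>At most one bound is strict, so an endpoint is a witness: the upper one,
      unless it is excluded.\<close>
    case False
    then show ?thesis unfolding c d using lr
      by (intro exI[of _ "if s then l else r"]) auto
  qed
qed

text \<open>A constraint with coefficient 0 stays as it is. A constraint with nonzero coefficient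
  can be met by a suitable \<open>a\<close>. Two coefficients of equal sign are served together by
  going far out in one direction, and opposite signs are the case of
  \<open>ex_between_iff\<close>.\<close>

lemma polyhedral_project_two:
  assumes "halfspace h" "halfspace k"
  shows "polyhedral (\<lambda>f. \<exists>a. h (f(i := a)) \<and> k (f(i := a)))"
proof -
  obtain A s where A: "aff A" "\<And>f. h f \<longleftrightarrow> (if s then A f < 0 else A f \<le> 0)"
    using halfspaceE[OF assms(1)] by metis
  obtain B t where B: "aff B" "\<And>f. k f \<longleftrightarrow> (if t then B f < 0 else B f \<le> 0)"
    using halfspaceE[OF assms(2)] by metis
  obtain c :: int and A' where A': "aff A'" "\<And>f a. A (f(i := a)) = of_int c * a + A' f"
    by (rule aff_decompose[OF A(1), of i]) blast
  obtain d :: int and B' where B': "aff B'" "\<And>f a. B (f(i := a)) = of_int d * a + B' f"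
    by (rule aff_decompose[OF B(1), of i]) blast
  have less: "\<exists>a. of_int c * a + A' f < 0 \<and> of_int d * a + B' f < 0" if "c > 0" "d > 0" for f
  proof -
    obtain m where m: "A' f < m" "B' f < m" "0 < m"
      using that by (metis gt_ex max_less_iff_conj)
    \<comment> \<open>Positive integers are at least 1, so \<open>- m\<close> outweighs both
      constant terms.\<close>
    have "of_int c * (- m) \<le> 1 * (- m)" "of_int d * (- m) \<le> 1 * (- m)"
      using that m(3) by (intro mult_right_mono_neg; simp)+
    then show ?thesis using m by (intro exI[of _ "- m"] conjI) linarith+
  qed
  have greater: "\<exists>a. of_int c * a + A' f < 0 \<and> of_int d * a + B' f < 0" if "c < 0" "d < 0" for f
  proof -
    obtain m where m: "A' f < m" "B' f < m" "0 < m"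
      using that by (metis gt_ex max_less_iff_conj)
    have "real_of_int c \<le> - 1" "real_of_int d \<le> - 1" using that by linarith+
    then have "of_int c * m \<le> - 1 * m" "of_int d * m \<le> - 1 * m"
      using m(3) by (intro mult_right_mono; simp)+
    then show ?thesis using m by (intro exI[of _ m] conjI) linarith+
  qed
  have elim: "polyhedral (\<lambda>f. if b then X f < 0 else X f \<le> 0)" if "aff X" for b X
    using polyhedral_less[OF that] polyhedral_le[OF that] by (cases b) simp_all
  have unbounded: "\<exists>a. of_int k * a + x < (0 :: real)" if "k \<noteq> 0" for k :: int and x
    using that by (intro exI[of _ "(- x - 1) / of_int k"]) simp
  have unbounded': "\<exists>a. if b then of_int k * a + x < (0 :: real) else of_int k * a + x \<le> 0"
    if "k \<noteq> 0" for k :: int and x b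
    using unbounded[OF that, of x] by (meson less_imp_le)
  have P: "(\<lambda>f. \<exists>a. h (f(i := a)) \<and> k (f(i := a))) = (\<lambda>f. \<exists>a.
      (if s then of_int c * a + A' f < 0 else of_int c * a + A' f \<le> 0) \<and>
      (if t then of_int d * a + B' f < 0 else of_int d * a + B' f \<le> 0))"
    by (simp only: A(2) A'(2) B(2) B'(2))
  have comm: "(\<exists>a. X a \<and> Y a) \<longleftrightarrow> (\<exists>a. Y a \<and> X a)" for X Y :: "real \<Rightarrow> bool"
    by blast
  consider "c = 0" "d = 0" | "c = 0" "d \<noteq> 0" | "c \<noteq> 0" "d = 0" | "c > 0" "d > 0" | "c < 0" "d < 0"
    | "c > 0" "d < 0" | "c < 0" "d > 0" by linarith
  then show ?thesis
  proof cases
    case 1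
    then have "(\<lambda>f. \<exists>a. h (f(i := a)) \<and> k (f(i := a))) = (\<lambda>f.
        (if s then A' f < 0 else A' f \<le> 0) \<and> (if t then B' f < 0 else B' f \<le> 0))"
      unfolding P by auto
    then show ?thesis using polyhedral_conj[OF elim[OF A'(1), of s] elim[OF B'(1), of t]] by (simp only:)
  next
    case 2
    have "(\<lambda>f. \<exists>a. h (f(i := a)) \<and> k (f(i := a))) = (\<lambda>f. if s then A' f < 0 else A' f \<le> 0)"
      unfolding P 2(1)
      by (simp only: of_int_0 mult_zero_left add_0_left ex_simps unbounded'[OF 2(2)] simp_thms)
    then show ?thesis using elim[OF A'(1), of s] by (simp only:)
  next
    case 3
    have "(\<lambda>f. \<exists>a. h (f(i := a)) \<and> k (f(i := a))) = (\<lambda>f. if t then B' f < 0 else B' f \<le> 0)"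
      unfolding P 3(2)
      by (simp only: of_int_0 mult_zero_left add_0_left ex_simps unbounded'[OF 3(1)] simp_thms)
    then show ?thesis using elim[OF B'(1), of t] by (simp only:)
  next
    case 4
    have "(\<lambda>f. \<exists>a. h (f(i := a)) \<and> k (f(i := a))) = (\<lambda>f. True)"
    proof
      fix f
      from less[OF 4] obtain a where "of_int c * a + A' f < 0" "of_int d * a + B' f < 0" by blast
      then have "h (f(i := a)) \<and> k (f(i := a))" by (simp add: A(2) A'(2) B(2) B'(2) del: fun_upd_apply)
      then show "(\<exists>a. h (f(i := a)) \<and> k (f(i := a))) = True" by blast
    qed
    then show ?thesis using polyhedral_true by simp
  next
    case 5
    have "(\<lambda>f. \<exists>a. h (f(i := a)) \<and> k (f(i := a))) = (\<lambda>f. True)"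
    proof
      fix f
      from greater[OF 5] obtain a where "of_int c * a + A' f < 0" "of_int d * a + B' f < 0" by blast
      then have "h (f(i := a)) \<and> k (f(i := a))" by (simp add: A(2) A'(2) B(2) B'(2) del: fun_upd_apply)
      then show "(\<exists>a. h (f(i := a)) \<and> k (f(i := a))) = True" by blast
    qed
    then show ?thesis using polyhedral_true by simp
  next
    case 6
    then have "(\<lambda>f. \<exists>a. h (f(i := a)) \<and> k (f(i := a))) =
        (\<lambda>f. if s \<or> t then of_int c * B' f - of_int d * A' f < 0 else of_int c * B' f - of_int d * A' f \<le> 0)"
      unfolding P by (intro ext ex_between_iff) simp_all
    then show ?thesis using elim[OF aff_diff[OF aff_of_int_mult[OF B'(1)] aff_of_int_mult[OF A'(1)]]] by (simp only:)
  next
    case 7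
    then have "(\<lambda>f. \<exists>a. h (f(i := a)) \<and> k (f(i := a))) =
        (\<lambda>f. if t \<or> s then of_int d * A' f - of_int c * B' f < 0 else of_int d * A' f - of_int c * B' f \<le> 0)"
      unfolding P by (intro ext trans[OF comm ex_between_iff]) simp_all
    then show ?thesis using elim[OF aff_diff[OF aff_of_int_mult[OF A'(1)] aff_of_int_mult[OF B'(1)]]] by (simp only:)
  qed
qed

lemma convex_halfspace_line:
  assumes "halfspace h"
  shows "convex {a. h (f(i := a))}"
proof -
  obtain A s where A: "aff A" "\<And>f. h f \<longleftrightarrow> (if s then A f < 0 else A f \<le> 0)"
    using halfspaceE[OF assms(1)] by metis
  obtain c :: int and A' where A': "aff A'" "\<And>f a. A (f(i := a)) = of_int c * a + A' f"
    by (rule aff_decompose[OF A(1), of i]) blast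
  have "{a. h (f(i := a))} =
      (if s then {a. inner (of_int c) a < - A' f} else {a. inner (of_int c) a \<le> - A' f})"
    by (auto simp: A(2) A'(2))
  then show ?thesis
    using convex_halfspace_lt[of "of_int c :: real"] convex_halfspace_le[of "of_int c :: real"]
    by (cases s) (simp_all del: inner_real_def)
qed

text \<open>Fourier--Motzkin elimination, reduced to two constraints at a time by Helly's theorem on the line.\<close>

lemma polyhedral_project:
  assumes "polyhedral P"
  shows "polyhedral (\<lambda>f. \<exists>a. P (f(i := a)))"
proof -
  obtain H where H: "finite H" "\<And>h. h \<in> H \<Longrightarrow> halfspace h" "\<And>f. P f \<longleftrightarrow> (\<forall>h\<in>H. h f)"
    using polyhedralE[OF assms] by metis
  have "(\<exists>a. P (f(i := a))) \<longleftrightarrow> (\<forall>h\<in>H. \<forall>k\<in>H. \<exists>a. h (f(i := a)) \<and> k (f(i := a)))" for f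
  proof
    assume *: "\<forall>h\<in>H. \<forall>k\<in>H. \<exists>a. h (f(i := a)) \<and> k (f(i := a))"
    let ?S = "(\<lambda>h. {a. h (f(i := a))}) ` H"
    have "\<Inter> ?S \<noteq> {}"
    proof (cases "card ?S \<ge> 2")
      case True
      show ?thesis
      proof (rule Helly)
        show "DIM(real) + 1 \<le> card ?S" using True by simp
        show "\<forall>s\<in>?S. convex s" using convex_halfspace_line H(2) by blast
        show "\<And>t. t \<subseteq> ?S \<Longrightarrow> card t = DIM(real) + 1 \<Longrightarrow> \<Inter> t \<noteq> {}"
        proof -
          fix t assume t: "t \<subseteq> ?S" "card t = DIM(real) + 1"
          then have "card t = 2" by simp
          then obtain u v where uv: "t = {u, v}" by (meson card_2_iff)
          with t(1) have "u \<in> ?S" "v \<in> ?S" by simp_all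
          then obtain h k where hk: "h \<in> H" "u = {a. h (f(i := a))}" "k \<in> H" "v = {a. k (f(i := a))}"
            by (elim imageE) (rule that)
          then obtain a where "h (f(i := a))" "k (f(i := a))" using * by blast
          then have "a \<in> \<Inter> t" unfolding uv hk by simp
          then show "\<Inter> t \<noteq> {}" by blast
        qed
      qed
    next
      \<comment> \<open>Helly's theorem is applied to at least two sets, but distinct constraints
        may cut out the same set on the line. Here all of them do, and \<open>*\<close> with both
        constraints equal shows that this set is nonempty.\<close>
      case False
      have fin: "finite ?S" using H(1) by simp
      have card: "card ?S \<le> Suc 0" using False by simp
      have eq: "\<forall>u\<in>?S. \<forall>v\<in>?S. u = v"
        by (rule iffD1[OF card_le_Suc0_iff_eq[OF fin] card])
      show ?thesis
      proof (cases "H = {}")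
        case False
        then obtain h where h: "h \<in> H" by blast
        then obtain a where a: "h (f(i := a))" using * by blast
        have k: "k (f(i := a))" if "k \<in> H" for k
        proof -
          have "{a. k (f(i := a))} = {a. h (f(i := a))}" using eq h that by (intro bspec[OF bspec[OF eq]] imageI)
          then show ?thesis using a by blast
        qed
        have "a \<in> \<Inter> ?S" by (rule INT_I, rule CollectI, erule k)
        then show ?thesis by blast
      qed simp
    qed
    then obtain a where "a \<in> \<Inter> ?S" by blast
    then have "\<forall>h\<in>H. h (f(i := a))" by (simp only: INT_iff mem_Collect_eq)
    then show "\<exists>a. P (f(i := a))" unfolding H(3) by (rule exI)
  next
    assume "\<exists>a. P (f(i := a))"
    then obtain a where a: "\<forall>h\<in>H. h (f(i := a))" unfolding H(3) by (elim exE)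
    show "\<forall>h\<in>H. \<forall>k\<in>H. \<exists>a. h (f(i := a)) \<and> k (f(i := a))"
      by (intro ballI exI[of _ a] conjI; erule bspec[OF a])
  qed
  moreover have "polyhedral (\<lambda>f. \<forall>h\<in>H. \<forall>k\<in>H. \<exists>a. h (f(i := a)) \<and> k (f(i := a)))"
    by (intro polyhedral_ball polyhedral_project_two H)
  ultimately show ?thesis by simp
qed

lemma dpred_polyhedral:
  assumes "polyhedral P"
  shows "dpred (int_expansion \<A>) P"
proof -
  obtain H where H: "finite H" "\<And>h. h \<in> H \<Longrightarrow> halfspace h" "\<And>f. P f \<longleftrightarrow> (\<forall>h\<in>H. h f)"
    using polyhedralE[OF assms] by metis
  have "dpred (int_expansion \<A>) h" if "halfspace h" for h
  proof -
    obtain A s where A: "aff A" "\<And>f. h f \<longleftrightarrow> (if s then A f < 0 else A f \<le> 0)"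
      using halfspaceE[OF \<open>halfspace h\<close>] by metis
    have "h = (if s then (\<lambda>f. A f < 0) else (\<lambda>f. A f \<le> 0))" using A(2) by auto
    then show ?thesis
      using dpred_less[OF dfun_aff[OF A(1)] dfun_const[of _ 0]]
        dpred_le[OF dfun_aff[OF A(1)] dfun_const[of _ 0]]
      by (cases s) simp_all
  qed
  then show ?thesis unfolding H(3) by (intro dpred_ball H(1)) (use H(2) in blast)
qed

section \<open>Segments towards the closure\<close>

text \<open>Convexity alone is weaker: in an open square together with half of one edge, the segment
  from a point of that half to the far end of the edge leaves the set.\<close>

definition closure_accessible :: "(nat \<Rightarrow> real) set \<Rightarrow> bool" where
  "closure_accessible P \<longleftrightarrow> (\<forall>x\<in>P. \<forall>y\<in>closure P. \<forall>t. 0 \<le> t \<and> t < 1 \<longrightarrow>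
     (\<lambda>i. (1 - t) * x i + t * y i) \<in> P)"

text \<open>At \<open>y\<close> every constraint survives in its weak form. Strict ones are restored
  along the segment by \<open>x\<close>, whose weight \<open>1 - t\<close> is positive.\<close>

lemma closure_accessible_polyhedral:
  assumes "polyhedral P"
  shows "closure_accessible {x. P x}"
proof -
  obtain H where H: "finite H" "\<And>h. h \<in> H \<Longrightarrow> halfspace h" "\<And>f. P f \<longleftrightarrow> (\<forall>h\<in>H. h f)"
    using polyhedralE[OF assms] by metis
  show ?thesis
    unfolding closure_accessible_def
  proof (intro ballI allI impI)
    fix x y and t :: real
    assume x: "x \<in> {x. P x}" and y: "y \<in> closure {x. P x}" and t: "0 \<le> t \<and> t < 1"
    have "h (\<lambda>i. (1 - t) * x i + t * y i)" if "h \<in> H" for h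
    proof -
      obtain A s where A: "aff A" "\<And>f. h f \<longleftrightarrow> (if s then A f < 0 else A f \<le> 0)"
        using halfspaceE[OF H(2)[OF \<open>h \<in> H\<close>]] by metis
      have "closed {f. A f \<le> 0}"
        by (intro closed_Collect_le continuous_aff A continuous_on_const)
      moreover have "{x. P x} \<subseteq> {f. A f \<le> 0}"
        using that unfolding H(3) by (auto simp: A(2) split: if_splits)
      ultimately have "A y \<le> 0" using y closure_minimal by blast
      then have Ay: "t * A y \<le> 0" using t by (simp add: mult_le_0_iff)
      have "h x" using x that unfolding mem_Collect_eq H(3) by blast
      then have "if s then (1 - t) * A x < 0 else (1 - t) * A x \<le> 0"
        using t by (auto simp: A(2) mult_less_0_iff mult_le_0_iff split: if_splits)
      then show ?thesis
        using Ay by (simp add: A(2) aff_convex_combination[OF A(1)] split: if_splits)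
    qed
    then show "(\<lambda>i. (1 - t) * x i + t * y i) \<in> {x. P x}" unfolding mem_Collect_eq H(3) by blast
  qed
qed

text \<open>
  As \<open>\<int> \<times> [0, 1)\<close> with carries, \<open>(\<real>, <, +, \<int>)\<close> decomposes in the manner of Feferman and Vaught:
  a definable set is a finite union of products of a condition on the integer parts and a
  polyhedral condition on the fractional parts.
\<close>

definition cellular :: "(nat \<times> (nat \<Rightarrow> int) set) set \<Rightarrow> ((nat \<Rightarrow> real) \<Rightarrow> bool) \<Rightarrow> bool" where
  "cellular \<A> S \<longleftrightarrow> (\<exists>\<B>. finite \<B> \<and>
     (\<forall>b\<in>\<B>. dpred (int_expansion \<A>) (\<lambda>e. fst b (\<lambda>i. \<lfloor>e i\<rfloor>)) \<and> polyhedral (snd b)) \<and>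
     S = (\<lambda>e. \<exists>b\<in>\<B>. fst b (\<lambda>i. \<lfloor>e i\<rfloor>) \<and> snd b (\<lambda>i. frac (e i))))"

lemma cellularE:
  assumes "cellular \<A> S"
  obtains \<B> where "finite \<B>"
    "\<And>b. b \<in> \<B> \<Longrightarrow> dpred (int_expansion \<A>) (\<lambda>e. fst b (\<lambda>i. \<lfloor>e i\<rfloor>))"
    "\<And>b. b \<in> \<B> \<Longrightarrow> polyhedral (snd b)"
    "S = (\<lambda>e. \<exists>b\<in>\<B>. fst b (\<lambda>i. \<lfloor>e i\<rfloor>) \<and> snd b (\<lambda>i. frac (e i)))"
  using assms unfolding cellular_def by blast

lemma cellular_box:
  assumes "dpred (int_expansion \<A>) (\<lambda>e. D (\<lambda>i. \<lfloor>e i\<rfloor>))" "polyhedral P"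
  shows "cellular \<A> (\<lambda>e. D (\<lambda>i. \<lfloor>e i\<rfloor>) \<and> P (\<lambda>i. frac (e i)))"
  unfolding cellular_def using assms by (intro exI[of _ "{(D, P)}"]) simp

lemma cellular_false: "cellular \<A> (\<lambda>e. False)"
  unfolding cellular_def by (intro exI[of _ "{}"]) simp

lemma cellular_disj:
  assumes "cellular \<A> S" "cellular \<A> T"
  shows "cellular \<A> (\<lambda>e. S e \<or> T e)"
proof -
  obtain \<B> where B: "finite \<B>"
    "\<And>b. b \<in> \<B> \<Longrightarrow> dpred (int_expansion \<A>) (\<lambda>e. fst b (\<lambda>i. \<lfloor>e i\<rfloor>))"
    "\<And>b. b \<in> \<B> \<Longrightarrow> polyhedral (snd b)"
    "S = (\<lambda>e. \<exists>b\<in>\<B>. fst b (\<lambda>i. \<lfloor>e i\<rfloor>) \<and> snd b (\<lambda>i. frac (e i)))"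
    using assms(1) by (rule cellularE) (rule that)
  obtain \<C> where C: "finite \<C>"
    "\<And>b. b \<in> \<C> \<Longrightarrow> dpred (int_expansion \<A>) (\<lambda>e. fst b (\<lambda>i. \<lfloor>e i\<rfloor>))"
    "\<And>b. b \<in> \<C> \<Longrightarrow> polyhedral (snd b)"
    "T = (\<lambda>e. \<exists>b\<in>\<C>. fst b (\<lambda>i. \<lfloor>e i\<rfloor>) \<and> snd b (\<lambda>i. frac (e i)))"
    using assms(2) by (rule cellularE) (rule that)
  show ?thesis
    unfolding cellular_def
  proof (intro exI conjI ballI)
    show "finite (\<B> \<union> \<C>)" using B(1) C(1) by simp
    show "(\<lambda>e. S e \<or> T e) = (\<lambda>e. \<exists>b\<in>\<B> \<union> \<C>. fst b (\<lambda>i. \<lfloor>e i\<rfloor>) \<and> snd b (\<lambda>i. frac (e i)))"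
      unfolding B(4) C(4) by (simp only: bex_Un)
    fix b assume "b \<in> \<B> \<union> \<C>"
    then show "dpred (int_expansion \<A>) (\<lambda>e. fst b (\<lambda>i. \<lfloor>e i\<rfloor>))" "polyhedral (snd b)"
      using B(2,3) C(2,3) by (elim UnE; simp)+
  qed
qed

lemma cellular_bex:
  assumes "finite I" "\<And>i. i \<in> I \<Longrightarrow> cellular \<A> (S i)"
  shows "cellular \<A> (\<lambda>e. \<exists>i\<in>I. S i e)"
  using assms
  by (induction I rule: finite_induct) (auto intro: cellular_false cellular_disj)

lemma cellular_conj:
  assumes "cellular \<A> S" "cellular \<A> T"
  shows "cellular \<A> (\<lambda>e. S e \<and> T e)"
proof -
  obtain \<B> where B: "finite \<B>"
    "\<And>b. b \<in> \<B> \<Longrightarrow> dpred (int_expansion \<A>) (\<lambda>e. fst b (\<lambda>i. \<lfloor>e i\<rfloor>))"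
    "\<And>b. b \<in> \<B> \<Longrightarrow> polyhedral (snd b)"
    "S = (\<lambda>e. \<exists>b\<in>\<B>. fst b (\<lambda>i. \<lfloor>e i\<rfloor>) \<and> snd b (\<lambda>i. frac (e i)))"
    using assms(1) by (rule cellularE) (rule that)
  obtain \<C> where C: "finite \<C>"
    "\<And>b. b \<in> \<C> \<Longrightarrow> dpred (int_expansion \<A>) (\<lambda>e. fst b (\<lambda>i. \<lfloor>e i\<rfloor>))"
    "\<And>b. b \<in> \<C> \<Longrightarrow> polyhedral (snd b)"
    "T = (\<lambda>e. \<exists>b\<in>\<C>. fst b (\<lambda>i. \<lfloor>e i\<rfloor>) \<and> snd b (\<lambda>i. frac (e i)))"
    using assms(2) by (rule cellularE) (rule that)
  have "cellular \<A> (\<lambda>e. (fst b (\<lambda>i. \<lfloor>e i\<rfloor>) \<and> fst c (\<lambda>i. \<lfloor>e i\<rfloor>)) \<and>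
      (snd b (\<lambda>i. frac (e i)) \<and> snd c (\<lambda>i. frac (e i))))" if "b \<in> \<B>" "c \<in> \<C>" for b c
    using B(2,3) C(2,3) that
    by (intro cellular_box[where D = "\<lambda>z. fst b z \<and> fst c z" and P = "\<lambda>f. snd b f \<and> snd c f"]
        dpred_conj polyhedral_conj) simp_all
  then have "cellular \<A> (\<lambda>e. \<exists>b\<in>\<B>. \<exists>c\<in>\<C>. (fst b (\<lambda>i. \<lfloor>e i\<rfloor>) \<and> fst c (\<lambda>i. \<lfloor>e i\<rfloor>)) \<and>
      (snd b (\<lambda>i. frac (e i)) \<and> snd c (\<lambda>i. frac (e i))))"
    by (intro cellular_bex B(1) C(1))
  moreover have "(\<lambda>e. S e \<and> T e) = (\<lambda>e. \<exists>b\<in>\<B>. \<exists>c\<in>\<C>. (fst b (\<lambda>i. \<lfloor>e i\<rfloor>) \<and> fst c (\<lambda>i. \<lfloor>e i\<rfloor>)) \<and>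
      (snd b (\<lambda>i. frac (e i)) \<and> snd c (\<lambda>i. frac (e i))))"
    unfolding B(4) C(4) by (intro ext) blast
  ultimately show ?thesis by simp
qed

lemma cellular_floor:
  assumes "dpred (int_expansion \<A>) (\<lambda>e. D (\<lambda>i. \<lfloor>e i\<rfloor>))"
  shows "cellular \<A> (\<lambda>e. D (\<lambda>i. \<lfloor>e i\<rfloor>))"
  using cellular_box[OF assms polyhedral_true] by simp

lemma cellular_frac:
  assumes "polyhedral P"
  shows "cellular \<A> (\<lambda>e. P (\<lambda>i. frac (e i)))"
  using cellular_box[of \<A> "\<lambda>z. True", OF _ assms] by simp

lemma cellular_ball:
  assumes "finite I" "\<And>i. i \<in> I \<Longrightarrow> cellular \<A> (S i)"
  shows "cellular \<A> (\<lambda>e. \<forall>i\<in>I. S i e)"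
  using assms
proof (induction I rule: finite_induct)
  case empty
  show ?case using cellular_floor[of \<A> "\<lambda>z. True"] by simp
qed (auto intro: cellular_conj)

text \<open>By de Morgan, the condition on integer parts is negated inside the structure, and a
  negated polyhedral condition becomes a finite union of opposite half-spaces.\<close>

lemma cellular_not:
  assumes "cellular \<A> S"
  shows "cellular \<A> (\<lambda>e. \<not> S e)"
proof -
  obtain \<B> where B: "finite \<B>"
    "\<And>b. b \<in> \<B> \<Longrightarrow> dpred (int_expansion \<A>) (\<lambda>e. fst b (\<lambda>i. \<lfloor>e i\<rfloor>))"
    "\<And>b. b \<in> \<B> \<Longrightarrow> polyhedral (snd b)"
    "S = (\<lambda>e. \<exists>b\<in>\<B>. fst b (\<lambda>i. \<lfloor>e i\<rfloor>) \<and> snd b (\<lambda>i. frac (e i)))"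
    using assms(1) by (rule cellularE) (rule that)
  have frac: "cellular \<A> (\<lambda>e. \<not> P (\<lambda>i. frac (e i)))" if P: "polyhedral P" for P
  proof -
    obtain H where H: "finite H" "\<And>h. h \<in> H \<Longrightarrow> halfspace h" "\<And>f. P f \<longleftrightarrow> (\<forall>h\<in>H. h f)"
      using polyhedralE[OF P] by metis
    have "cellular \<A> (\<lambda>e. \<exists>h\<in>H. \<not> h (\<lambda>i. frac (e i)))"
    proof (rule cellular_bex[OF H(1)])
      fix h assume "h \<in> H"
      from cellular_frac[OF polyhedral_halfspace[OF halfspace_not[OF H(2)[OF this]]]]
      show "cellular \<A> (\<lambda>e. \<not> h (\<lambda>i. frac (e i)))" .
    qed
    moreover have "(\<lambda>e. \<not> P (\<lambda>i. frac (e i))) = (\<lambda>e. \<exists>h\<in>H. \<not> h (\<lambda>i. frac (e i)))"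
      unfolding H(3) by (simp only: ball_simps)
    ultimately show ?thesis by (simp only:)
  qed
  have "cellular \<A> (\<lambda>e. \<forall>b\<in>\<B>. \<not> fst b (\<lambda>i. \<lfloor>e i\<rfloor>) \<or> \<not> snd b (\<lambda>i. frac (e i)))"
  proof (rule cellular_ball[OF B(1)])
    fix b assume "b \<in> \<B>"
    note b = B(2,3)[OF this]
    show "cellular \<A> (\<lambda>e. \<not> fst b (\<lambda>i. \<lfloor>e i\<rfloor>) \<or> \<not> snd b (\<lambda>i. frac (e i)))"
      using cellular_disj[OF cellular_floor[where D = "\<lambda>z. \<not> fst b z", OF dpred_not[OF b(1)]] frac[OF b(2)]] .
  qed
  then show ?thesis unfolding B(4) by (simp only: bex_simps de_Morgan_conj)
qed

lemma cellular_ex: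
  assumes "cellular \<A> S"
  shows "cellular \<A> (\<lambda>e. \<exists>a. S (e(i := a)))"
proof -
  obtain \<B> where B: "finite \<B>"
    "\<And>b. b \<in> \<B> \<Longrightarrow> dpred (int_expansion \<A>) (\<lambda>e. fst b (\<lambda>i. \<lfloor>e i\<rfloor>))"
    "\<And>b. b \<in> \<B> \<Longrightarrow> polyhedral (snd b)"
    "S = (\<lambda>e. \<exists>b\<in>\<B>. fst b (\<lambda>i. \<lfloor>e i\<rfloor>) \<and> snd b (\<lambda>i. frac (e i)))"
    using assms(1) by (rule cellularE) (rule that)
  have box: "cellular \<A> (\<lambda>e. \<exists>a. D (\<lambda>j. \<lfloor>(e(i := a)) j\<rfloor>) \<and> P (\<lambda>j. frac ((e(i := a)) j)))"
    if D: "dpred (int_expansion \<A>) (\<lambda>e. D (\<lambda>i. \<lfloor>e i\<rfloor>))" and P: "polyhedral P" for D P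
  proof -
    \<comment> \<open>The fractional part of the quantified number must lie in [0, 1); this becomes
      part of the polyhedral condition. Then integer and fractional parts can be chosen
      independently.\<close>
    let ?Q = "\<lambda>f. P f \<and> - f i \<le> 0 \<and> f i - 1 < 0"
    have "(\<exists>a. D (\<lambda>j. \<lfloor>(e(i := a)) j\<rfloor>) \<and> P (\<lambda>j. frac ((e(i := a)) j))) \<longleftrightarrow>
        (\<exists>k. D ((\<lambda>j. \<lfloor>e j\<rfloor>)(i := k))) \<and> (\<exists>a. ?Q ((\<lambda>j. frac (e j))(i := a)))" (is "?L \<longleftrightarrow> ?R") for e
    proof -
      have upd: "(\<lambda>j. \<lfloor>(e(i := a)) j\<rfloor>) = (\<lambda>j. \<lfloor>e j\<rfloor>)(i := \<lfloor>a\<rfloor>)"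
        "(\<lambda>j. frac ((e(i := a)) j)) = (\<lambda>j. frac (e j))(i := frac a)" for a by auto
      show ?thesis
      proof
        assume ?L
        then obtain a where a: "D ((\<lambda>j. \<lfloor>e j\<rfloor>)(i := \<lfloor>a\<rfloor>))" "P ((\<lambda>j. frac (e j))(i := frac a))"
          unfolding upd by blast
        then have "?Q ((\<lambda>j. frac (e j))(i := frac a))" by (simp add: frac_lt_1)
        then show ?R using a(1) by blast
      next
        assume ?R
        then obtain k a where ka: "D ((\<lambda>j. \<lfloor>e j\<rfloor>)(i := k))" "P ((\<lambda>j. frac (e j))(i := a))"
          "0 \<le> a" "a < 1" by auto
        then have "\<lfloor>of_int k + a\<rfloor> = k" "frac (of_int k + a) = a"
          by (simp_all add: floor_unique frac_unique_iff)
        then show ?L unfolding upd using ka(1,2) by metis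
      qed
    qed
    moreover have "dpred (int_expansion \<A>) (\<lambda>e. \<exists>k. D ((\<lambda>j. \<lfloor>e j\<rfloor>)(i := k)))"
    proof -
      have "(\<lambda>e. \<exists>k. D ((\<lambda>j. \<lfloor>e j\<rfloor>)(i := k))) = (\<lambda>e :: nat \<Rightarrow> real. \<exists>a. D (\<lambda>j. \<lfloor>(e(i := a)) j\<rfloor>))"
      proof (intro ext iffI)
        fix e :: "nat \<Rightarrow> real"
        assume "\<exists>k. D ((\<lambda>j. \<lfloor>e j\<rfloor>)(i := k))"
        then obtain k where "D ((\<lambda>j. \<lfloor>e j\<rfloor>)(i := k))" ..
        moreover have "(\<lambda>j. \<lfloor>e j\<rfloor>)(i := k) = (\<lambda>j. \<lfloor>(e(i := of_int k)) j\<rfloor>)" by auto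
        ultimately show "\<exists>a. D (\<lambda>j. \<lfloor>(e(i := a)) j\<rfloor>)" by metis
      next
        fix e :: "nat \<Rightarrow> real"
        assume "\<exists>a. D (\<lambda>j. \<lfloor>(e(i := a)) j\<rfloor>)"
        then obtain a where "D (\<lambda>j. \<lfloor>(e(i := a)) j\<rfloor>)" ..
        moreover have "(\<lambda>j. \<lfloor>e j\<rfloor>)(i := \<lfloor>a\<rfloor>) = (\<lambda>j. \<lfloor>(e(i := a)) j\<rfloor>)" by auto
        ultimately show "\<exists>k. D ((\<lambda>j. \<lfloor>e j\<rfloor>)(i := k))" by metis
      qed
      then show ?thesis using dpred_ex_upd[OF D, of i] by simp
    qed
    moreover have "polyhedral (\<lambda>f. \<exists>a. ?Q (f(i := a)))"
      by (intro polyhedral_project polyhedral_conj P polyhedral_le polyhedral_less aff_uminus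
          aff_diff aff_var aff_one)
    ultimately show ?thesis
      using cellular_box[where D = "\<lambda>z. \<exists>k. D (z(i := k))" and P = "\<lambda>f. \<exists>a. ?Q (f(i := a))"] by simp
  qed
  have "(\<lambda>e. \<exists>a. S (e(i := a))) = (\<lambda>e. \<exists>b\<in>\<B>. \<exists>a. fst b (\<lambda>j. \<lfloor>(e(i := a)) j\<rfloor>) \<and> snd b (\<lambda>j. frac ((e(i := a)) j)))"
    unfolding B(4) by (intro ext) blast
  moreover have "cellular \<A> (\<lambda>e. \<exists>b\<in>\<B>. \<exists>a. fst b (\<lambda>j. \<lfloor>(e(i := a)) j\<rfloor>) \<and> snd b (\<lambda>j. frac ((e(i := a)) j)))"
    by (intro cellular_bex B(1) box B(2,3))
  ultimately show ?thesis by simp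
qed

section \<open>Atomic formulas\<close>

lemma int_expansion_simps:
  "fun_syms (int_expansion \<A>) = {Plus}" "fun_arity (int_expansion \<A>) f = 2"
  "fun_interp (int_expansion \<A>) f x = x 0 + x 1"
  "rel_arity (int_expansion \<A>) Less = 2" "rel_arity (int_expansion \<A>) IsInt = 1"
  "rel_arity (int_expansion \<A>) (IntRel n A) = n"
  "rel_interp (int_expansion \<A>) Less = {x \<in> tuples 2. x 0 < x 1}"
  "rel_interp (int_expansion \<A>) IsInt = {x \<in> tuples 1. x 0 \<in> \<int>}"
  "rel_interp (int_expansion \<A>) (IntRel n A) = (\<lambda>x. real_of_int \<circ> x) ` A"
  "rel_syms (int_expansion \<A>) = {Less, IsInt} \<union> {IntRel n A | n A. (n, A) \<in> \<A>}"
  by (simp_all add: int_expansion_def)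

lemma lin_diff: "lin A \<Longrightarrow> lin B \<Longrightarrow> lin (\<lambda>f. A f - B f)"
  using lin_add[OF _ lin_uminus] by simp

lemma lin_term_val:
  assumes "term_ok (int_expansion \<A>) t"
  shows "lin (\<lambda>e. term_val (int_expansion \<A>) e t)"
  using assms
proof (induction t)
  case (Var i)
  show ?case by (simp add: lin_var)
next
  case (Fun f ts)
  then have "length ts = 2" by (simp add: int_expansion_simps)
  then obtain s t where ts: "ts = [s, t]" by (auto simp: numeral_2_eq_2 length_Suc_conv)
  have *: "lin (\<lambda>e. term_val (int_expansion \<A>) e s)" "lin (\<lambda>e. term_val (int_expansion \<A>) e t)"
    using Fun.IH[of s] Fun.IH[of t] Fun.prems unfolding ts by simp_all
  have "term_val (int_expansion \<A>) e (Fun f ts) =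
      term_val (int_expansion \<A>) e s + term_val (int_expansion \<A>) e t" for e
    by (simp add: ts int_expansion_simps tuple_of_def)
  then show ?case using lin_add[OF *] by simp
qed

lemma dfun_lin_floor:
  assumes "lin A"
  shows "dfun (int_expansion \<A>) (\<lambda>e. A (\<lambda>i. of_int \<lfloor>e i\<rfloor>))"
  by (rule dfun_subst[OF dfun_aff[OF aff_lin[OF assms]] dfun_floor[OF dfun_var]])

text \<open>For an integer \<open>u\<close>, \<open>u + v < 0\<close> is equivalent to
  \<open>u + k < 0\<close> with \<open>k\<close> the floor of \<open>v\<close>. This carry comes
  from a finite range, so the inequality is a finite union of products.\<close>

lemma cellular_lin_less:
  assumes "lin A"
  shows "cellular \<A> (\<lambda>e. A e < 0)"
proof -
  obtain N :: nat where N: "\<And>f. (\<And>i. 0 \<le> f i \<and> f i < 1) \<Longrightarrow> \<bar>A f\<bar> \<le> real N"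
    using lin_bounded[OF assms] by blast
  have "cellular \<A> (\<lambda>e. \<exists>k\<in>{- int N..int N}. A (\<lambda>i. of_int \<lfloor>e i\<rfloor>) + of_int k < 0 \<and>
      (of_int k - A (\<lambda>i. frac (e i)) \<le> 0 \<and> A (\<lambda>i. frac (e i)) - of_int (k + 1) < 0))"
  proof (rule cellular_bex)
    fix k
    show "cellular \<A> (\<lambda>e. A (\<lambda>i. of_int \<lfloor>e i\<rfloor>) + of_int k < 0 \<and>
      (of_int k - A (\<lambda>i. frac (e i)) \<le> 0 \<and> A (\<lambda>i. frac (e i)) - of_int (k + 1) < 0))"
      by (rule cellular_box[where D = "\<lambda>z. A (\<lambda>i. of_int (z i)) + of_int k < 0" and
            P = "\<lambda>f. of_int k - A f \<le> 0 \<and> A f - of_int (k + 1) < 0"])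
        (intro dpred_less dfun_add dfun_lin_floor assms dfun_const polyhedral_conj polyhedral_le
          polyhedral_less aff_diff aff_of_int aff_lin)+
  qed simp
  moreover have "(\<lambda>e. A e < 0) = (\<lambda>e. \<exists>k\<in>{- int N..int N}. A (\<lambda>i. of_int \<lfloor>e i\<rfloor>) + of_int k < 0 \<and>
      (of_int k - A (\<lambda>i. frac (e i)) \<le> 0 \<and> A (\<lambda>i. frac (e i)) - of_int (k + 1) < 0))"
  proof
    fix e
    let ?u = "A (\<lambda>i. of_int \<lfloor>e i\<rfloor>)" and ?v = "A (\<lambda>i. frac (e i))"
    have A: "A e = ?u + ?v" by (rule lin_floor_frac[OF assms])
    obtain u where u: "?u = of_int u" using lin_Ints[OF assms, of "\<lambda>i. \<lfloor>e i\<rfloor>"] by (rule Ints_cases)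
    have "\<bar>?v\<bar> \<le> real N" by (rule N) (simp add: frac_lt_1)
    then have "\<lfloor>?v\<rfloor> \<in> {- int N..int N}" by (simp add: le_floor_iff floor_le_iff, linarith)
    then show "(A e < 0) = (\<exists>k\<in>{- int N..int N}. ?u + of_int k < 0 \<and>
        (of_int k - ?v \<le> 0 \<and> ?v - of_int (k + 1) < 0))"
    proof (intro iffI)
      assume "A e < 0"
      then have "of_int u + of_int \<lfloor>?v\<rfloor> < (0 :: real)" unfolding A u by linarith
      then show "\<exists>k\<in>{- int N..int N}. ?u + of_int k < 0 \<and> (of_int k - ?v \<le> 0 \<and> ?v - of_int (k + 1) < 0)"
        unfolding u using \<open>\<lfloor>?v\<rfloor> \<in> _\<close> by (intro bexI[of _ "\<lfloor>?v\<rfloor>"] conjI) simp_all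
    next
      assume "\<exists>k\<in>{- int N..int N}. ?u + of_int k < 0 \<and> (of_int k - ?v \<le> 0 \<and> ?v - of_int (k + 1) < 0)"
      then obtain k where k: "of_int u + of_int k < (0 :: real)" "?v < of_int (k + 1)" unfolding u by auto
      \<comment> \<open>A negative integer is at most -1, which leaves room for the fractional
        remainder of \<open>?v\<close>.\<close>
      from k(1) have "u + k + 1 \<le> 0" by linarith
      then have "of_int u + of_int (k + 1) \<le> (0 :: real)" by linarith
      then show "A e < 0" unfolding A u using k(2) by linarith
    qed
  qed
  ultimately show ?thesis by (simp only:)
qed

lemma lin_list_bounded:
  assumes "\<And>A. A \<in> set As \<Longrightarrow> lin A"
  obtains N :: nat where "\<And>A f. A \<in> set As \<Longrightarrow> (\<And>i. 0 \<le> f i \<and> f i < 1) \<Longrightarrow> \<bar>A f\<bar> \<le> real N"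
proof -
  have "\<exists>N :: nat. \<forall>A\<in>set As. \<forall>f. (\<forall>i. 0 \<le> f i \<and> f i < 1) \<longrightarrow> \<bar>A f\<bar> \<le> real N"
    using assms
  proof (induction As)
    case (Cons B As)
    obtain K :: nat where K: "\<And>f. (\<And>i. 0 \<le> f i \<and> f i < 1) \<Longrightarrow> \<bar>B f\<bar> \<le> real K"
      using lin_bounded[OF Cons.prems[OF list.set_intros(1)]] by blast
    have "\<exists>N :: nat. \<forall>A\<in>set As. \<forall>f. (\<forall>i. 0 \<le> f i \<and> f i < 1) \<longrightarrow> \<bar>A f\<bar> \<le> real N"
      by (rule Cons.IH) (rule Cons.prems[OF list.set_intros(2)])
    then obtain L :: nat where L: "\<forall>A\<in>set As. \<forall>f. (\<forall>i. 0 \<le> f i \<and> f i < 1) \<longrightarrow> \<bar>A f\<bar> \<le> real L" ..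
    have "\<bar>A f\<bar> \<le> real (K + L)" if "A \<in> set (B # As)" "\<forall>i. 0 \<le> f i \<and> f i < 1" for A f
    proof (cases "A = B")
      case True
      have "\<bar>B f\<bar> \<le> real K" by (rule K) (use that(2) in blast)
      then show ?thesis unfolding True by simp
    next
      case False
      then have "A \<in> set As" using that(1) by simp
      from L[rule_format, OF this, of f] that(2) have "\<bar>A f\<bar> \<le> real L" by blast
      then show ?thesis by simp
    qed
    then show ?case by blast
  qed simp
  then obtain N :: nat where "\<forall>A\<in>set As. \<forall>f. (\<forall>i. 0 \<le> f i \<and> f i < 1) \<longrightarrow> \<bar>A f\<bar> \<le> real N" ..
  then show thesis by (intro that[of N]) blast
qed

text \<open>Elements of \<open>S\<close> have integer coordinates, so each form must take an integer
  value at the fractional parts. These values form a bounded list \<open>ks\<close>; once it is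
  known, membership in \<open>S\<close> concerns integer parts only.\<close>

lemma cellular_lin_rel:
  assumes lin: "\<And>A. A \<in> set As \<Longrightarrow> lin A"
    and int: "\<And>x i. x \<in> S \<Longrightarrow> x i \<in> \<int>"
    and dpred: "dpred (int_expansion \<A>) (\<lambda>e. (\<lambda>i. if i < length As then e i else 0) \<in> S)"
  shows "cellular \<A> (\<lambda>e. tuple_of (map (\<lambda>A. A e) As) \<in> S)"
proof -
  define m where "m = length As"
  obtain N :: nat where N: "\<And>A f. A \<in> set As \<Longrightarrow> (\<And>i. 0 \<le> f i \<and> f i < 1) \<Longrightarrow> \<bar>A f\<bar> \<le> real N"
    using lin_list_bounded[OF lin] by metis
  define K where "K = {ks. set ks \<subseteq> {- int N..int N} \<and> length ks = m}"
  have "finite K" unfolding K_def by (rule finite_lists_length_eq) simp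
  define D where "D ks z \<longleftrightarrow> (\<lambda>i. if i < m then (As ! i) (\<lambda>l. of_int (z l)) + of_int (ks ! i) else 0) \<in> S"
    for ks :: "int list" and z :: "nat \<Rightarrow> int"
  define P where "P ks f \<longleftrightarrow> (\<forall>i\<in>{..<m}. (As ! i) f - of_int (ks ! i) \<le> 0 \<and> of_int (ks ! i) - (As ! i) f \<le> 0)"
    for ks :: "int list" and f :: "nat \<Rightarrow> real"
  have nth: "As ! i \<in> set As" if "i < m" for i using that by (simp add: m_def)
  have "cellular \<A> (\<lambda>e. \<exists>ks\<in>K. D ks (\<lambda>i. \<lfloor>e i\<rfloor>) \<and> P ks (\<lambda>i. frac (e i)))"
  proof (rule cellular_bex[OF \<open>finite K\<close>], rule cellular_box)
    fix ks
    let ?h = "\<lambda>(e :: nat \<Rightarrow> real) i. if i < m then (As ! i) (\<lambda>l. of_int \<lfloor>e l\<rfloor>) + of_int (ks ! i) else 0"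
    have h: "dfun (int_expansion \<A>) (\<lambda>e. ?h e i)" for i
      using dfun_add[OF dfun_lin_floor[OF lin[OF nth]] dfun_const] by (cases "i < m") simp_all
    have "(\<lambda>e. (\<lambda>i. if i < length As then ?h e i else 0) \<in> S) = (\<lambda>e. D ks (\<lambda>i. \<lfloor>e i\<rfloor>))"
      unfolding D_def by (intro ext arg_cong[of _ _ "\<lambda>x. x \<in> S"]) (simp add: m_def)
    with dpred_subst[OF dpred, of ?h, OF h]
    show "dpred (int_expansion \<A>) (\<lambda>e. D ks (\<lambda>i. \<lfloor>e i\<rfloor>))" by (simp only:)
    show "polyhedral (P ks)"
      unfolding P_def
      by (intro polyhedral_ball polyhedral_conj polyhedral_le aff_diff aff_of_int aff_lin lin nth) auto
  qed
  moreover have "(\<lambda>e. tuple_of (map (\<lambda>A. A e) As) \<in> S) =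
      (\<lambda>e. \<exists>ks\<in>K. D ks (\<lambda>i. \<lfloor>e i\<rfloor>) \<and> P ks (\<lambda>i. frac (e i)))"
  proof
    fix e
    have tuple: "tuple_of (map (\<lambda>A. A e) As) = (\<lambda>i. if i < m then (As ! i) e else 0)"
      by (auto simp: tuple_of_def m_def)
    have split: "(As ! i) e = (As ! i) (\<lambda>l. of_int \<lfloor>e l\<rfloor>) + (As ! i) (\<lambda>l. frac (e l))" if "i < m" for i
      by (rule lin_floor_frac[OF lin[OF nth[OF that]]])
    have eq: "D ks (\<lambda>i. \<lfloor>e i\<rfloor>) \<longleftrightarrow> tuple_of (map (\<lambda>A. A e) As) \<in> S" if "P ks (\<lambda>i. frac (e i))" for ks
    proof -
      have "(As ! i) (\<lambda>l. frac (e l)) = of_int (ks ! i)" if "i < m" for i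
        using \<open>P ks (\<lambda>i. frac (e i))\<close> that unfolding P_def by force
      then have "(\<lambda>i. if i < m then (As ! i) (\<lambda>l. of_int \<lfloor>e l\<rfloor>) + of_int (ks ! i) else 0) =
          (\<lambda>i. if i < m then (As ! i) e else 0)"
        using split by auto
      then show ?thesis unfolding D_def tuple by (simp only:)
    qed
    show "(tuple_of (map (\<lambda>A. A e) As) \<in> S) = (\<exists>ks\<in>K. D ks (\<lambda>i. \<lfloor>e i\<rfloor>) \<and> P ks (\<lambda>i. frac (e i)))"
    proof
      assume S: "tuple_of (map (\<lambda>A. A e) As) \<in> S"
      define ks where "ks = map (\<lambda>A. \<lfloor>A (\<lambda>l. frac (e l))\<rfloor>) As"
      have val: "(As ! i) (\<lambda>l. frac (e l)) = of_int (ks ! i)" if "i < m" for i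
      proof -
        have "(As ! i) e \<in> \<int>" using int[OF S, of i] that by (simp add: tuple)
        moreover have "(As ! i) (\<lambda>l. of_int \<lfloor>e l\<rfloor>) \<in> \<int>"
          by (rule lin_Ints[OF lin[OF nth[OF that]]])
        ultimately have "(As ! i) (\<lambda>l. frac (e l)) \<in> \<int>"
          using split[OF that] by (metis Ints_diff add_diff_cancel_left')
        then show ?thesis using that by (auto simp: ks_def m_def elim!: Ints_cases)
      qed
      have "P ks (\<lambda>i. frac (e i))" unfolding P_def using val by simp
      moreover have "ks \<in> K"
      proof -
        have "\<lfloor>A (\<lambda>l. frac (e l))\<rfloor> \<in> {- int N..int N}" if "A \<in> set As" for A
        proof -
          have "\<bar>A (\<lambda>l. frac (e l))\<bar> \<le> real N" by (rule N[OF that]) (simp add: frac_lt_1)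
          then show ?thesis by (simp add: le_floor_iff floor_le_iff, linarith)
        qed
        then show ?thesis unfolding K_def ks_def by (auto simp: m_def)
      qed
      ultimately show "\<exists>ks\<in>K. D ks (\<lambda>i. \<lfloor>e i\<rfloor>) \<and> P ks (\<lambda>i. frac (e i))"
        using S eq by blast
    next
      assume "\<exists>ks\<in>K. D ks (\<lambda>i. \<lfloor>e i\<rfloor>) \<and> P ks (\<lambda>i. frac (e i))"
      then show "tuple_of (map (\<lambda>A. A e) As) \<in> S" using eq by blast
    qed
  qed
  ultimately show ?thesis by (simp only:)
qed

lemma dpred_IntRel:
  assumes "(n, A) \<in> \<A>"
  shows "dpred (int_expansion \<A>) (\<lambda>e. (\<lambda>i. if i < n then e i else 0) \<in> (\<lambda>x. real_of_int \<circ> x) ` A)"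
  unfolding dpred_def
proof (intro exI conjI allI)
  let ?\<phi> = "Rel (IntRel n A) (map (\<lambda>i. Var (2 * i)) [0..<n])"
  show "formula_ok (int_expansion \<A>) ?\<phi>" using assms by (auto simp: int_expansion_simps)
  fix e
  have "tuple_of (map (term_val (int_expansion \<A>) (mix e p)) (map (\<lambda>i. Var (2 * i)) [0..<n])) =
      (\<lambda>i. if i < n then e i else 0)" for p
    by (auto simp: tuple_of_def mix_def)
  then show "((\<lambda>i. if i < n then e i else 0) \<in> (\<lambda>x. real_of_int \<circ> x) ` A) \<longleftrightarrow>
      satisfies (int_expansion \<A>) (mix e undefined) ?\<phi>"
    unfolding satisfies.simps by (simp add: int_expansion_simps)
qed

lemma cellular_satisfies:
  assumes "formula_ok (int_expansion \<A>) \<phi>"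
  shows "cellular \<A> (\<lambda>e. satisfies (int_expansion \<A>) e \<phi>)"
  using assms
proof (induction \<phi>)
  case (Equal s t)
  let ?M = "int_expansion \<A>"
  have st: "lin (\<lambda>e. term_val ?M e s - term_val ?M e t)" "lin (\<lambda>e. term_val ?M e t - term_val ?M e s)"
    using Equal by (simp_all add: lin_diff lin_term_val)
  have "cellular \<A> (\<lambda>e. \<not> term_val ?M e s - term_val ?M e t < 0 \<and> \<not> term_val ?M e t - term_val ?M e s < 0)"
    by (intro cellular_conj cellular_not cellular_lin_less st)
  moreover have "satisfies ?M e (Equal s t) \<longleftrightarrow>
      \<not> term_val ?M e s - term_val ?M e t < 0 \<and> \<not> term_val ?M e t - term_val ?M e s < 0" for e
    by auto
  ultimately show ?case by (simp only:)
next
  case (Rel r ts)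
  let ?M = "int_expansion \<A>"
  define As where "As = map (\<lambda>t e. term_val ?M e t) ts"
  have lin: "lin A" if "A \<in> set As" for A
    using that Rel by (auto simp: As_def lin_term_val)
  have As: "map (\<lambda>A. A e) As = map (term_val ?M e) ts" for e by (simp add: As_def)
  have len: "length As = rel_arity ?M r" using Rel by (simp add: As_def)
  from Rel have "r \<in> rel_syms ?M" by simp
  then consider "r = Less" | "r = IsInt" | n A where "r = IntRel n A" "(n, A) \<in> \<A>"
    by (auto simp: int_expansion_simps)
  then show ?case
  proof cases
    case 1
    then have "length ts = 2" using len by (simp add: As_def int_expansion_simps)
    then obtain s t where ts: "ts = [s, t]" by (auto simp: numeral_2_eq_2 length_Suc_conv)
    have "lin (\<lambda>e. term_val ?M e s - term_val ?M e t)"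
      using Rel by (simp add: ts lin_diff lin_term_val)
    from cellular_lin_less[OF this] have "cellular \<A> (\<lambda>e. term_val ?M e s - term_val ?M e t < 0)" .
    moreover have "satisfies ?M e (Rel r ts) \<longleftrightarrow> term_val ?M e s - term_val ?M e t < 0" for e
      unfolding satisfies.simps ts 1 by (simp add: int_expansion_simps tuple_of_def tuples_def)
    ultimately show ?thesis by (simp only:)
  next
    case 2
    have "cellular \<A> (\<lambda>e. tuple_of (map (\<lambda>A. A e) As) \<in> {x \<in> tuples 1. x 0 \<in> \<int>})"
    proof (rule cellular_lin_rel[OF lin])
      show "x i \<in> \<int>" if "x \<in> {x \<in> tuples 1. x 0 \<in> \<int>}" for x :: "nat \<Rightarrow> real" and i
        using that by (cases "i = 0") (auto simp: tuples_def)
      have "length As = 1" using len by (simp add: 2 int_expansion_simps)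
      then have "(\<lambda>i. if i < length As then e i else 0) \<in> {x \<in> tuples 1. x 0 \<in> \<int>} \<longleftrightarrow> e 0 \<in> \<int>"
        for e :: "nat \<Rightarrow> real" by (simp add: tuples_def)
      then show "dpred ?M (\<lambda>e. (\<lambda>i. if i < length As then e i else 0) \<in> {x \<in> tuples 1. x 0 \<in> \<int>})"
        using dpred_Ints[OF dfun_var] by (simp only:)
    qed
    moreover have "satisfies ?M e (Rel r ts) \<longleftrightarrow> tuple_of (map (\<lambda>A. A e) As) \<in> {x \<in> tuples 1. x 0 \<in> \<int>}" for e
      unfolding satisfies.simps As 2 by (simp add: int_expansion_simps)
    ultimately show ?thesis by (simp only:)
  next
    case 3
    have len: "length As = n" using len by (simp add: 3 int_expansion_simps)
    have "cellular \<A> (\<lambda>e. tuple_of (map (\<lambda>A. A e) As) \<in> (\<lambda>x. real_of_int \<circ> x) ` A)"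
      by (rule cellular_lin_rel[OF lin]) (auto simp: len dpred_IntRel[OF 3(2)])
    moreover have "satisfies ?M e (Rel r ts) \<longleftrightarrow> tuple_of (map (\<lambda>A. A e) As) \<in> (\<lambda>x. real_of_int \<circ> x) ` A" for e
      unfolding satisfies.simps As 3 by (simp add: int_expansion_simps)
    ultimately show ?thesis by (simp only:)
  qed
next
  case (Neg \<phi>)
  then show ?case by (simp add: cellular_not)
next
  case (Conj \<phi> \<psi>)
  then show ?case by (simp add: cellular_conj)
next
  case (Exists i \<phi>)
  then have "cellular \<A> (\<lambda>e. satisfies (int_expansion \<A>) e \<phi>)" by simp
  from cellular_ex[OF this] show ?case by simp
qed

section \<open>Definable sets as finite unions of families of cells\<close>

text \<open>Serves to insert the fractional parts of the parameters for the variables from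
  \<open>n\<close> on, a continuous affine map.\<close>

lemma closure_accessible_vimage:
  assumes "closure_accessible P" "continuous_on UNIV g"
    "\<And>t x y. g (\<lambda>i. (1 - t) * x i + t * y i) = (\<lambda>i. (1 - t) * g x i + t * g y i)"
  shows "closure_accessible (g -` P)"
  unfolding closure_accessible_def
proof (intro ballI allI impI)
  fix x y and t :: real
  assume x: "x \<in> g -` P" and y: "y \<in> closure (g -` P)" and t: "0 \<le> t \<and> t < 1"
  have "g ` closure (g -` P) \<subseteq> closure P"
  proof (rule image_closure_subset)
    show "continuous_on (closure (g -` P)) g" using assms(2) continuous_on_subset by blast
    show "g ` (g -` P) \<subseteq> closure P" using closure_subset by blast
  qed simp
  then have "g y \<in> closure P" using y by blast
  then have "(\<lambda>i. (1 - t) * g x i + t * g y i) \<in> P"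
    using assms(1) x t unfolding closure_accessible_def by blast
  then show "(\<lambda>i. (1 - t) * x i + t * y i) \<in> g -` P" using assms(3) by simp
qed

text \<open>Only now are the parameters inserted, their integer parts into \<open>D\<close> and
  their fractional parts into \<open>P\<close>. Both are false for \<open>j\<close> from
  \<open>J\<close> on, so the first three properties hold for every index.\<close>

lemma definable_cells:
  assumes "definable (int_expansion \<A>) n E"
  obtains J :: nat and D P where
    "\<And>j. dpred (int_expansion \<A>) (\<lambda>e. D j (\<lambda>i. \<lfloor>e i\<rfloor>))"
    "\<And>j. dpred (int_expansion \<A>) (P j)"
    "\<And>j. closure_accessible {f. P j f}"
    "E = {x \<in> tuples n. \<exists>j<J. D j (\<lambda>i. \<lfloor>x i\<rfloor>) \<and> P j (\<lambda>i. frac (x i))}"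
proof -
  let ?M = "int_expansion \<A>"
  from assms obtain \<phi> p where ok: "formula_ok ?M \<phi>"
    and E: "E = {x \<in> tuples n. satisfies ?M (\<lambda>i. if i < n then x i else p i) \<phi>}"
    unfolding definable_def by blast
  obtain \<B> where B: "finite \<B>"
    "\<And>b. b \<in> \<B> \<Longrightarrow> dpred (int_expansion \<A>) (\<lambda>e. fst b (\<lambda>i. \<lfloor>e i\<rfloor>))"
    "\<And>b. b \<in> \<B> \<Longrightarrow> polyhedral (snd b)"
    "(\<lambda>e. satisfies ?M e \<phi>) = (\<lambda>e. \<exists>b\<in>\<B>. fst b (\<lambda>i. \<lfloor>e i\<rfloor>) \<and> snd b (\<lambda>i. frac (e i)))"
    using cellular_satisfies[OF ok] by (rule cellularE) (rule that)
  obtain bs where bs: "set bs = \<B>" using finite_list[OF B(1)] by blast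
  define J where "J = length bs"
  define D where "D j z \<longleftrightarrow> j < J \<and> fst (bs ! j) (\<lambda>i. if i < n then z i else \<lfloor>p i\<rfloor>)" for j z
  define P where "P j f \<longleftrightarrow> j < J \<and> snd (bs ! j) (\<lambda>i. if i < n then f i else frac (p i))" for j f
  have nth: "bs ! j \<in> \<B>" if "j < J" for j using that bs nth_mem unfolding J_def by blast
  show thesis
  proof (rule that)
    fix j
    show "dpred ?M (\<lambda>e. D j (\<lambda>i. \<lfloor>e i\<rfloor>))"
    proof (cases "j < J")
      case True
      have "dfun ?M (\<lambda>e. of_int ((\<lambda>i. if i < n then \<lfloor>e i\<rfloor> else \<lfloor>p i\<rfloor>) i))" for i
        by (cases "i < n") (simp_all add: dfun_floor)
      from dpred_of_int_subst[OF B(2)[OF nth[OF True]], of "\<lambda>e i. if i < n then \<lfloor>e i\<rfloor> else \<lfloor>p i\<rfloor>", OF this]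
      show ?thesis using True unfolding D_def by simp
    qed (simp add: D_def)
    show "dpred ?M (P j)"
    proof (cases "j < J")
      case True
      have "dfun ?M (\<lambda>e. if i < n then e i else frac (p i))" for i
        by (cases "i < n") simp_all
      from dpred_subst[OF dpred_polyhedral[OF B(3)[OF nth[OF True]]], where h = "\<lambda>e i. if i < n then e i else frac (p i)", OF this]
      have "dpred ?M (\<lambda>e. snd (bs ! j) (\<lambda>i. if i < n then e i else frac (p i)))" .
      moreover have "P j = (\<lambda>e. snd (bs ! j) (\<lambda>i. if i < n then e i else frac (p i)))"
        using True unfolding P_def by auto
      ultimately show ?thesis by (simp only:)
    next
      case False
      then have "P j = (\<lambda>f. False)" unfolding P_def by auto
      then show ?thesis by simp
    qed
    show "closure_accessible {f. P j f}"
    proof (cases "j < J")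
      case True
      have "closure_accessible ((\<lambda>f i. if i < n then f i else frac (p i)) -` {f. snd (bs ! j) f})"
      proof (rule closure_accessible_vimage[OF closure_accessible_polyhedral[OF B(3)[OF nth[OF True]]]])
        show "continuous_on UNIV (\<lambda>f i. if i < n then f i else frac (p i))"
        proof (rule continuous_on_coordinatewise_then_product)
          show "continuous_on UNIV (\<lambda>f. if i < n then f i else frac (p i))" for i
            by (cases "i < n") (simp_all add: continuous_on_product_coordinates)
        qed
      qed (auto simp: algebra_simps)
      moreover have "{f. P j f} = (\<lambda>f i. if i < n then f i else frac (p i)) -` {f. snd (bs ! j) f}"
        using True unfolding P_def by auto
      ultimately show ?thesis by (simp only:)
    next
      case False
      then show ?thesis unfolding P_def closure_accessible_def by simp
    qed
  next
    have bex_nth: "(\<exists>b\<in>set bs. R b) \<longleftrightarrow> (\<exists>j<length bs. R (bs ! j))" for R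
      by (metis in_set_conv_nth)
    have "satisfies ?M (\<lambda>i. if i < n then x i else p i) \<phi> \<longleftrightarrow>
        (\<exists>j<J. D j (\<lambda>i. \<lfloor>x i\<rfloor>) \<and> P j (\<lambda>i. frac (x i)))" for x
    proof -
      have upd: "(\<lambda>i. \<lfloor>if i < n then x i else p i\<rfloor>) = (\<lambda>i. if i < n then \<lfloor>x i\<rfloor> else \<lfloor>p i\<rfloor>)"
        "(\<lambda>i. frac (if i < n then x i else p i)) = (\<lambda>i. if i < n then frac (x i) else frac (p i))"
        by auto
      have "satisfies ?M (\<lambda>i. if i < n then x i else p i) \<phi> \<longleftrightarrow>
          (\<exists>b\<in>\<B>. fst b (\<lambda>i. if i < n then \<lfloor>x i\<rfloor> else \<lfloor>p i\<rfloor>) \<and> snd b (\<lambda>i. if i < n then frac (x i) else frac (p i)))"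
        unfolding fun_cong[OF B(4)] upd ..
      also have "\<dots> \<longleftrightarrow> (\<exists>j<J. fst (bs ! j) (\<lambda>i. if i < n then \<lfloor>x i\<rfloor> else \<lfloor>p i\<rfloor>) \<and>
          snd (bs ! j) (\<lambda>i. if i < n then frac (x i) else frac (p i)))"
        unfolding bs[symmetric] J_def by (rule bex_nth)
      finally show ?thesis unfolding D_def P_def by blast
    qed
    then show "E = {x \<in> tuples n. \<exists>j<J. D j (\<lambda>i. \<lfloor>x i\<rfloor>) \<and> P j (\<lambda>i. frac (x i))}"
      unfolding E by blast
  qed
qed

section \<open>Components of definable sets\<close>

locale cell_union =
  fixes \<A> :: "(nat \<times> (nat \<Rightarrow> int) set) set" and n J :: nat
    and D :: "nat \<Rightarrow> (nat \<Rightarrow> int) \<Rightarrow> bool" and P :: "nat \<Rightarrow> (nat \<Rightarrow> real) \<Rightarrow> bool"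
  assumes dpred_D: "\<And>j. dpred (int_expansion \<A>) (\<lambda>e. D j (\<lambda>i. \<lfloor>e i\<rfloor>))"
    and dpred_P: "\<And>j. dpred (int_expansion \<A>) (P j)"
    and accessible: "\<And>j. closure_accessible {f. P j f}"
    and mult: "def_mult (int_expansion \<A>)"
begin

definition E :: "(nat \<Rightarrow> real) set" where
  "E = {x \<in> tuples n. \<exists>j<J. D j (\<lambda>i. \<lfloor>x i\<rfloor>) \<and> P j (\<lambda>i. frac (x i))}"

text \<open>Cells of different types may overlap. Overlapping cells touch with displacement 0 and
  are then joined by an edge.\<close>

definition Q :: "nat \<Rightarrow> (nat \<Rightarrow> real) set" where
  "Q j = {f \<in> tuples n. (\<forall>i. 0 \<le> f i \<and> f i < 1) \<and> P j f}"

definition piece :: "nat \<Rightarrow> (nat \<Rightarrow> int) \<Rightarrow> (nat \<Rightarrow> real) set" where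
  "piece j z = {x. (\<lambda>i. x i - of_int (z i)) \<in> Q j}"

text \<open>The piece with index \<open>(j, z)\<close> touches that with index \<open>(k, z + \<delta>)\<close>, for any \<open>z\<close>.\<close>

definition touches :: "nat \<Rightarrow> nat \<Rightarrow> (nat \<Rightarrow> int) \<Rightarrow> bool" where
  "touches j k \<delta> \<longleftrightarrow> (\<exists>y\<in>closure (Q j). (\<lambda>i. y i - of_int (\<delta> i)) \<in> Q k)"

text \<open>Points that differ by less than 1 in each coordinate have integer parts that differ by
  at most 1, so these displacements suffice near a point.\<close>

definition shifts :: "(nat \<Rightarrow> int) set" where
  "shifts = {\<delta> \<in> tuples n. \<forall>i. \<delta> i \<in> {-1, 0, 1}}"

text \<open>Touching is not symmetric: the common point lies in one cell and in the closure of the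
  other. Either orientation yields a path between the cells. The set is finite and is used in
  \<open>step\<close> as a list of cases, so that \<open>touches\<close> is never expressed in the
  structure.\<close>

definition edges :: "(nat \<times> nat \<times> (nat \<Rightarrow> int)) set" where
  "edges = {(j, k, \<delta>). j < J \<and> k < J \<and> \<delta> \<in> shifts \<and>
     (touches j k \<delta> \<or> touches k j (\<lambda>i. - \<delta> i))}"

definition code :: "nat \<Rightarrow> (nat \<Rightarrow> int) \<Rightarrow> nat" where
  "code j z = prod_encode (j, vec_encode n z)"

definition step :: "nat \<Rightarrow> nat \<Rightarrow> bool" where
  "step a b \<longleftrightarrow> (\<exists>(j, k, \<delta>)\<in>edges. fst (prod_decode a) = j \<and>
     D j (vec_decode n (snd (prod_decode a))) \<and>
     D k (\<lambda>i. vec_decode n (snd (prod_decode a)) i + \<delta> i) \<and>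
     b = prod_encode (k, vec_encode n (\<lambda>i. vec_decode n (snd (prod_decode a)) i + \<delta> i)))"

section \<open>The graph of cells\<close>

lemma finite_shifts: "finite shifts"
proof -
  have "shifts \<subseteq> {f. \<forall>i. (i \<in> {..<n} \<longrightarrow> f i \<in> {-1, 0, 1}) \<and> (i \<notin> {..<n} \<longrightarrow> f i = 0)}"
    by (auto simp: shifts_def tuples_def)
  moreover have "finite {f. \<forall>i. (i \<in> {..<n} \<longrightarrow> f i \<in> {-1, 0, 1 :: int}) \<and> (i \<notin> {..<n} \<longrightarrow> f i = 0)}"
    by (rule finite_set_of_finite_funs) auto
  ultimately show ?thesis by (rule finite_subset)
qed

lemma finite_edges: "finite edges"
proof (rule finite_subset)
  show "edges \<subseteq> {..<J} \<times> {..<J} \<times> shifts" by (auto simp: edges_def)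
  show "finite ({..<J} \<times> {..<J} \<times> shifts)" by (simp add: finite_shifts)
qed

lemma edges_sym: "(j, k, \<delta>) \<in> edges \<Longrightarrow> (k, j, \<lambda>i. - \<delta> i) \<in> edges"
  by (auto simp: edges_def shifts_def tuples_def)

lemma step_code:
  assumes "z \<in> tuples n"
  shows "step (code j z) b \<longleftrightarrow> (\<exists>k \<delta>. (j, k, \<delta>) \<in> edges \<and> D j z \<and> D k (\<lambda>i. z i + \<delta> i) \<and>
    b = code k (\<lambda>i. z i + \<delta> i))"
proof -
  have z: "vec_decode n (vec_encode n z) = z"
    unfolding vec_decode_encode using assms by (auto simp: tuples_def)
  show ?thesis unfolding step_def code_def prod_encode_inverse fst_conv snd_conv z by blast
qed

lemma dpred_step: "dpred (int_expansion \<A>) (\<lambda>e. step (nat \<lfloor>e 0\<rfloor>) (nat \<lfloor>e 1\<rfloor>))"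
  unfolding step_def
proof (rule dpred_bex[OF finite_edges], clarify)
  fix j k \<delta>
  let ?v = "\<lambda>e :: nat \<Rightarrow> real. vec_decode n (snd (prod_decode (nat \<lfloor>e 0\<rfloor>)))"
  have v: "dfun (int_expansion \<A>) (\<lambda>e. of_int (?v e i))" for i
    by (intro dfun_vec_decode dfun_snd_prod_decode dfun_nat_floor dfun_var mult)
  then have v': "dfun (int_expansion \<A>) (\<lambda>e. of_int (?v e i + \<delta> i))" for i
    unfolding of_int_add by (intro dfun_add dfun_const)
  show "dpred (int_expansion \<A>) (\<lambda>e. fst (prod_decode (nat \<lfloor>e 0\<rfloor>)) = j \<and>
     D j (?v e) \<and> D k (\<lambda>i. ?v e i + \<delta> i) \<and>
     nat \<lfloor>e 1\<rfloor> = prod_encode (k, vec_encode n (\<lambda>i. ?v e i + \<delta> i)))"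
    by (intro dpred_conj dpred_of_nat_eq dfun_fst_prod_decode dfun_prod_encode dfun_vec_encode
        dfun_nat_floor dfun_var dfun_const mult v' dpred_of_int_subst[OF dpred_D v]
        dpred_of_int_subst[OF dpred_D, where h = "\<lambda>e i. ?v e i + \<delta> i"])
qed

section \<open>Paths inside a cell and to its boundary\<close>

lemma closure_Q:
  assumes "y \<in> closure (Q j)"
  shows "y \<in> closure {f. P j f}" "y \<in> tuples n" "0 \<le> y i" "y i \<le> 1"
proof -
  show "y \<in> closure {f. P j f}"
    using assms closure_mono[of "Q j" "{f. P j f}"] by (auto simp: Q_def)
  have coord: "continuous_on UNIV (\<lambda>f :: nat \<Rightarrow> real. f i)" for i
    by (rule continuous_on_product_coordinates)
  have *: "y \<in> T" if "closed T" "Q j \<subseteq> T" for T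
    using closure_minimal[OF that(2,1)] assms by blast
  have "y \<in> {f. 0 \<le> f i}"
    by (rule *) (auto simp: Q_def intro!: closed_Collect_le coord continuous_on_const)
  then show "0 \<le> y i" by simp
  have "y \<in> {f. f i \<le> 1}"
    by (rule *) (auto simp: Q_def less_imp_le intro!: closed_Collect_le coord continuous_on_const)
  then show "y i \<le> 1" by simp
  have "y \<in> {f. f l = 0}" if "l \<ge> n" for l
    by (rule *) (auto simp: Q_def tuples_def that intro!: closed_Collect_eq coord continuous_on_const)
  then show "y \<in> tuples n" by (simp add: tuples_def)
qed

lemma closure_accessible_Q: "closure_accessible (Q j)"
  unfolding closure_accessible_def
proof (intro ballI allI impI)
  fix x y and t :: real
  assume x: "x \<in> Q j" and y: "y \<in> closure (Q j)" and t: "0 \<le> t \<and> t < 1"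
  have "(\<lambda>i. (1 - t) * x i + t * y i) \<in> tuples n"
    using x closure_Q(2)[OF y] by (auto simp: Q_def tuples_def)
  moreover have "0 \<le> (1 - t) * x i + t * y i \<and> (1 - t) * x i + t * y i < 1" for i
  proof
    have xi: "0 \<le> x i" "x i < 1" using x by (auto simp: Q_def)
    note yi = closure_Q(3,4)[OF y, of i]
    show "0 \<le> (1 - t) * x i + t * y i" using xi yi t by simp
    \<comment> \<open>A coordinate of \<open>y\<close> may equal 1; strictness comes from
      \<open>x i < 1\<close> and the positive weight \<open>1 - t\<close>.\<close>
    have "(1 - t) * x i < (1 - t) * 1" using xi t by (intro mult_strict_left_mono) auto
    moreover have "t * y i \<le> t * 1" using yi t by (intro mult_left_mono) auto
    ultimately show "(1 - t) * x i + t * y i < 1" by simp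
  qed
  moreover have "P j (\<lambda>i. (1 - t) * x i + t * y i)"
    using accessible[of j] x closure_Q(1)[OF y] t unfolding closure_accessible_def Q_def by blast
  ultimately show "(\<lambda>i. (1 - t) * x i + t * y i) \<in> Q j" unfolding Q_def by blast
qed

text \<open>The endpoint \<open>y\<close> may lie outside the piece; the segment stays in the piece
  before \<open>t = 1\<close>, and \<open>y\<close> itself lies in \<open>S\<close> by
  assumption.\<close>

lemma segment_in_piece:
  assumes "x \<in> piece j z" "(\<lambda>i. y i - of_int (z i)) \<in> closure (Q j)" "piece j z \<subseteq> S" "y \<in> S"
  shows "path_component S x y"
proof -
  let ?g = "\<lambda>t i. (1 - t) * x i + t * y i"
  have "path_component S (?g 0) (?g 1)"
  proof (rule path_component_curve)
    show "continuous_on {0..1} ?g"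
      by (intro continuous_on_coordinatewise_then_product continuous_intros)
    fix t :: real assume t: "0 \<le> t" "t \<le> 1"
    show "?g t \<in> S"
    proof (cases "t = 1")
      case True
      then show ?thesis using assms(4) by simp
    next
      case False
      have "(\<lambda>i. (1 - t) * (x i - of_int (z i)) + t * (y i - of_int (z i))) \<in> Q j"
        using closure_accessible_Q[of j] assms(1,2) t False
        unfolding closure_accessible_def piece_def by force
      moreover have "(\<lambda>i. (1 - t) * (x i - of_int (z i)) + t * (y i - of_int (z i))) =
          (\<lambda>i. ?g t i - of_int (z i))"
        by (auto simp: algebra_simps)
      ultimately have "?g t \<in> piece j z" by (simp add: piece_def)
      then show ?thesis using assms(3) by blast
    qed
  qed simp
  then show ?thesis by simp
qed

lemma piece_floor_frac:
  assumes "x \<in> piece j z" "z \<in> tuples n"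
  shows "x \<in> tuples n" "(\<lambda>i. \<lfloor>x i\<rfloor>) = z" "P j (\<lambda>i. frac (x i))"
proof -
  have *: "0 \<le> x i - of_int (z i)" "x i - of_int (z i) < 1" for i
    using assms(1) by (auto simp: piece_def Q_def)
  show z: "(\<lambda>i. \<lfloor>x i\<rfloor>) = z"
  proof
    show "\<lfloor>x i\<rfloor> = z i" for i using *[of i] by (intro floor_unique) linarith+
  qed
  have "frac (x i) = x i - of_int (z i)" for i
    unfolding frac_def using fun_cong[OF z, of i] by simp
  then show "P j (\<lambda>i. frac (x i))" using assms(1) by (simp add: piece_def Q_def)
  show "x \<in> tuples n" using assms by (auto simp: piece_def Q_def tuples_def)
qed

lemma in_piece:
  assumes "x \<in> tuples n" "P j (\<lambda>i. frac (x i))"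
  shows "x \<in> piece j (\<lambda>i. \<lfloor>x i\<rfloor>)" "(\<lambda>i. \<lfloor>x i\<rfloor>) \<in> tuples n"
proof -
  have "(\<lambda>i. x i - of_int \<lfloor>x i\<rfloor>) = (\<lambda>i. frac (x i))" by (simp add: frac_def)
  moreover have lt: "x i - of_int \<lfloor>x i\<rfloor> < 1" for i by linarith
  ultimately show "x \<in> piece j (\<lambda>i. \<lfloor>x i\<rfloor>)"
    using assms lt by (simp add: piece_def Q_def tuples_def)
  show "(\<lambda>i. \<lfloor>x i\<rfloor>) \<in> tuples n" using assms(1) by (simp add: tuples_def)
qed

section \<open>Classes of reachable cells\<close>

definition cls :: "nat \<Rightarrow> (nat \<Rightarrow> real) set" where
  "cls a = {x \<in> tuples n. \<exists>j\<in>{..<J}. D j (\<lambda>i. \<lfloor>x i\<rfloor>) \<and> P j (\<lambda>i. frac (x i)) \<and>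
     step\<^sup>*\<^sup>* a (code j (\<lambda>i. \<lfloor>x i\<rfloor>))}"

lemma cls_subset: "cls a \<subseteq> E"
  by (auto simp: cls_def E_def)

lemma definable_cls: "definable (int_expansion \<A>) n (cls a)"
proof (rule dpred_imp_definable)
  show "x \<in> cls a \<longleftrightarrow> x \<in> tuples n \<and> (\<exists>j\<in>{..<J}. D j (\<lambda>i. \<lfloor>x i\<rfloor>) \<and> P j (\<lambda>i. frac (x i)) \<and>
     step\<^sup>*\<^sup>* a (code j (\<lambda>i. \<lfloor>x i\<rfloor>)))" for x
    by (simp add: cls_def)
  have frac: "dfun (int_expansion \<A>) (\<lambda>e. frac (e i))" for i
    unfolding frac_def by (intro dfun_diff dfun_floor dfun_var)
  show "dpred (int_expansion \<A>) (\<lambda>x. \<exists>j\<in>{..<J}. D j (\<lambda>i. \<lfloor>x i\<rfloor>) \<and> P j (\<lambda>i. frac (x i)) \<and>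
     step\<^sup>*\<^sup>* a (code j (\<lambda>i. \<lfloor>x i\<rfloor>)))"
    unfolding code_def
    by (intro dpred_bex finite_lessThan dpred_conj dpred_D dpred_subst[OF dpred_P frac]
        dpred_rtranclp[OF mult dpred_step] dfun_const dfun_prod_encode[OF mult]
        dfun_vec_encode[OF mult] dfun_floor dfun_var)
qed

lemma piece_subset_cls:
  assumes "step\<^sup>*\<^sup>* a (code j z)" "j < J" "z \<in> tuples n" "D j z"
  shows "piece j z \<subseteq> cls a"
proof
  fix x assume "x \<in> piece j z"
  note x = piece_floor_frac[OF this assms(3)]
  show "x \<in> cls a" unfolding cls_def using x assms by auto
qed

text \<open>Induction along the path of cells. The invariant records that each piece is nonempty,
  which gives a point from which to move on, and that its points are joined to \<open>x0\<close>
  within the class.\<close>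

lemma reachable_piece:
  assumes "step\<^sup>*\<^sup>* (code j0 z0) b" "j0 < J" "z0 \<in> tuples n" "D j0 z0" "x0 \<in> piece j0 z0"
  shows "\<exists>j z. b = code j z \<and> j < J \<and> z \<in> tuples n \<and> D j z \<and> piece j z \<noteq> {} \<and>
    (\<forall>x\<in>piece j z. path_component (cls (code j0 z0)) x0 x)"
  using assms(1)
proof (induction rule: rtranclp_induct)
  case base
  have sub: "piece j0 z0 \<subseteq> cls (code j0 z0)" by (rule piece_subset_cls) (use assms in simp_all)
  have "path_component (cls (code j0 z0)) x0 x" if x: "x \<in> piece j0 z0" for x
  proof (rule segment_in_piece[OF assms(5) _ sub])
    show "(\<lambda>i. x i - of_int (z0 i)) \<in> closure (Q j0)"
      using x closure_subset by (auto simp: piece_def)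
    show "x \<in> cls (code j0 z0)" using x sub by blast
  qed
  then show ?case using assms by blast
next
  case (step a b)
  then obtain j z where a: "a = code j z" "j < J" "z \<in> tuples n" "D j z" "piece j z \<noteq> {}"
    and path: "\<And>x. x \<in> piece j z \<Longrightarrow> path_component (cls (code j0 z0)) x0 x" by blast
  from step.hyps(2)[unfolded a(1) step_code[OF a(3)]] obtain k \<delta> where
    e: "(j, k, \<delta>) \<in> edges" "D k (\<lambda>i. z i + \<delta> i)" "b = code k (\<lambda>i. z i + \<delta> i)" by blast
  let ?w = "\<lambda>i. z i + \<delta> i"
  have k: "k < J" "\<delta> \<in> tuples n" using e(1) by (auto simp: edges_def shifts_def)
  then have w: "?w \<in> tuples n" using a(3) by (simp add: tuples_def)
  have reach: "step\<^sup>*\<^sup>* (code j0 z0) (code k ?w)" "step\<^sup>*\<^sup>* (code j0 z0) (code j z)"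
    using step.hyps by (simp_all flip: e(3) a(1))
  have sub: "piece k ?w \<subseteq> cls (code j0 z0)" "piece j z \<subseteq> cls (code j0 z0)"
    using piece_subset_cls reach k(1) w e(2) a by blast+
  from e(1) consider "touches j k \<delta>" | "touches k j (\<lambda>i. - \<delta> i)" by (auto simp: edges_def)
  then have "piece k ?w \<noteq> {} \<and> (\<forall>x\<in>piece k ?w. path_component (cls (code j0 z0)) x0 x)"
  proof cases
    \<comment> \<open>The shared point \<open>y'\<close> belongs to the new piece and to the closure
      of the old one: the path leaves the old piece only at \<open>y'\<close>.\<close>
    case 1
    then obtain y where y: "y \<in> closure (Q j)" "(\<lambda>i. y i - of_int (\<delta> i)) \<in> Q k"
      unfolding touches_def by blast
    define y' where "y' i = y i + of_int (z i)" for i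
    have y': "y' \<in> piece k ?w" "(\<lambda>i. y' i - of_int (z i)) \<in> closure (Q j)"
      using y by (simp_all add: y'_def piece_def algebra_simps)
    obtain x where x: "x \<in> piece j z" using a(5) by blast
    have "path_component (cls (code j0 z0)) x y'"
      by (rule segment_in_piece[OF x y'(2) sub(2)]) (use y'(1) sub(1) in blast)
    then have xy: "path_component (cls (code j0 z0)) x0 y'"
      using path[OF x] path_component_trans by blast
    have "path_component (cls (code j0 z0)) y' u" if u: "u \<in> piece k ?w" for u
    proof (rule segment_in_piece[OF y'(1) _ sub(1)])
      show "(\<lambda>i. u i - of_int (?w i)) \<in> closure (Q k)"
        using u closure_subset unfolding piece_def by blast
      show "u \<in> cls (code j0 z0)" using u sub(1) by blast
    qed
    then show ?thesis using xy y'(1) path_component_trans by blast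
  next
    \<comment> \<open>Now \<open>y'\<close> belongs to the old piece, and points of the new piece
      reach it by segments that are then reversed. The new piece is nonempty because its closure
      is.\<close>
    case 2
    then obtain y where y: "y \<in> closure (Q k)" "(\<lambda>i. y i - of_int (- \<delta> i)) \<in> Q j"
      unfolding touches_def by blast
    define y' where "y' i = y i + of_int (z i) + of_int (\<delta> i)" for i
    have y': "y' \<in> piece j z" "(\<lambda>i. y' i - of_int (?w i)) \<in> closure (Q k)"
      using y by (simp_all add: y'_def piece_def algebra_simps)
    have "path_component (cls (code j0 z0)) u y'" if u: "u \<in> piece k ?w" for u
      by (rule segment_in_piece[OF u y'(2) sub(1)]) (use y'(1) sub(2) in blast)
    then have all: "\<forall>u\<in>piece k ?w. path_component (cls (code j0 z0)) x0 u"
      using path[OF y'(1)] path_component_trans path_component_sym by blast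
    have "Q k \<noteq> {}" using y(1) by (cases "Q k = {}") simp_all
    then obtain q where "q \<in> Q k" by blast
    then have "(\<lambda>i. q i + of_int (?w i)) \<in> piece k ?w" by (simp add: piece_def)
    then show ?thesis using all by blast
  qed
  then show ?case using e(2,3) k(1) w by blast
qed

section \<open>Local finiteness and clopenness\<close>

lemma open_coordinate: "open {y :: nat \<Rightarrow> real. \<bar>y i - c\<bar> < 1}"
proof -
  have "continuous_on UNIV (\<lambda>f :: nat \<Rightarrow> real. f i)"
    by (rule continuous_on_product_coordinates)
  then show ?thesis by (intro open_Collect_less continuous_intros)
qed

text \<open>Near \<open>x\<close> only finitely many translated cells occur. A neighbourhood
  avoiding those whose closure misses \<open>x\<close> meets only cells with \<open>x\<close> in
  their closure, and these touch every cell that contains \<open>x\<close>.\<close>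

lemma neighbours:
  assumes "x \<in> tuples n" "j < J" "P j (\<lambda>i. frac (x i))"
  obtains U where "open U" "x \<in> U"
    "\<And>y k. y \<in> U \<Longrightarrow> y \<in> tuples n \<Longrightarrow> k < J \<Longrightarrow> P k (\<lambda>i. frac (y i)) \<Longrightarrow>
       (j, k, \<lambda>i. \<lfloor>y i\<rfloor> - \<lfloor>x i\<rfloor>) \<in> edges"
proof -
  \<comment> \<open>\<open>g \<delta>\<close> moves the cube displaced by \<open>\<delta>\<close>
    from that of \<open>x\<close> onto the unit cube, where the sets \<open>Q k\<close>
    live.\<close>
  define g where "g \<delta> y = (\<lambda>i. y i - of_int \<lfloor>x i\<rfloor> - of_int (\<delta> i))" for \<delta> :: "nat \<Rightarrow> int" and y :: "nat \<Rightarrow> real"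
  define bad where "bad = {b \<in> {..<J} \<times> shifts. g (snd b) x \<notin> closure (Q (fst b))}"
  define U where "U = (\<Inter>i\<in>{..<n}. {y. \<bar>y i - x i\<bar> < 1}) \<inter> (\<Inter>b\<in>bad. g (snd b) -` (- closure (Q (fst b))))"
  have "finite bad" unfolding bad_def by (simp add: finite_shifts)
  have "continuous_on UNIV (g \<delta>)" for \<delta>
    unfolding g_def
    by (intro continuous_on_coordinatewise_then_product continuous_intros continuous_on_product_coordinates)
  then have "open (g (snd b) -` (- closure (Q (fst b))))" for b
    by (intro open_vimage) auto
  then have "open U"
    unfolding U_def using \<open>finite bad\<close> by (intro open_Int open_INT ballI open_coordinate) auto
  moreover have "x \<in> U" by (auto simp: U_def bad_def)
  moreover have "(j, k, \<lambda>i. \<lfloor>y i\<rfloor> - \<lfloor>x i\<rfloor>) \<in> edges"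
    if y: "y \<in> U" "y \<in> tuples n" "k < J" "P k (\<lambda>i. frac (y i))" for y k
  proof -
    let ?\<delta> = "\<lambda>i. \<lfloor>y i\<rfloor> - \<lfloor>x i\<rfloor>"
    have "?\<delta> i \<in> {-1, 0, 1}" for i
    proof (cases "i < n")
      case True
      then have "\<bar>y i - x i\<bar> < 1" using y(1) by (simp add: U_def)
      then have "\<bar>\<lfloor>y i\<rfloor> - \<lfloor>x i\<rfloor>\<bar> \<le> 1" by linarith
      then show ?thesis by auto
    next
      case False
      then show ?thesis using assms(1) y(2) by (simp add: tuples_def)
    qed
    moreover have "?\<delta> \<in> tuples n" using assms(1) y(2) by (simp add: tuples_def)
    ultimately have \<delta>: "?\<delta> \<in> shifts" by (simp add: shifts_def)
    have "g ?\<delta> y = (\<lambda>i. y i - of_int \<lfloor>y i\<rfloor>)" by (auto simp: g_def)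
    then have "g ?\<delta> y \<in> Q k" using in_piece(1)[OF y(2,4)] by (simp add: piece_def)
    then have "g ?\<delta> y \<in> closure (Q k)" using closure_subset by blast
    then have "(k, ?\<delta>) \<notin> bad" using y(1) unfolding U_def by auto
    then have cl: "g ?\<delta> x \<in> closure (Q k)" using \<delta> y(3) unfolding bad_def by simp
    have "(\<lambda>i. g ?\<delta> x i - of_int (- ?\<delta> i)) = (\<lambda>i. x i - of_int \<lfloor>x i\<rfloor>)" by (auto simp: g_def)
    then have "(\<lambda>i. g ?\<delta> x i - of_int (- ?\<delta> i)) \<in> Q j"
      using in_piece(1)[OF assms(1,3)] by (simp add: piece_def)
    \<comment> \<open>The common point is \<open>x\<close>, in the closure of the piece of
      \<open>y\<close>; hence the edge has the reversed orientation.\<close>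
    then have "touches k j (\<lambda>i. - ?\<delta> i)" unfolding touches_def using cl by blast
    then show ?thesis using \<delta> assms(2) y(3) unfolding edges_def by blast
  qed
  ultimately show thesis by (rule that)
qed

lemma step_edge:
  assumes "(j, k, \<lambda>i. w i - z i) \<in> edges" "D j z" "D k w" "z \<in> tuples n" "w \<in> tuples n"
  shows "step (code j z) (code k w)" "step (code k w) (code j z)"
proof -
  show "step (code j z) (code k w)"
    unfolding step_code[OF assms(4)] using assms by (intro exI[of _ k] exI[of _ "\<lambda>i. w i - z i"]) simp
  have "(k, j, \<lambda>i. z i - w i) \<in> edges" using edges_sym[OF assms(1)] by simp
  then show "step (code k w) (code j z)"
    unfolding step_code[OF assms(5)] using assms by (intro exI[of _ j] exI[of _ "\<lambda>i. z i - w i"]) simp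
qed

text \<open>The cells of \<open>x\<close> and of a nearby point are joined by steps in both
  directions, so either both or none are reachable from \<open>a\<close>.\<close>

lemma locally_constant_cls:
  assumes "x \<in> E"
  obtains U where "open U" "x \<in> U" "\<And>y. y \<in> U \<Longrightarrow> y \<in> E \<Longrightarrow> y \<in> cls a \<longleftrightarrow> x \<in> cls a"
proof -
  from assms obtain j where x: "x \<in> tuples n" "j < J" "D j (\<lambda>i. \<lfloor>x i\<rfloor>)" "P j (\<lambda>i. frac (x i))"
    unfolding E_def by blast
  have to_all: "step\<^sup>*\<^sup>* a (code k (\<lambda>i. \<lfloor>y i\<rfloor>)) \<longleftrightarrow> step\<^sup>*\<^sup>* a (code j (\<lambda>i. \<lfloor>x i\<rfloor>))"
    if "(j, k, \<lambda>i. \<lfloor>y i\<rfloor> - \<lfloor>x i\<rfloor>) \<in> edges" "D k (\<lambda>i. \<lfloor>y i\<rfloor>)" "y \<in> tuples n" for y k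
  proof -
    have "(\<lambda>i. \<lfloor>x i\<rfloor>) \<in> tuples n" "(\<lambda>i. \<lfloor>y i\<rfloor>) \<in> tuples n"
      using x(1) that(3) by (simp_all add: tuples_def)
    from step_edge[OF that(1) x(3) that(2) this] show ?thesis
      by (meson rtranclp.rtrancl_into_rtrancl)
  qed
  obtain U where U: "open U" "x \<in> U"
    "\<And>y k. y \<in> U \<Longrightarrow> y \<in> tuples n \<Longrightarrow> k < J \<Longrightarrow> P k (\<lambda>i. frac (y i)) \<Longrightarrow>
       (j, k, \<lambda>i. \<lfloor>y i\<rfloor> - \<lfloor>x i\<rfloor>) \<in> edges"
    using neighbours[OF x(1,2,4)] by blast
  have *: "y \<in> cls a \<longleftrightarrow> step\<^sup>*\<^sup>* a (code j (\<lambda>i. \<lfloor>x i\<rfloor>))" if y: "y \<in> U" "y \<in> E" for y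
  proof
    assume "y \<in> cls a"
    then obtain k where "y \<in> tuples n" "k < J" "D k (\<lambda>i. \<lfloor>y i\<rfloor>)" "P k (\<lambda>i. frac (y i))"
      "step\<^sup>*\<^sup>* a (code k (\<lambda>i. \<lfloor>y i\<rfloor>))" unfolding cls_def by blast
    then show "step\<^sup>*\<^sup>* a (code j (\<lambda>i. \<lfloor>x i\<rfloor>))" using to_all U(3) y(1) by blast
  next
    assume *: "step\<^sup>*\<^sup>* a (code j (\<lambda>i. \<lfloor>x i\<rfloor>))"
    obtain k where k: "y \<in> tuples n" "k < J" "D k (\<lambda>i. \<lfloor>y i\<rfloor>)" "P k (\<lambda>i. frac (y i))"
      using y(2) unfolding E_def by blast
    then have "step\<^sup>*\<^sup>* a (code k (\<lambda>i. \<lfloor>y i\<rfloor>))" using * to_all U(3) y(1) by blast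
    then show "y \<in> cls a" using k unfolding cls_def by blast
  qed
  \<comment> \<open>The equivalence is applied to \<open>x\<close> as well, since \<open>x\<close>
    may lie in cells of types other than the chosen \<open>j\<close>.\<close>
  show thesis using that[OF U(1,2)] * U(2) assms by blast
qed

lemma clopen_cls: "openin (top_of_set E) (cls a)" "closedin (top_of_set E) (cls a)"
proof -
  have *: "openin (top_of_set E) {x \<in> E. x \<in> cls a \<longleftrightarrow> b}" for b
  proof (subst openin_subopen, intro ballI)
    fix x assume x: "x \<in> {x \<in> E. x \<in> cls a \<longleftrightarrow> b}"
    then obtain U where U: "open U" "x \<in> U" "\<And>y. y \<in> U \<Longrightarrow> y \<in> E \<Longrightarrow> y \<in> cls a \<longleftrightarrow> x \<in> cls a"
      using locally_constant_cls[of x a] by blast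
    have "openin (top_of_set E) (E \<inter> U)" using U(1) by (rule openin_open_Int)
    then show "\<exists>T. openin (top_of_set E) T \<and> x \<in> T \<and> T \<subseteq> {x \<in> E. x \<in> cls a \<longleftrightarrow> b}"
      using x U by (intro exI[of _ "E \<inter> U"]) auto
  qed
  have "{x \<in> E. x \<in> cls a \<longleftrightarrow> True} = cls a" "{x \<in> E. x \<in> cls a \<longleftrightarrow> False} = E - cls a"
    using cls_subset by auto
  then show "openin (top_of_set E) (cls a)" "closedin (top_of_set E) (cls a)"
    using *[of True] *[of False] cls_subset by (simp_all add: closedin_def)
qed

lemma definable_clopen_path_connected:
  assumes "x0 \<in> E"
  obtains C where "definable (int_expansion \<A>) n C" "x0 \<in> C" "path_connectedin (top_of_set E) C"
    "openin (top_of_set E) C" "closedin (top_of_set E) C"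
proof -
  from assms obtain j0 where x0: "x0 \<in> tuples n" "j0 < J" "D j0 (\<lambda>i. \<lfloor>x0 i\<rfloor>)" "P j0 (\<lambda>i. frac (x0 i))"
    unfolding E_def by blast
  let ?a = "code j0 (\<lambda>i. \<lfloor>x0 i\<rfloor>)"
  note p0 = in_piece[OF x0(1,4)]
  have "path_component (cls ?a) x0 x" if "x \<in> cls ?a" for x
  proof -
    from that obtain k where x: "x \<in> tuples n" "D k (\<lambda>i. \<lfloor>x i\<rfloor>)" "P k (\<lambda>i. frac (x i))"
      "step\<^sup>*\<^sup>* ?a (code k (\<lambda>i. \<lfloor>x i\<rfloor>))" unfolding cls_def by blast
    \<comment> \<open>The piece obtained has the same code as the piece containing \<open>x\<close>.
      Codes are injective on tuples, so the two pieces coincide.\<close>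
    from reachable_piece[OF x(4) x0(2) p0(2) x0(3) p0(1)] obtain j z where
      jz: "code k (\<lambda>i. \<lfloor>x i\<rfloor>) = code j z" "z \<in> tuples n"
        "\<And>x. x \<in> piece j z \<Longrightarrow> path_component (cls ?a) x0 x" by blast
    note p = in_piece[OF x(1,3)]
    have "k = j" "vec_encode n (\<lambda>i. \<lfloor>x i\<rfloor>) = vec_encode n z"
      using jz(1) by (simp_all add: code_def prod_encode_eq)
    then have "(\<lambda>i. if i < n then \<lfloor>x i\<rfloor> else 0) = (\<lambda>i. if i < n then z i else 0)"
      using vec_decode_encode by metis
    moreover have "(\<lambda>i. if i < n then w i else 0) = w" if "w \<in> tuples n" for w :: "nat \<Rightarrow> int"
      using that by (auto simp: tuples_def)
    ultimately have "(\<lambda>i. \<lfloor>x i\<rfloor>) = z" using p(2) jz(2) by metis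
    then show ?thesis using jz(3) p(1) \<open>k = j\<close> by simp
  qed
  then have "path_connected (cls ?a)"
    unfolding path_connected_component by (meson path_component_sym path_component_trans)
  then have "path_connectedin (top_of_set E) (cls ?a)"
    using cls_subset by (auto simp: path_connectedin_subtopology)
  moreover have "x0 \<in> cls ?a" using x0 unfolding cls_def by blast
  ultimately show thesis using that definable_cls clopen_cls by blast
qed

end

section \<open>The equivalence for the three notions of component\<close>

lemma component_closed_if_def_mult:
  assumes "def_mult (int_expansion \<A>)"
  shows "PCC (int_expansion \<A>)" "CC (int_expansion \<A>)" "QCC (int_expansion \<A>)"
proof -
  have *: "definable (int_expansion \<A>) n (path_component_of_set (subtopology (Euclidean_space n) E) x) \<and>
      definable (int_expansion \<A>) n (connected_component_of_set (subtopology (Euclidean_space n) E) x) \<and>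
      definable (int_expansion \<A>) n (quasi_component_of_set (subtopology (Euclidean_space n) E) x)"
    if E: "definable (int_expansion \<A>) n E" and x: "x \<in> topspace (subtopology (Euclidean_space n) E)"
    for n E x
  proof -
    obtain J :: nat and D P where cells:
      "\<And>j. dpred (int_expansion \<A>) (\<lambda>e. D j (\<lambda>i. \<lfloor>e i\<rfloor>))"
      "\<And>j. dpred (int_expansion \<A>) (P j)" "\<And>j. closure_accessible {f. P j f}"
      "E = {x \<in> tuples n. \<exists>j<J. D j (\<lambda>i. \<lfloor>x i\<rfloor>) \<and> P j (\<lambda>i. frac (x i))}"
      using E by (rule definable_cells) (rule that)
    interpret cell_union \<A> n J D P by unfold_locales (fact cells assms)+
    have E: "E = cell_union.E n J D P" unfolding E_def by (rule cells(4))
    have sub: "E \<subseteq> tuples n" unfolding cells(4) by blast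
    have "x \<in> cell_union.E n J D P" using x E by simp
    then obtain C where C: "definable (int_expansion \<A>) n C" "x \<in> C"
      "path_connectedin (top_of_set E) C" "openin (top_of_set E) C" "closedin (top_of_set E) C"
      unfolding E by (rule definable_clopen_path_connected)
    show ?thesis
      unfolding subtopology_Euclidean_space[OF sub]
      using clopen_path_connected_component[OF C(3-5,2)] C(1) by simp
  qed
  show "PCC (int_expansion \<A>)" "CC (int_expansion \<A>)" "QCC (int_expansion \<A>)"
    unfolding PCC_def CC_def QCC_def path_components_of_def connected_components_of_def
      quasi_components_of_def
    using * by blast+
qed

theorem theorem1p9:
  fixes \<A> :: "(nat \<times> (nat \<Rightarrow> int) set) set"
  assumes "\<And>n A. (n, A) \<in> \<A> \<Longrightarrow> A \<subseteq> tuples n"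
  shows "(PCC (int_expansion \<A>) \<longleftrightarrow> defines_all_arithmetic (int_expansion \<A>)) \<and>
         (CC (int_expansion \<A>) \<longleftrightarrow> defines_all_arithmetic (int_expansion \<A>)) \<and>
         (QCC (int_expansion \<A>) \<longleftrightarrow> defines_all_arithmetic (int_expansion \<A>))"
proof -
  have "defines_all_arithmetic (int_expansion \<A>) \<longleftrightarrow> def_mult (int_expansion \<A>)"
    using defines_all_arithmetic_if_def_mult def_mult_if_defines_all_arithmetic by blast
  then show ?thesis
    using component_closed_if_def_mult def_mult_if_component_closed by blast
qed

end
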